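(* Let $G$ be a group which is not a $CL$-group but all of whose proper subgroups are $CL$-groups (an $MNCL$-group). Then $G$ is an $MNCC$-group, i.e. $G$ is not a $CC$-group but all proper subgroups of $G$ are $CC$-groups.
   Context: A Chernikov group is a group that is a finite extension of a direct product of finitely many quasicyclic (Prüfer) groups (finite groups included). For $m$ a positive integer or $\infty$, the $m$-layer $G_m$ of a group $G$ is the subgroup generated by all elements of $G$ of order $m$. A group $G$ is a $CL$-group if $G_m$ is a Chernikov group for every $m$ (positive integer or $\infty$). A group $G$ is a $CC$-group (group with Chernikov conjugacy classes) if $G/C_G(\langle x\rangle^G)$ is a Chernikov group for every $x\in G$, where $C_G(\langle x\rangle^G)$ is the centralizer in $G$ of the normal closure $\langle x\rangle^G$ of $\langle x\rangle$ in $G$. For a class $\mathcal{X}$ of groups, a minimal non-$\mathcal{X}$-group is a group that is not an $\mathcal{X}$-group but all of whose proper subgroups are $\mathcal{X}$-groups; $MNCL$ and $MNCC$ refer to $\mathcal{X}$ being the class of $CL$-groups and of $CC$-groups respectively. *)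

theory Defs
  imports
    Complex_Main
    "HOL-Computational_Algebra.Primes"
    "HOL-Algebra.Product_Groups"
    "HOL-Algebra.Generated_Groups"
    "HOL-Algebra.Multiplicative_Group"
    "HOL-Library.Extended_Nat"
begin

text \<open>The quasicyclic group of type \<open>p\<^sup>\<infinity>\<close>, realised as the complex roots of unity of
  \<open>p\<close>-power order under multiplication.\<close>

definition pruefer_group :: "nat \<Rightarrow> complex monoid" where
  "pruefer_group p =
     \<lparr>carrier = {z. \<exists>n::nat. z ^ (p ^ n) = 1}, monoid.mult = (*), one = 1\<rparr>"

text \<open>The primes \<open>p i\<close> need not be distinct. For \<open>k = 0\<close> the product is the trivial group, so finite
  groups are included.\<close>

definition chernikov_group :: "('a, 'b) monoid_scheme \<Rightarrow> bool" where
  "chernikov_group G \<longleftrightarrow>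
     group G \<and>
     (\<exists>N. N \<lhd> G \<and> finite (carrier (G Mod N)) \<and>
        (\<exists>(k::nat) (p :: nat \<Rightarrow> nat).
           (\<forall>i<k. prime (p i)) \<and>
           G\<lparr>carrier := N\<rparr> \<cong> product_group {..<k} (\<lambda>i. pruefer_group (p i))))"

text \<open>In \<^theory>\<open>HOL-Algebra.Multiplicative_Group\<close> elements of infinite order have
  \<open>ord\<close> equal to \<open>0\<close>.\<close>

definition element_order :: "('a, 'b) monoid_scheme \<Rightarrow> 'a \<Rightarrow> enat" where
  "element_order G x = (if group.ord G x = 0 then \<infinity> else enat (group.ord G x))"

definition layer :: "('a, 'b) monoid_scheme \<Rightarrow> enat \<Rightarrow> 'a set" where
  "layer G m = generate G {x \<in> carrier G. element_order G x = m}"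

definition CL_group :: "('a, 'b) monoid_scheme \<Rightarrow> bool" where
  "CL_group G \<longleftrightarrow>
     group G \<and> (\<forall>m::enat. m > 0 \<longrightarrow> chernikov_group (G\<lparr>carrier := layer G m\<rparr>))"

definition normal_closure :: "('a, 'b) monoid_scheme \<Rightarrow> 'a set \<Rightarrow> 'a set" where
  "normal_closure G S = \<Inter>{N. N \<lhd> G \<and> S \<subseteq> N}"

definition centralizer :: "('a, 'b) monoid_scheme \<Rightarrow> 'a set \<Rightarrow> 'a set" where
  "centralizer G S = {g \<in> carrier G. \<forall>s\<in>S. g \<otimes>\<^bsub>G\<^esub> s = s \<otimes>\<^bsub>G\<^esub> g}"

definition CC_group :: "('a, 'b) monoid_scheme \<Rightarrow> bool" where
  "CC_group G \<longleftrightarrow>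
     group G \<and>
     (\<forall>x \<in> carrier G.
        chernikov_group (G Mod centralizer G (normal_closure G (generate G {x}))))"

definition minimal_non ::
    "(('a, 'b) monoid_scheme \<Rightarrow> bool) \<Rightarrow> ('a, 'b) monoid_scheme \<Rightarrow> bool" where
  "minimal_non X G \<longleftrightarrow>
     group G \<and> \<not> X G \<and> (\<forall>H. subgroup H G \<and> H \<noteq> carrier G \<longrightarrow> X (G\<lparr>carrier := H\<rparr>))"

end

theory Submission
  imports Defs "HOL-Number_Theory.Cong"
begin

text \<open>
  Proper subgroups of a minimal non-\<open>CL\<close>-group \<open>G\<close> are \<open>CL\<close>-groups, and \<open>CL\<close>-groups are
  \<open>CC\<close>-groups; so the point is that \<open>G\<close> itself is not a \<open>CC\<close>-group.

  Chernikov groups enter only through an elementary description: there is a normal divisible abelian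
  subgroup \<open>D\<close> of finite index, involving finitely many primes, that has finitely many elements of
  each order. Conversely, a normal abelian subgroup \<open>A\<close> of finite index makes a group Chernikov
  as soon as, for some \<open>n > 0\<close>, each element of \<open>A\<close> has order dividing a power of \<open>n\<close> and
  only finitely many have order dividing \<open>n\<close> (\<open>chernikov_subgroupI\<close>, \<open>chernikov_subgroupE\<close>).
  A divisible group of this kind is built up to a product of quasicyclic groups one factor at a time.

  The tool behind everything else is rigidity (\<open>centralizes_divisible\<close>): an automorphism of finite
  order of \<open>D\<close> that fixes the elements of order dividing \<open>n\<^sup>2\<close> is trivial. It yields
  two facts: the product of two normal Chernikov subgroups is Chernikov, and in a periodic group
  \<open>G\<close> the quotient \<open>G / C\<^sub>G(M)\<close> is Chernikov for each normal subgroup \<open>M\<close> contained in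
  a normal Chernikov subgroup. The second one, applied to \<open>M = \<langle>x\<rangle>\<^sup>G\<close> inside
  the layer of the order of \<open>x\<close>, shows that \<open>CL\<close>-groups are \<open>CC\<close>-groups.

  Now let \<open>G\<close> be a \<open>CC\<close>-group all of whose proper subgroups are \<open>CL\<close>-groups, and suppose
  that some layer is not Chernikov. Then \<open>G\<close> is periodic, and \<open>G\<close> equals that layer, since
  otherwise the layer would be a \<open>CL\<close>-group equal to one of its own layers. So \<open>G\<close> is generated by
  elements of order \<open>m\<close>, \<open>m\<close> finite, and is not Chernikov.

  If \<open>\<langle>x\<rangle>\<^sup>G = G\<close> for some \<open>x\<close>, then \<open>G / Z(G)\<close> is Chernikov, hence
  \<open>G\<close> has a normal abelian subgroup \<open>E\<close> of finite index \<open>k\<close> containing \<open>Z(G)\<close>. The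
  transfer into \<open>E\<close> has values of order dividing \<open>m\<close> and maps a central \<open>z\<close> to
  \<open>z\<^sup>k\<close>, so \<open>Z(G)\<close> has exponent dividing \<open>k m\<close>. If \<open>E\<close> is proper, it is a \<open>CL\<close>-group
  with finitely many elements of each order, and \<open>G\<close> is Chernikov; if \<open>E = G\<close>, then \<open>G\<close> is
  cyclic and periodic, so finite.

  Otherwise each \<open>\<langle>x\<rangle>\<^sup>G\<close> is a proper subgroup, hence a \<open>CL\<close>-group equal to one of its
  own layers, hence Chernikov. The \<open>CC\<close>-property gives a proper normal subgroup \<open>H\<close> of finite
  index, and then \<open>G = H K\<close> for a normal Chernikov subgroup \<open>K\<close>, with divisible part
  \<open>D \<subseteq> H\<close>. Each generator \<open>g = h r\<close>, with \<open>h \<in> H\<close> and \<open>r \<in> K\<close>, has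
  \<open>h\<^sup>M \<in> D\<close> for a fixed \<open>M\<close>, and multiplying \<open>h\<close> by a suitable element of \<open>D\<close>
  makes its order divide \<open>M\<^sup>2\<close> (\<open>bounded_order_correction\<close>). So \<open>G\<close> is the product of \<open>K\<close>
  and finitely many layers of the \<open>CL\<close>-group \<open>H\<close>, and is Chernikov after all.
\<close>

section \<open>Preliminaries on groups\<close>

lemma (in group) power_mem_subgroup:
  assumes "subgroup H G" "x \<in> H"
  shows "x [^] (n::nat) \<in> H"
  using subgroup_int_pow_closed[OF assms, of "int n"] by (simp add: int_pow_int)

lemma (in group) inv_mult_cancel [simp]:
  assumes "x \<in> carrier G" "y \<in> carrier G"
  shows "inv x \<otimes> (x \<otimes> y) = y" "x \<otimes> (inv x \<otimes> y) = y"
  using assms by (simp_all flip: m_assoc)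

lemma (in group) conj_nat_pow:
  assumes "x \<in> carrier G" "d \<in> carrier G"
  shows "x \<otimes> d [^] (m::nat) \<otimes> inv x = (x \<otimes> d \<otimes> inv x) [^] m"
proof (induction m)
  case 0
  then show ?case using assms by simp
next
  case (Suc m)
  have "x \<otimes> d [^] Suc m \<otimes> inv x = (x \<otimes> d [^] m \<otimes> inv x) \<otimes> (x \<otimes> d \<otimes> inv x)"
    using assms by (simp add: m_assoc)
  then show ?case by (simp add: Suc)
qed

lemma (in group) conj_eq_iff_commute:
  assumes "x \<in> carrier G" "d \<in> carrier G"
  shows "x \<otimes> d \<otimes> inv x = d \<longleftrightarrow> x \<otimes> d = d \<otimes> x"
proof
  assume "x \<otimes> d \<otimes> inv x = d"
  then have "(x \<otimes> d \<otimes> inv x) \<otimes> x = d \<otimes> x" by simp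
  then show "x \<otimes> d = d \<otimes> x" using assms by (simp add: m_assoc)
next
  assume "x \<otimes> d = d \<otimes> x"
  then show "x \<otimes> d \<otimes> inv x = d" using assms by (simp add: m_assoc)
qed

lemma (in group) pow_eq_iff_cong:
  assumes "x \<in> carrier G"
  shows "x [^] (a::nat) = x [^] b \<longleftrightarrow> [a = b] (mod ord x)"
proof -
  have "x [^] a = x [^] b \<longleftrightarrow> x [^] int a = x [^] int b" by (simp add: int_pow_int)
  also have "\<dots> \<longleftrightarrow> [int a = int b] (mod int (ord x))"
    using assms by (simp add: int_pow_eq cong_iff_dvd_diff dvd_diff_commute)
  finally show ?thesis by (simp add: cong_int_iff)
qed

lemma (in group) comm_group_subgroup:
  assumes "subgroup A G" "\<And>a b. a \<in> A \<Longrightarrow> b \<in> A \<Longrightarrow> a \<otimes> b = b \<otimes> a"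
  shows "comm_group (G\<lparr>carrier := A\<rparr>)"
proof -
  interpret A: group "G\<lparr>carrier := A\<rparr>" using assms(1) by (rule subgroup_imp_group)
  show ?thesis by (rule A.group_comm_groupI) (use assms in auto)
qed

lemma mem_set_multI: "p \<in> P \<Longrightarrow> q \<in> Q \<Longrightarrow> p \<otimes>\<^bsub>G\<^esub> q \<in> P <#>\<^bsub>G\<^esub> Q"
  by (auto simp: set_mult_def)

lemma (in group) normal_set_mult:
  assumes P: "P \<lhd> G" and Q: "Q \<lhd> G"
  shows "P <#> Q \<lhd> G"
proof (rule normal_invI)
  note P' = normal_invE[OF P] and Q' = normal_invE[OF Q]
  note PG = subgroup.mem_carrier[OF P'(1)] and QG = subgroup.mem_carrier[OF Q'(1)]
  show "subgroup (P <#> Q) G"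
  proof (rule subgroupI)
    show "P <#> Q \<subseteq> carrier G" using PG QG by (auto simp: set_mult_def)
    show "P <#> Q \<noteq> {}"
      using subgroup.one_closed[OF P'(1)] subgroup.one_closed[OF Q'(1)] by (auto simp: set_mult_def)
    show "inv a \<in> P <#> Q" if a: "a \<in> P <#> Q" for a
    proof -
      obtain p q where pq: "p \<in> P" "q \<in> Q" "a = p \<otimes> q" using a by (auto simp: set_mult_def)
      have "inv a = inv p \<otimes> (p \<otimes> inv q \<otimes> inv p)" using pq PG QG by (simp add: inv_mult_group m_assoc)
      also have "\<dots> \<in> P <#> Q"
        using mem_set_multI[OF subgroup.m_inv_closed[OF P'(1) pq(1)] Q'(2)[OF PG[OF pq(1)] subgroup.m_inv_closed[OF Q'(1) pq(2)]]] .
      finally show ?thesis .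
    qed
    show "a \<otimes> b \<in> P <#> Q" if a: "a \<in> P <#> Q" and b: "b \<in> P <#> Q" for a b
    proof -
      obtain p q where pq: "p \<in> P" "q \<in> Q" "a = p \<otimes> q" using a by (auto simp: set_mult_def)
      obtain r s where rs: "r \<in> P" "s \<in> Q" "b = r \<otimes> s" using b by (auto simp: set_mult_def)
      have "a \<otimes> b = (p \<otimes> (q \<otimes> r \<otimes> inv q)) \<otimes> (q \<otimes> s)" using pq rs PG QG by (simp add: m_assoc)
      also have "\<dots> \<in> P <#> Q"
        using mem_set_multI[OF subgroup.m_closed[OF P'(1) pq(1) P'(2)[OF QG[OF pq(2)] rs(1)]] subgroup.m_closed[OF Q'(1) pq(2) rs(2)]] .
      finally show ?thesis .
    qed
  qed
  show "x \<otimes> a \<otimes> inv x \<in> P <#> Q" if x: "x \<in> carrier G" and a: "a \<in> P <#> Q" for x a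
  proof -
    obtain p q where pq: "p \<in> P" "q \<in> Q" "a = p \<otimes> q" using a by (auto simp: set_mult_def)
    have "x \<otimes> a \<otimes> inv x = (x \<otimes> p \<otimes> inv x) \<otimes> (x \<otimes> q \<otimes> inv x)" using pq PG QG x by (simp add: m_assoc)
    also have "\<dots> \<in> P <#> Q" using mem_set_multI[OF P'(2)[OF x pq(1)] Q'(2)[OF x pq(2)]] .
    finally show ?thesis .
  qed
qed

lemma (in normal) group_hom_FactGroup: "group_hom G (G Mod H) (\<lambda>g. H #> g)"
  by (intro group_hom.intro group_hom_axioms.intro r_coset_hom_Mod factorgroup_is_group) (rule is_group)

lemma (in normal) rcos_eq_one_FactGroup_iff:
  "g \<in> carrier G \<Longrightarrow> H #> g = \<one>\<^bsub>G Mod H\<^esub> \<longleftrightarrow> g \<in> H"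
  using coset_join1[OF _ _ subgroup_axioms] coset_join2[OF _ subgroup_axioms] by auto

section \<open>Quasicyclic groups\<close>

lemma carrier_pruefer_group [simp]: "carrier (pruefer_group p) = {z. \<exists>n::nat. z ^ (p ^ n) = 1}"
  and mult_pruefer_group [simp]: "monoid.mult (pruefer_group p) = (*)"
  and one_pruefer_group [simp]: "one (pruefer_group p) = 1"
  by (simp_all add: pruefer_group_def)

lemma comm_group_pruefer_group:
  assumes "prime p"
  shows "comm_group (pruefer_group p)"
proof (rule comm_groupI)
  have p: "p > 0" using assms by (simp add: prime_gt_0_nat)
  show "x \<otimes>\<^bsub>pruefer_group p\<^esub> y \<in> carrier (pruefer_group p)"
    if xy: "x \<in> carrier (pruefer_group p)" "y \<in> carrier (pruefer_group p)" for x y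
  proof -
    obtain m n where mn: "x ^ (p ^ m) = 1" "y ^ (p ^ n) = 1" using xy by auto
    have "(x * y) ^ (p ^ (m + n)) = (x ^ (p ^ m)) ^ (p ^ n) * (y ^ (p ^ n)) ^ (p ^ m)"
      by (simp add: power_mult_distrib power_add mult.commute flip: power_mult)
    then show ?thesis using mn by (auto intro!: exI[of _ "m + n"])
  qed
  show "\<exists>y\<in>carrier (pruefer_group p). y \<otimes>\<^bsub>pruefer_group p\<^esub> x = \<one>\<^bsub>pruefer_group p\<^esub>"
    if x: "x \<in> carrier (pruefer_group p)" for x
  proof -
    obtain m where m: "x ^ (p ^ m) = 1" using x by auto
    then have "x \<noteq> 0" using p by (metis power_0_left power_eq_0_iff zero_neq_one not_gr_zero)
    then show ?thesis using m by (auto intro!: exI[of _ "inverse x"] exI[of _ m] simp: power_inverse)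
  qed
qed (auto simp: mult.assoc mult.commute)

lemma nat_pow_pruefer_group [simp]: "x [^]\<^bsub>pruefer_group p\<^esub> (n::nat) = x ^ n"
  by (induction n) (simp_all add: mult.commute)

text \<open>A complex \<open>N\<close>-th root \<open>w\<close> of \<open>z\<close> need not have \<open>p\<close>-power order. Writing \<open>N = p\<^sup>a M\<close>
  with \<open>M\<close> prime to \<open>p\<close>, the power \<open>w\<^bsup>M u\<^esup>\<close> does, where \<open>u\<close> inverts \<open>M\<close> modulo a
  sufficiently high power of \<open>p\<close>.\<close>

lemma divisible_pruefer_group:
  assumes p: "prime p" and N: "N > 0" and z: "z \<in> carrier (pruefer_group p)"
  shows "\<exists>w\<in>carrier (pruefer_group p). w [^]\<^bsub>pruefer_group p\<^esub> (N::nat) = z"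
proof -
  obtain n where n: "z ^ (p ^ n) = 1" using z by auto
  have p0: "p > 0" using p by (simp add: prime_gt_0_nat)
  then have z0: "z \<noteq> 0" using n by (metis power_0_left power_eq_0_iff zero_neq_one not_gr_zero)
  define a M where "a = multiplicity p N" and "M = N div p ^ a"
  have NM: "N = p ^ a * M" unfolding M_def a_def by (simp add: multiplicity_dvd)
  have "coprime M (p ^ (a + n))"
    using p N unfolding M_def a_def
    by (metis coprime_commute coprime_power_left_iff multiplicity_decompose not_prime_unit prime_imp_coprime
        bot_nat_0.not_eq_extremum)
  then obtain u where u: "[M * u = 1] (mod p ^ (a + n))" using cong_solve_coprime_nat by fastforce
  obtain w where w: "w ^ N = z"
  proof -
    have "card {w. w ^ N = z} = N" using card_nth_roots[OF z0 N] .
    then have "{w. w ^ N = z} \<noteq> {}" using N by (metis card.empty less_numeral_extra(3))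
    then show ?thesis using that by auto
  qed
  have "[M * u = 1] (mod p ^ n)" by (rule cong_dvd_modulus_nat[OF u]) (simp add: power_add)
  moreover have red: "z ^ x = z ^ (x mod p ^ n)" for x
  proof -
    have "z ^ x = z ^ (p ^ n * (x div p ^ n) + x mod p ^ n)" by simp
    also have "\<dots> = z ^ (x mod p ^ n)" by (simp only: power_add power_mult n power_one mult_1)
    finally show ?thesis .
  qed
  ultimately have "z ^ (M * u) = z ^ 1" unfolding cong_def by metis
  then have "z ^ (M * u) = z" by simp
  moreover have "w ^ (M * u * N) = z ^ (M * u)" by (simp add: w mult.commute[of _ N] power_mult)
  ultimately have 1: "(w ^ (M * u)) ^ N = z" by (simp add: power_mult)
  have "(w ^ (M * u)) ^ (p ^ (a + n)) = ((w ^ N) ^ (p ^ n)) ^ u"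
    by (simp add: NM power_add mult_ac flip: power_mult)
  also have "\<dots> = 1" by (simp add: w n)
  finally show ?thesis using 1 by (auto intro!: bexI[of _ "w ^ (M * u)"])
qed

text \<open>A root chain is a sequence \<open>\<beta> 0 = \<one>, \<beta> 1, \<beta> 2, \<dots>\<close> in which each term is the
  \<open>p\<close>-th power of the next. If \<open>\<beta> 1 \<noteq> \<one>\<close>, then \<open>\<beta> j\<close> has order \<open>p\<^sup>j\<close>, and
  the relations among powers of the terms depend on \<open>p\<close> only (\<open>root_chain_eq_iff\<close>). This makes the
  assignment of a root chain in one group to one in another a well-defined injection.\<close>

lemma (in group) root_chain_pow:
  assumes \<beta>: "\<And>j. \<beta> j \<in> carrier G" and step: "\<And>j. \<beta> (Suc j) [^] (p::nat) = \<beta> j"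
  shows "\<beta> (i + j) [^] (p ^ i) = \<beta> j"
proof (induction i)
  case (Suc i)
  have "\<beta> (Suc i + j) [^] (p ^ Suc i) = (\<beta> (Suc (i + j)) [^] p) [^] (p ^ i)"
    using \<beta> by (simp add: nat_pow_pow)
  then show ?case by (simp add: step Suc)
qed (simp add: \<beta>)

lemma (in group) ord_root_chain:
  assumes p: "prime p" and \<beta>: "\<And>j. \<beta> j \<in> carrier G" and step: "\<And>j. \<beta> (Suc j) [^] (p::nat) = \<beta> j"
    and "\<beta> 0 = \<one>" "\<beta> (Suc 0) \<noteq> \<one>"
  shows "ord (\<beta> j) = p ^ j"
proof (cases j)
  case 0
  then show ?thesis using assms by simp
next
  case (Suc i)
  have "\<beta> j [^] (p ^ j) = \<one>" using root_chain_pow[where \<beta>=\<beta> and i=j and j=0, OF \<beta> step] assms by simp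
  then have "ord (\<beta> j) dvd p ^ j" using \<beta> pow_eq_id by simp
  then obtain k where k: "k \<le> j" "ord (\<beta> j) = p ^ k" using p by (auto simp: divides_primepow_nat)
  have "\<beta> j [^] (p ^ i) = \<beta> (Suc 0)"
    using root_chain_pow[where \<beta>=\<beta> and i=i and j="Suc 0", OF \<beta> step] Suc by simp
  then have "\<not> p ^ k dvd p ^ i" using assms(5) k \<beta> pow_eq_id by metis
  then have "k > i" by (meson le_imp_power_dvd not_less)
  then have "k = j" using k Suc by simp
  then show ?thesis using k by simp
qed

lemma (in group) root_chain_eq_iff:
  assumes p: "prime p" and \<beta>: "\<And>j. \<beta> j \<in> carrier G" and step: "\<And>j. \<beta> (Suc j) [^] (p::nat) = \<beta> j"
    and "\<beta> 0 = \<one>" "\<beta> (Suc 0) \<noteq> \<one>"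
  shows "\<beta> i [^] (a::nat) = \<beta> j [^] b \<longleftrightarrow> [p ^ j * a = p ^ i * b] (mod p ^ (i + j))"
proof -
  have "\<beta> i [^] a = \<beta> (i + j) [^] (p ^ j * a)"
    using root_chain_pow[where \<beta>=\<beta> and i=j and j=i, OF \<beta> step] \<beta>
    by (simp add: add.commute flip: nat_pow_pow)
  moreover have "\<beta> j [^] b = \<beta> (i + j) [^] (p ^ i * b)"
    using root_chain_pow[where \<beta>=\<beta> and i=i and j=j, OF \<beta> step] \<beta>
    by (simp flip: nat_pow_pow)
  ultimately show ?thesis
    using pow_eq_iff_cong[OF \<beta>] ord_root_chain[OF assms] by simp
qed

lemma (in comm_group) root_chain_mult:
  assumes \<beta>: "\<And>j. \<beta> j \<in> carrier G" and step: "\<And>j. \<beta> (Suc j) [^] (p::nat) = \<beta> j"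
  shows "\<beta> i [^] (a::nat) \<otimes> \<beta> j [^] b = \<beta> (i + j) [^] (p ^ j * a + p ^ i * b)"
proof -
  have "\<beta> i [^] a = \<beta> (i + j) [^] (p ^ j * a)"
    using root_chain_pow[where \<beta>=\<beta> and i=j and j=i, OF \<beta> step] \<beta>
    by (simp add: add.commute flip: nat_pow_pow)
  moreover have "\<beta> j [^] b = \<beta> (i + j) [^] (p ^ i * b)"
    using root_chain_pow[where \<beta>=\<beta> and i=i and j=j, OF \<beta> step] \<beta>
    by (simp flip: nat_pow_pow)
  ultimately show ?thesis using \<beta> by (simp add: nat_pow_mult)
qed

text \<open>The quasicyclic group is the union of the cyclic groups generated by a root chain.\<close>

lemma pruefer_group_root_chain:
  assumes p: "prime p"
  obtains \<omega> where "\<And>j. \<omega> j \<in> carrier (pruefer_group p)" "\<And>j. \<omega> (Suc j) ^ p = \<omega> j" "\<omega> 0 = 1"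
    "\<omega> (Suc 0) \<noteq> 1" "\<And>z j. z ^ (p ^ j) = 1 \<Longrightarrow> \<exists>a. z = \<omega> j ^ a"
proof
  define \<omega> where "\<omega> = (\<lambda>j. cis (2 * pi / real (p ^ j)))"
  have p0: "p > 1" using p by (rule prime_gt_1_nat)
  show "\<omega> j \<in> carrier (pruefer_group p)" for j
    using p0 by (auto intro!: exI[of _ j] simp: \<omega>_def DeMoivre)
  show "\<omega> (Suc j) ^ p = \<omega> j" for j using p0 by (simp add: \<omega>_def DeMoivre field_simps)
  show "\<omega> 0 = 1" by (simp add: \<omega>_def)
  show roots: "\<exists>a. z = \<omega> j ^ a" if "z ^ (p ^ j) = 1" for z j
  proof -
    have "z \<in> (\<lambda>k. cis (2 * pi * real k / real (p ^ j))) ` {..<p ^ j}"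
      using bij_betw_roots_unity[of "p ^ j"] that p0 by (simp add: bij_betw_def)
    then obtain k where "z = cis (2 * pi * real k / real (p ^ j))" by auto
    then have "z = \<omega> j ^ k" by (simp add: \<omega>_def DeMoivre mult_ac)
    then show ?thesis ..
  qed
  show "\<omega> (Suc 0) \<noteq> 1"
  proof
    assume "\<omega> (Suc 0) = 1"
    then have "{z::complex. z ^ p = 1} \<subseteq> {1}" using roots[of _ "Suc 0"] by auto
    then have "card {z::complex. z ^ p = 1} \<le> 1" by (metis card_mono card.empty card_insert_disjoint finite.emptyI finite.insertI One_nat_def empty_iff)
    then show False using card_roots_unity_eq[of p] p0 by simp
  qed
qed

text \<open>In an abelian group divisible by \<open>p\<close>, each element of order \<open>p\<close> lies in a quasicyclic
  subgroup: extend it to a root chain, and send a root chain of the quasicyclic group to this one.\<close>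

lemma (in comm_group) pruefer_group_embedding:
  assumes p: "prime p" and e: "e \<in> carrier G" "e \<noteq> \<one>" "e [^] (p::nat) = \<one>"
    and div: "\<And>x. x \<in> carrier G \<Longrightarrow> \<exists>y\<in>carrier G. y [^] p = x"
  obtains \<phi> where "\<phi> \<in> hom (pruefer_group p) G" "inj_on \<phi> (carrier (pruefer_group p))"
    "e \<in> \<phi> ` carrier (pruefer_group p)" "\<And>w. w ^ p = 1 \<Longrightarrow> \<exists>a::nat. \<phi> w = e [^] a"
proof -
  interpret P: comm_group "pruefer_group p" using comm_group_pruefer_group[OF p] .
  obtain \<omega> where \<omega>: "\<And>j. \<omega> j \<in> carrier (pruefer_group p)" "\<And>j. \<omega> (Suc j) ^ p = \<omega> j" "\<omega> 0 = 1"
    "\<omega> (Suc 0) \<noteq> 1" "\<And>z j. z ^ (p ^ j) = 1 \<Longrightarrow> \<exists>a. z = \<omega> j ^ a"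
    using pruefer_group_root_chain[OF p] by metis
  obtain r where r: "\<And>x. x \<in> carrier G \<Longrightarrow> r x \<in> carrier G \<and> r x [^] p = x"
    using div by metis
  \<comment> \<open>the chain starts \<open>\<one>, e\<close>: at step \<open>0\<close> the chosen root of \<open>\<one>\<close> must be \<open>e\<close>\<close>
  define \<beta> where "\<beta> = rec_nat \<one> (\<lambda>j x. if j = 0 then e else r x)"
  have b0: "\<beta> 0 = \<one>" "\<beta> (Suc 0) = e" by (simp_all add: \<beta>_def)
  have b1: "\<beta> (Suc j) = (if j = 0 then e else r (\<beta> j))" for j by (simp add: \<beta>_def)
  have bc: "\<beta> j \<in> carrier G" for j by (induction j) (use b0 b1 e r in auto)
  have bs: "\<beta> (Suc j) [^] p = \<beta> j" for j using b0 b1 e r bc by auto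
  have eq: "\<beta> i [^] a = \<beta> j [^] b \<longleftrightarrow> \<omega> i ^ a = \<omega> j ^ b" for i a j b
    using root_chain_eq_iff[OF p, of \<beta>, OF bc bs b0(1)] b0(2) e(2)
      P.root_chain_eq_iff[OF p, of \<omega>] \<omega>(1-4) by simp
  define \<phi> where "\<phi> z = (case (SOME (j, a). z = \<omega> j ^ a) of (j, a) \<Rightarrow> \<beta> j [^] a)" for z
  have \<phi>: "\<phi> (\<omega> j ^ a) = \<beta> j [^] a" for j a
  proof -
    obtain i b where ib: "(SOME (i, b). \<omega> j ^ a = \<omega> i ^ b) = (i, b)" by fastforce
    then have "\<omega> j ^ a = \<omega> i ^ b"
      using someI[of "\<lambda>(i, b). \<omega> j ^ a = \<omega> i ^ b" "(j, a)"] by simp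
    then have "\<beta> j [^] a = \<beta> i [^] b" using eq by blast
    moreover have "\<phi> (\<omega> j ^ a) = \<beta> i [^] b" unfolding \<phi>_def ib by simp
    ultimately show ?thesis by simp
  qed
  have ex: "\<exists>j a. z = \<omega> j ^ a" if z: "z \<in> carrier (pruefer_group p)" for z
  proof -
    obtain n where n: "z ^ (p ^ n) = 1" using z by auto
    show ?thesis using \<omega>(5)[OF n] by blast
  qed
  show thesis
  proof
    show "\<phi> \<in> hom (pruefer_group p) G"
    proof (rule homI)
      show "\<phi> x \<in> carrier G" if "x \<in> carrier (pruefer_group p)" for x
        using ex[OF that] \<phi> bc by auto
      show "\<phi> (x \<otimes>\<^bsub>pruefer_group p\<^esub> y) = \<phi> x \<otimes> \<phi> y"
        if x: "x \<in> carrier (pruefer_group p)" and y: "y \<in> carrier (pruefer_group p)" for x y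
      proof -
        obtain i a j b where xy: "x = \<omega> i ^ a" "y = \<omega> j ^ b" using ex[OF x] ex[OF y] by auto
        then have "x * y = \<omega> (i + j) ^ (p ^ j * a + p ^ i * b)"
          using P.root_chain_mult[of \<omega> p i a j b] \<omega>(1,2) by simp
        then show ?thesis using root_chain_mult[of \<beta> p i a j b] bc bs \<phi> xy by simp
      qed
    qed
    show "inj_on \<phi> (carrier (pruefer_group p))"
      by (rule inj_onI) (metis ex \<phi> eq)
    show "e \<in> \<phi> ` carrier (pruefer_group p)"
      using \<phi>[of "Suc 0" 1] \<omega>(1)[of "Suc 0"] b0 e by (metis imageI nat_pow_eone power_one_right)
    show "\<exists>a::nat. \<phi> w = e [^] a" if w: "w ^ p = 1" for w
    proof -
      obtain a where "w = \<omega> (Suc 0) ^ a" using \<omega>(5)[of w "Suc 0"] w by auto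
      then show ?thesis using \<phi>[of "Suc 0" a] b0(2) by auto
    qed
  qed
qed

section \<open>Finite products of quasicyclic groups\<close>

lemma nat_pow_product_group:
  assumes "x \<in> carrier (product_group I H)" "\<And>i. i \<in> I \<Longrightarrow> group (H i)"
  shows "x [^]\<^bsub>product_group I H\<^esub> (n::nat) = (\<lambda>i\<in>I. x i [^]\<^bsub>H i\<^esub> n)"
  using assms by (induction n) (auto simp: fun_eq_iff)

text \<open>Each nontrivial subgroup of a quasicyclic group contains all elements of order \<open>p\<close>. So a
  subgroup that avoids \<open>e\<close> meets the quasicyclic group over \<open>e\<close> trivially.\<close>

lemma (in comm_group) pruefer_group_embedding_meets_trivially:
  assumes p: "prime p" and \<phi>: "\<phi> \<in> hom (pruefer_group p) G" "inj_on \<phi> (carrier (pruefer_group p))"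
    and e: "e \<in> carrier G" "e [^] (p::nat) = \<one>" "\<And>w. w ^ p = 1 \<Longrightarrow> \<exists>a::nat. \<phi> w = e [^] a"
    and I: "subgroup I G" "e \<notin> I" and z: "z \<in> carrier (pruefer_group p)" "\<phi> z \<in> I"
  shows "z = 1"
proof (rule ccontr)
  assume "z \<noteq> 1"
  interpret P: comm_group "pruefer_group p" using comm_group_pruefer_group[OF p] .
  interpret h: group_hom "pruefer_group p" G \<phi> by unfold_locales (rule \<phi>(1))
  obtain m where m: "z ^ (p ^ m) = 1" "\<And>i. i < m \<Longrightarrow> z ^ (p ^ i) \<noteq> 1"
    using z(1) exists_least_iff[of "\<lambda>m. z ^ (p ^ m) = 1"] by auto
  then obtain i where i: "m = Suc i" using \<open>z \<noteq> 1\<close> by (cases m) auto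
  define w where "w = z ^ (p ^ i)"
  have wc: "w \<in> carrier (pruefer_group p)"
    using P.nat_pow_closed[OF z(1), of "p ^ i"] by (simp add: w_def)
  have w: "w \<noteq> 1" "w ^ p = 1" using m i by (auto simp: w_def mult.commute simp flip: power_mult)
  have "\<phi> w = \<phi> z [^] (p ^ i)"
    using h.hom_nat_pow[OF z(1), of "p ^ i"] by (simp add: w_def)
  then have wI: "\<phi> w \<in> I" using z(2) I(1) by (metis subgroup_int_pow_closed int_pow_int)
  obtain a where a: "\<phi> w = e [^] (a::nat)" using e(3) w(2) by blast
  have "\<phi> w \<noteq> \<one>" using w(1) \<phi>(2) wc h.hom_one P.one_closed by (metis inj_onD one_pruefer_group)
  then have "\<not> p dvd a" using a e(1,2) by (auto simp: dvd_def simp flip: nat_pow_pow)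
  then have "coprime a p" using p prime_imp_coprime coprime_commute by blast
  then obtain u where u: "[a * u = 1] (mod p)" using cong_solve_coprime_nat by fastforce
  have "ord e dvd p" using e pow_eq_id by simp
  then have "[a * u = 1] (mod ord e)" using u cong_dvd_modulus_nat by blast
  then have "e [^] (a * u) = e [^] (1::nat)" using pow_eq_iff_cong e(1) by blast
  then have "e = \<phi> w [^] u" using a e(1) by (simp add: nat_pow_pow)
  then have "e \<in> I" using wI I(1) by (metis subgroup_int_pow_closed int_pow_int)
  then show False using I(2) by simp
qed

text \<open>The direct product of the quasicyclic groups for the primes \<open>p 0, \<dots>, p (k - 1)\<close>; the values
  of \<open>p\<close> from \<open>k\<close> on are irrelevant.\<close>

definition pruefer_product :: "nat \<Rightarrow> (nat \<Rightarrow> nat) \<Rightarrow> (nat \<Rightarrow> complex) monoid" where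
  "pruefer_product k p = product_group {..<k} (\<lambda>i. pruefer_group (p i))"

lemma comm_group_pruefer_product:
  assumes "\<And>i. i < k \<Longrightarrow> prime (p i)"
  shows "comm_group (pruefer_product k p)"
proof -
  interpret group "pruefer_product k p"
    unfolding pruefer_product_def
    by (rule product_group) (use assms comm_group_pruefer_group comm_group.axioms(2) in blast)
  show ?thesis
    by (rule group_comm_groupI) (auto simp: pruefer_product_def mult.commute)
qed

text \<open>The greedy step of the structure theorem: an embedded product of quasicyclic groups that misses an
  element \<open>e\<close> of prime order can be enlarged by one factor so as to reach \<open>e\<close>.\<close>

lemma (in comm_group) extend_pruefer_product_embedding:
  assumes p: "\<And>i. i < k \<Longrightarrow> prime (p i)"
    and f: "f \<in> hom (pruefer_product k p) G" "inj_on f (carrier (pruefer_product k p))"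
    and q: "prime q" and e: "e \<in> carrier G" "e [^] (q::nat) = \<one>" "e \<notin> f ` carrier (pruefer_product k p)"
    and div: "\<And>x. x \<in> carrier G \<Longrightarrow> \<exists>y\<in>carrier G. y [^] q = x"
  obtains p' f' where "\<And>i. i < Suc k \<Longrightarrow> prime (p' i)" "f' \<in> hom (pruefer_product (Suc k) p') G"
    "inj_on f' (carrier (pruefer_product (Suc k) p'))"
    "insert e (f ` carrier (pruefer_product k p)) \<subseteq> f' ` carrier (pruefer_product (Suc k) p')"
proof -
  let ?P = "pruefer_product k p"
  interpret P: comm_group "?P" using comm_group_pruefer_product p by blast
  interpret Q: comm_group "pruefer_group q" using comm_group_pruefer_group[OF q] .
  interpret f: group_hom "?P" G f by unfold_locales (rule f(1))
  define I where "I = f ` carrier (?P)"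
  have I: "subgroup I G" unfolding I_def by (rule f.img_is_subgroup)
  have "e \<noteq> \<one>" using e(3) I subgroup.one_closed[OF I] by (auto simp: I_def)
  then obtain \<phi> where \<phi>: "\<phi> \<in> hom (pruefer_group q) G" "inj_on \<phi> (carrier (pruefer_group q))"
    "e \<in> \<phi> ` carrier (pruefer_group q)" "\<And>w. w ^ q = 1 \<Longrightarrow> \<exists>a::nat. \<phi> w = e [^] a"
    using pruefer_group_embedding[OF q e(1) _ e(2) div] by metis
  interpret \<phi>: group_hom "pruefer_group q" G \<phi> by unfold_locales (rule \<phi>(1))
  define p' where "p' = p(k := q)"
  define f' where "f' x = f (restrict x {..<k}) \<otimes> \<phi> (x k)" for x
  let ?Q = "pruefer_product (Suc k) p'"
  have p': "prime (p' i)" if "i < Suc k" for i using that p q by (auto simp: p'_def less_Suc_eq)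
  interpret Q': comm_group ?Q using comm_group_pruefer_product p' by blast
  have c1: "restrict x {..<k} \<in> carrier (?P)" and c2: "x k \<in> carrier (pruefer_group q)"
    if "x \<in> carrier ?Q" for x
    using that by (auto simp: pruefer_product_def p'_def PiE_iff less_Suc_eq split: if_splits)
  have hom: "f' \<in> hom ?Q G"
  proof (rule homI)
    show "f' x \<in> carrier G" if "x \<in> carrier ?Q" for x
      using c1[OF that] c2[OF that] unfolding f'_def by (intro m_closed f.hom_closed \<phi>.hom_closed)
    show "f' (x \<otimes>\<^bsub>?Q\<^esub> y) = f' x \<otimes> f' y" if x: "x \<in> carrier ?Q" and y: "y \<in> carrier ?Q" for x y
    proof -
      have 1: "restrict (x \<otimes>\<^bsub>?Q\<^esub> y) {..<k}
          = restrict x {..<k} \<otimes>\<^bsub>?P\<^esub> restrict y {..<k}"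
        by (auto simp: pruefer_product_def fun_eq_iff)
      have 2: "(x \<otimes>\<^bsub>?Q\<^esub> y) k = x k \<otimes>\<^bsub>pruefer_group q\<^esub> y k"
        by (simp add: pruefer_product_def)
      show ?thesis
        unfolding f'_def 1 2 f.hom_mult[OF c1[OF x] c1[OF y]] \<phi>.hom_mult[OF c2[OF x] c2[OF y]]
        using f.hom_closed[OF c1[OF x]] f.hom_closed[OF c1[OF y]] \<phi>.hom_closed[OF c2[OF x]] \<phi>.hom_closed[OF c2[OF y]]
        by (simp add: m_ac)
    qed
  qed
  interpret f': group_hom ?Q G f' by unfold_locales (rule hom)
  have inj: "inj_on f' (carrier ?Q)"
  proof (rule f'.inj_on_one_iff[THEN iffD2], intro ballI allI impI)
    fix x assume x: "x \<in> carrier ?Q" and fx: "f' x = \<one>"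
    note fc = f.hom_closed[OF c1[OF x]] \<phi>.hom_closed[OF c2[OF x]]
    have "\<phi> (x k) = inv (f (restrict x {..<k}))"
      using fx fc by (metis f'_def inv_equality m_comm inv_inv)
    also have "\<dots> \<in> I" using I c1[OF x] by (auto simp: I_def intro: subgroup.m_inv_closed)
    finally have xk: "x k = 1"
      using pruefer_group_embedding_meets_trivially[OF q \<phi>(1,2) e(1,2) \<phi>(4) I] e(3) c2[OF x]
      by (auto simp: I_def)
    then have "f (restrict x {..<k}) = \<one>" using fx fc \<phi>.hom_one by (simp add: f'_def)
    then have "restrict x {..<k} = \<one>\<^bsub>?P\<^esub>"
      using f(2) c1[OF x] by (metis P.one_closed f.hom_one inj_onD)
    then have "x i = 1" if "i < k" for i
      using that by (metis (no_types, lifting) lessThan_iff one_product_group one_pruefer_group pruefer_product_def restrict_apply')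
    then show "x = \<one>\<^bsub>?Q\<^esub>"
      using x xk by (auto simp: pruefer_product_def fun_eq_iff PiE_iff extensional_def less_Suc_eq)
  qed
  have "e \<in> f' ` carrier ?Q"
  proof -
    obtain z where z: "z \<in> carrier (pruefer_group q)" "e = \<phi> z" using \<phi>(3) by auto
    define x where "x = (\<lambda>i\<in>{..<Suc k}. if i = k then z else 1)"
    have "x \<in> carrier ?Q" using z by (auto simp: pruefer_product_def x_def p'_def)
    moreover have "restrict x {..<k} = \<one>\<^bsub>?P\<^esub>"
      by (auto simp: pruefer_product_def x_def fun_eq_iff)
    then have "f' x = e" using z e by (simp add: f'_def x_def f.hom_one)
    ultimately show ?thesis by blast
  qed
  moreover have "f y \<in> f' ` carrier ?Q" if y: "y \<in> carrier (?P)" for y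
  proof -
    define x where "x = (\<lambda>i\<in>{..<Suc k}. if i = k then 1 else y i)"
    have "x \<in> carrier ?Q"
      using y by (auto simp: pruefer_product_def x_def p'_def less_Suc_eq PiE_iff)
    moreover have "restrict x {..<k} = y"
      using y by (auto simp: pruefer_product_def x_def fun_eq_iff PiE_iff extensional_def)
    then have "f' x = f y" using f.hom_closed[OF y] \<phi>.hom_one by (simp add: f'_def x_def)
    ultimately show ?thesis by (metis imageI)
  qed
  ultimately show thesis using that[OF p' hom inj] by blast
qed

lemma divisible_pruefer_product:
  assumes "\<And>i. i < k \<Longrightarrow> prime (p i)" "N > 0" "x \<in> carrier (pruefer_product k p)"
  shows "\<exists>y\<in>carrier (pruefer_product k p). y [^]\<^bsub>pruefer_product k p\<^esub> (N::nat) = x"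
proof -
  let ?P = "pruefer_product k p"
  have "\<forall>i\<in>{..<k}. \<exists>w. w \<in> carrier (pruefer_group (p i)) \<and> w [^]\<^bsub>pruefer_group (p i)\<^esub> N = x i"
  proof
    fix i assume "i \<in> {..<k}"
    then have "x i \<in> carrier (pruefer_group (p i))" using assms(3) unfolding pruefer_product_def carrier_product_group by blast
    then show "\<exists>w. w \<in> carrier (pruefer_group (p i)) \<and> w [^]\<^bsub>pruefer_group (p i)\<^esub> N = x i"
      using divisible_pruefer_group[of "p i" N "x i"] assms \<open>i \<in> {..<k}\<close> by blast
  qed
  then obtain w where w: "\<And>i. i < k \<Longrightarrow> w i \<in> carrier (pruefer_group (p i)) \<and> w i [^]\<^bsub>pruefer_group (p i)\<^esub> N = x i"
    by (metis lessThan_iff)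
  define y where "y = restrict w {..<k}"
  have y: "y \<in> carrier (?P)"
    using w by (auto simp: y_def pruefer_product_def simp del: carrier_pruefer_group)
  have "y [^]\<^bsub>?P\<^esub> N = (\<lambda>i\<in>{..<k}. y i [^]\<^bsub>pruefer_group (p i)\<^esub> N)"
    using nat_pow_product_group[of y "{..<k}" "\<lambda>i. pruefer_group (p i)" N] y assms(1) comm_group_pruefer_group comm_group.axioms(2)
    unfolding pruefer_product_def by blast
  also have "\<dots> = x"
    using w assms(3) by (auto simp: y_def pruefer_product_def fun_eq_iff PiE_iff extensional_def)
  finally show ?thesis using y by blast
qed

lemma torsion_pruefer_product:
  assumes p: "\<And>i. i < k \<Longrightarrow> prime (p i)" and x: "x \<in> carrier (pruefer_product k p)"
  shows "\<exists>j. x [^]\<^bsub>pruefer_product k p\<^esub> ((\<Prod>i<k. p i) ^ j) = \<one>\<^bsub>pruefer_product k p\<^esub>"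
proof -
  let ?P = "pruefer_product k p"
  have xi: "\<exists>m. x i ^ (p i ^ m) = 1" if "i < k" for i
    using x that by (auto simp: pruefer_product_def PiE_iff)
  then obtain m where m: "\<And>i. i < k \<Longrightarrow> x i ^ (p i ^ m i) = 1" by metis
  define j where "j = (\<Sum>i<k. m i)"
  have "x i ^ ((\<Prod>i<k. p i) ^ j) = 1" if i: "i < k" for i
  proof -
    have "m i \<le> j" unfolding j_def by (rule member_le_sum) (use i in auto)
    moreover have "p i dvd (\<Prod>i<k. p i)" by (rule dvd_prodI) (use i in auto)
    ultimately have "p i ^ m i dvd (\<Prod>i<k. p i) ^ j"
      by (meson dvd_power_le dvd_trans le_imp_power_dvd)
    then show ?thesis using m[OF i] by (auto simp: dvd_def power_mult)
  qed
  moreover have "x [^]\<^bsub>?P\<^esub> ((\<Prod>i<k. p i) ^ j)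
      = (\<lambda>i\<in>{..<k}. x i [^]\<^bsub>pruefer_group (p i)\<^esub> ((\<Prod>i<k. p i) ^ j))"
    using nat_pow_product_group[of x "{..<k}" "\<lambda>i. pruefer_group (p i)"] x p comm_group_pruefer_group comm_group.axioms(2)
    unfolding pruefer_product_def by blast
  ultimately show ?thesis by (intro exI[of _ j]) (auto simp: pruefer_product_def fun_eq_iff)
qed

lemma finite_torsion_pruefer_product:
  assumes p: "\<And>i. i < k \<Longrightarrow> prime (p i)" and N: "N > 0"
  shows "finite {x \<in> carrier (pruefer_product k p). x [^]\<^bsub>pruefer_product k p\<^esub> (N::nat) = \<one>\<^bsub>pruefer_product k p\<^esub>}"
proof (rule finite_subset)
  show "finite (\<Pi>\<^sub>E i\<in>{..<k}. {z::complex. z ^ N = 1})"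
    using N by (intro finite_PiE) (auto intro: finite_roots_unity)
  show "{x \<in> carrier (pruefer_product k p). x [^]\<^bsub>pruefer_product k p\<^esub> N = \<one>\<^bsub>pruefer_product k p\<^esub>}
      \<subseteq> (\<Pi>\<^sub>E i\<in>{..<k}. {z. z ^ N = 1})"
  proof
    fix x assume "x \<in> {x \<in> carrier (pruefer_product k p). x [^]\<^bsub>pruefer_product k p\<^esub> N = \<one>\<^bsub>pruefer_product k p\<^esub>}"
    then have x: "x \<in> carrier (pruefer_product k p)" "x [^]\<^bsub>pruefer_product k p\<^esub> N = \<one>\<^bsub>pruefer_product k p\<^esub>" by auto
    have "x [^]\<^bsub>pruefer_product k p\<^esub> N = (\<lambda>i\<in>{..<k}. x i [^]\<^bsub>pruefer_group (p i)\<^esub> N)"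
      using nat_pow_product_group[of x "{..<k}" "\<lambda>i. pruefer_group (p i)"] x(1) p comm_group_pruefer_group comm_group.axioms(2)
      unfolding pruefer_product_def by blast
    then have "(\<lambda>i\<in>{..<k}. x i ^ N) = (\<lambda>i\<in>{..<k}. 1)" using x(2) by (simp add: pruefer_product_def)
    then have "x i ^ N = 1" if "i < k" for i using that by (metis lessThan_iff restrict_apply')
    then show "x \<in> (\<Pi>\<^sub>E i\<in>{..<k}. {z. z ^ N = 1})" using x(1) by (auto simp: pruefer_product_def PiE_iff)
  qed
qed

text \<open>The structure theorem. Among the embedded products of quasicyclic groups, choose one whose image
  contains as many elements of order dividing \<open>n\<close> as possible. By maximality the image contains all elements of
  prime order; being divisible as well, it contains every element, by induction on the order.\<close>

theorem (in comm_group) divisible_iso_pruefer_product: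
  assumes div: "\<And>x. x \<in> carrier G \<Longrightarrow> \<exists>y\<in>carrier G. y [^] n = x"
    and n: "n > 0" and tors: "\<And>x. x \<in> carrier G \<Longrightarrow> \<exists>j. x [^] ((n::nat) ^ j) = \<one>"
    and fin: "finite {x \<in> carrier G. x [^] n = \<one>}"
  obtains k p where "\<And>i. i < (k::nat) \<Longrightarrow> prime (p i)" "G \<cong> pruefer_product k p"
proof -
  define T where "T = {x \<in> carrier G. x [^] n = \<one>}"
  define good where "good = (\<lambda>(k, p, f). (\<forall>i<k. prime (p i)) \<and> f \<in> hom (pruefer_product k p) G
    \<and> inj_on f (carrier (pruefer_product k p)))"
  define img where "img = (\<lambda>(k, p, f). f ` carrier (pruefer_product k p) :: 'a set)"
  have "good (0, (\<lambda>_. 2), (\<lambda>_. \<one>))"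
    by (auto simp: good_def hom_def pruefer_product_def)
  moreover have "card (img t \<inter> T) < Suc (card T)" for t
    using fin by (simp add: T_def card_mono le_imp_less_Suc)
  ultimately obtain t where t: "good t" and max: "\<And>s. good s \<Longrightarrow> card (img s \<inter> T) \<le> card (img t \<inter> T)"
    using ex_has_greatest_nat[of good _ "\<lambda>t. card (img t \<inter> T)" "Suc (card T)"] by (metis less_imp_le)
  obtain k p f where kpf: "t = (k, p, f)" by (cases t)
  let ?P = "pruefer_product k p"
  have p: "prime (p i)" if "i < k" for i using t that by (simp add: good_def kpf)
  have f: "f \<in> hom (?P) G" "inj_on f (carrier (?P))"
    using t by (auto simp: good_def kpf)
  interpret P: comm_group "?P" using comm_group_pruefer_product p by blast
  interpret f: group_hom "?P" G f by unfold_locales (rule f(1))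
  have I: "subgroup (img t) G" using f.img_is_subgroup by (simp add: img_def kpf)
  have prime_order: "e \<in> img t" if e: "e \<in> carrier G" "e [^] q = \<one>" "prime q" for e and q :: nat
  proof (rule ccontr)
    assume ne: "e \<notin> img t"
    then have e1: "e \<noteq> \<one>" using I subgroup.one_closed by blast
    obtain j where "e [^] (n ^ j) = \<one>" using tors e by blast
    then have "ord e dvd n ^ j" "ord e dvd q" using e pow_eq_id by auto
    moreover have "ord e \<noteq> 1" using e e1 ord_eq_1 by blast
    ultimately have "q dvd n" using e(3) by (metis prime_nat_iff prime_dvd_power)
    then have eT: "e \<in> T" using e by (auto simp: T_def dvd_def simp flip: nat_pow_pow)
    have divq: "\<exists>y\<in>carrier G. y [^] q = x" if x: "x \<in> carrier G" for x
    proof -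
      obtain y where y: "y \<in> carrier G" "y [^] n = x" using div x by blast
      obtain r where "n = r * q" using \<open>q dvd n\<close> by (metis dvdE mult.commute)
      then have "(y [^] r) [^] q = x" using y by (simp add: nat_pow_pow)
      then show ?thesis using y by blast
    qed
    obtain p' f' where "\<And>i. i < Suc k \<Longrightarrow> prime (p' i)" "f' \<in> hom (pruefer_product (Suc k) p') G"
      "inj_on f' (carrier (pruefer_product (Suc k) p'))"
      "insert e (f ` carrier (?P)) \<subseteq> f' ` carrier (pruefer_product (Suc k) p')"
      using extend_pruefer_product_embedding[of k p f q e] p f e ne divq by (auto simp: img_def kpf)
    then have s: "good (Suc k, p', f')" "insert e (img t) \<subseteq> img (Suc k, p', f')"
      by (auto simp: good_def img_def kpf)
    have "img t \<inter> T \<subset> img (Suc k, p', f') \<inter> T" using s(2) ne eT by auto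
    then have "card (img t \<inter> T) < card (img (Suc k, p', f') \<inter> T)"
      using fin by (intro psubset_card_mono) (auto simp: T_def)
    then show False using max[OF s(1)] by simp
  qed
  have "x \<in> img t" if "x \<in> carrier G" for x
    using that
  proof (induction "ord x" arbitrary: x rule: less_induct)
    case less
    show ?case
    proof (cases "ord x = 1")
      case True
      then show ?thesis using less.prems ord_eq_1 I subgroup.one_closed by blast
    next
      case False
      then obtain q where q: "prime q" "q dvd ord x" using prime_factor_nat by blast
      obtain j where "x [^] (n ^ j) = \<one>" using tors less.prems by blast
      then have "ord x > 0" using n less.prems
        by (metis bot_nat_0.not_eq_extremum dvd_0_left_iff pow_eq_id power_not_zero)
      have "ord (x [^] q) = ord x div q"
        using ord_pow[OF less.prems q(2)] q(1) by (metis not_prime_0)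
      also have "\<dots> < ord x" using \<open>ord x > 0\<close> q(1) prime_gt_1_nat by simp
      finally have "x [^] q \<in> img t" using less by simp
      then obtain y where y: "y \<in> carrier (?P)" "f y = x [^] q" by (auto simp: img_def kpf)
      obtain z where z: "z \<in> carrier (?P)" "z [^]\<^bsub>?P\<^esub> q = y"
        using divisible_pruefer_product[OF p _ y(1)] q(1) prime_gt_0_nat by blast
      have fz: "f z \<in> carrier G" "f z [^] q = x [^] q" using z y f.hom_nat_pow[of z q] by auto
      have "(x \<otimes> inv (f z)) [^] q = \<one>"
        using fz less.prems by (simp add: nat_pow_distrib nat_pow_inv)
      then have "x \<otimes> inv (f z) \<in> img t" using prime_order fz less.prems q(1) by blast
      moreover have "f z \<in> img t" using z by (simp add: img_def kpf)
      ultimately have "x \<otimes> inv (f z) \<otimes> f z \<in> img t" using subgroup.m_closed[OF I] by blast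
      then show ?thesis using fz less.prems by (simp add: m_assoc)
    qed
  qed
  then have "f ` carrier (?P) = carrier G"
    using subgroup.subset[OF I] by (auto simp: img_def kpf)
  then have "f \<in> iso (?P) G" using f by (simp add: iso_iff)
  then have "G \<cong> ?P"
    using P.iso_set_sym is_isoI by blast
  then show thesis using that p by blast
qed

section \<open>A characterization of Chernikov groups\<close>

lemma (in comm_group) finite_power_torsion:
  assumes "finite {a \<in> carrier G. a [^] (n::nat) = \<one>}"
  shows "finite {a \<in> carrier G. a [^] (n ^ j) = \<one>}"
proof (induction j)
  case 0
  have "{a \<in> carrier G. a [^] (n ^ 0) = \<one>} \<subseteq> {\<one>}" by auto
  then show ?case by (rule finite_subset) simp
next
  case (Suc j)
  let ?T = "{a \<in> carrier G. a [^] n = \<one>}"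
  have fib: "finite {x \<in> carrier G. x [^] n = y}" for y
  proof (cases "\<exists>x\<in>carrier G. x [^] n = y")
    case True
    then obtain x where x: "x \<in> carrier G" "x [^] n = y" by blast
    have "z \<in> (\<lambda>t. t \<otimes> x) ` ?T" if "z \<in> carrier G" "z [^] n = y" for z
    proof (rule image_eqI)
      show "z = (z \<otimes> inv x) \<otimes> x" using that x by (simp add: m_assoc)
      show "z \<otimes> inv x \<in> ?T" using that x by (auto simp: nat_pow_distrib nat_pow_inv)
    qed
    then have "{x \<in> carrier G. x [^] n = y} \<subseteq> (\<lambda>t. t \<otimes> x) ` ?T" by blast
    then show ?thesis using assms finite_surj by blast
  next
    case False
    then have eq: "{x \<in> carrier G. x [^] n = y} = {}" by blast
    show ?thesis unfolding eq by simp
  qed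
  have "{a \<in> carrier G. a [^] (n ^ Suc j) = \<one>}
      \<subseteq> (\<Union>y\<in>{a \<in> carrier G. a [^] (n ^ j) = \<one>}. {x \<in> carrier G. x [^] n = y})"
    by (auto simp: nat_pow_pow)
  then show ?case using Suc fib by (meson finite_UN_I finite_subset)
qed

text \<open>The subgroups of \<open>n\<^sup>k\<close>-th powers become stationary, at an \<open>n\<close>-divisible subgroup, and
  the group is the product of this subgroup and its elements of order dividing \<open>n\<^sup>k\<close>. The index
  \<open>k\<close> is chosen to minimize the number of elements of order dividing \<open>n\<close> that are
  \<open>n\<^sup>k\<close>-th powers.\<close>

lemma (in comm_group) torsion_power_stable:
  assumes n: "n > 0" and tors: "\<And>x. x \<in> carrier G \<Longrightarrow> \<exists>j. x [^] ((n::nat) ^ j) = \<one>"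
    and fin: "finite {x \<in> carrier G. x [^] n = \<one>}"
  obtains k where "\<And>a. a \<in> carrier G \<Longrightarrow> \<exists>c\<in>carrier G. c [^] (n ^ Suc k) = a [^] (n ^ k)"
    and "\<And>a. a \<in> carrier G \<Longrightarrow> \<exists>c\<in>carrier G. \<exists>t\<in>carrier G. a = c [^] (n ^ Suc k) \<otimes> t \<and> t [^] (n ^ k) = \<one>"
proof -
  define T where "T k = {x \<in> carrier G. x [^] n = \<one> \<and> (\<exists>b\<in>carrier G. x = b [^] (n ^ k))}" for k
  have finT: "finite (T k)" for k by (rule finite_subset[OF _ fin]) (auto simp: T_def)
  have dec: "T (k + j) \<subseteq> T k" for k j
  proof
    fix x assume "x \<in> T (k + j)"
    then obtain b where b: "b \<in> carrier G" "x = b [^] (n ^ (k + j))" "x \<in> carrier G" "x [^] n = \<one>"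
      by (auto simp: T_def)
    have "x = (b [^] (n ^ j)) [^] (n ^ k)" using b by (simp add: nat_pow_pow power_add mult.commute)
    then show "x \<in> T k" using b by (auto simp: T_def intro!: bexI[of _ "b [^] (n ^ j)"])
  qed
  obtain k where k: "\<And>j. card (T k) \<le> card (T j)"
    using ex_has_least_nat[of "\<lambda>_. True" _ "\<lambda>k. card (T k)"] by auto
  have stable: "T (k + j) = T k" for j
    using card_subset_eq[OF finT dec] k[of "k + j"] card_mono[OF finT dec[of k j]] by (simp add: le_antisym)
  have main: "\<exists>c\<in>carrier G. c [^] (n ^ Suc k) = a [^] (n ^ k)"
    if "a \<in> carrier G" "(a [^] (n ^ k)) [^] (n ^ j) = \<one>" for a j
    using that
  proof (induction j arbitrary: a)
    case 0
    then show ?case by (intro bexI[of _ \<one>]) auto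
  next
    case (Suc j)
    define x where "x = (a [^] (n ^ k)) [^] (n ^ j)"
    have "x [^] n = \<one>" using Suc.prems by (simp add: x_def nat_pow_pow mult_ac)
    moreover have "x = (a [^] (n ^ j)) [^] (n ^ k)"
      using Suc.prems by (simp add: x_def nat_pow_pow mult.commute)
    ultimately have "x \<in> T k" using Suc.prems by (auto simp: T_def)
    then have "x \<in> T (k + Suc j)" unfolding stable .
    then obtain c where c: "c \<in> carrier G" "x = c [^] (n ^ (k + Suc j))" by (auto simp: T_def)
    define a' where "a' = a \<otimes> inv (c [^] n)"
    have a': "a' \<in> carrier G" using Suc.prems c by (simp add: a'_def)
    have e: "a' [^] (n ^ k) = a [^] (n ^ k) \<otimes> inv (c [^] (n ^ Suc k))"
      using Suc.prems c by (simp add: a'_def nat_pow_distrib nat_pow_inv nat_pow_pow)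
    have "(c [^] (n ^ Suc k)) [^] (n ^ j) = x" using c by (simp add: nat_pow_pow power_add mult_ac)
    then have "(a' [^] (n ^ k)) [^] (n ^ j) = \<one>"
      unfolding e using Suc.prems c by (simp add: nat_pow_distrib nat_pow_inv x_def)
    then obtain c' where c': "c' \<in> carrier G" "c' [^] (n ^ Suc k) = a' [^] (n ^ k)"
      using Suc.IH a' by blast
    have "(c' \<otimes> c) [^] (n ^ Suc k) = a [^] (n ^ k)"
      using c' c Suc.prems unfolding e by (simp add: nat_pow_distrib m_assoc del: power_Suc)
    then show ?case using c c' by blast
  qed
  have stab: "\<exists>c\<in>carrier G. c [^] (n ^ Suc k) = a [^] (n ^ k)" if "a \<in> carrier G" for a
    using tors[of "a [^] (n ^ k)"] main that by blast
  have iter: "\<exists>c\<in>carrier G. c [^] (n ^ (k + j)) = a [^] (n ^ k)" if "a \<in> carrier G" for a j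
    using that
  proof (induction j)
    case 0
    then show ?case by auto
  next
    case (Suc j)
    then obtain c where c: "c \<in> carrier G" "c [^] (n ^ (k + j)) = a [^] (n ^ k)" by blast
    then obtain c' where c': "c' \<in> carrier G" "c' [^] (n ^ Suc k) = c [^] (n ^ k)" using stab by blast
    have "c' [^] (n ^ (k + Suc j)) = (c' [^] (n ^ Suc k)) [^] (n ^ j)"
      using nat_pow_pow[OF c'(1), of "n ^ Suc k" "n ^ j"] by (simp add: power_add mult_ac)
    also have "\<dots> = c [^] (n ^ (k + j))" unfolding c'(2) using c by (simp add: nat_pow_pow power_add)
    finally show ?case using c c' by auto
  qed
  have "\<exists>c\<in>carrier G. \<exists>t\<in>carrier G. a = c [^] (n ^ Suc k) \<otimes> t \<and> t [^] (n ^ k) = \<one>"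
    if a: "a \<in> carrier G" for a
  proof -
    obtain c where c: "c \<in> carrier G" "c [^] (n ^ (k + Suc k)) = a [^] (n ^ k)"
      using iter[OF a, of "Suc k"] by blast
    define t where "t = inv (c [^] (n ^ Suc k)) \<otimes> a"
    have "t [^] (n ^ k) = inv (c [^] (n ^ (k + Suc k))) \<otimes> a [^] (n ^ k)"
      using a c(1) by (simp add: t_def nat_pow_distrib nat_pow_inv nat_pow_pow power_add mult_ac)
    then have "t [^] (n ^ k) = \<one>" using a c by simp
    moreover have "a = c [^] (n ^ Suc k) \<otimes> t"
      using a c(1) by (simp add: t_def flip: m_assoc del: power_Suc)
    moreover have "t \<in> carrier G" using a c(1) by (simp add: t_def)
    ultimately show ?thesis using c(1) by blast
  qed
  then show thesis using that stab by blast
qed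

text \<open>Here \<open>A\<close> need not be divisible: its \<open>n\<close>-divisible part still has finite index and is a
  product of quasicyclic groups. Finiteness of the index is expressed by a finite set \<open>R\<close> that
  meets every coset.\<close>

lemma (in group) chernikov_subgroupI:
  assumes K: "subgroup K G" and A: "subgroup A G" "A \<subseteq> K"
    and comm: "\<And>a b. a \<in> A \<Longrightarrow> b \<in> A \<Longrightarrow> a \<otimes> b = b \<otimes> a"
    and norm: "\<And>x a. x \<in> K \<Longrightarrow> a \<in> A \<Longrightarrow> x \<otimes> a \<otimes> inv x \<in> A"
    and n: "n > 0" and tors: "\<And>a. a \<in> A \<Longrightarrow> \<exists>j. a [^] ((n::nat) ^ j) = \<one>"
    and fin: "finite {a \<in> A. a [^] n = \<one>}"
    and R: "finite R" "R \<subseteq> carrier G" "\<And>x. x \<in> K \<Longrightarrow> \<exists>a\<in>A. \<exists>r\<in>R. x = a \<otimes> r"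
  shows "chernikov_group (G\<lparr>carrier := K\<rparr>)"
proof -
  let ?A = "G\<lparr>carrier := A\<rparr>"
  let ?K = "G\<lparr>carrier := K\<rparr>"
  interpret K: group "?K" using K by (rule subgroup_imp_group)
  interpret A: comm_group "?A" using comm_group_subgroup A comm by blast
  have AG: "a \<in> carrier G" if "a \<in> A" for a using that A(1) subgroup.subset by blast
  have KG: "a \<in> carrier G" if "a \<in> K" for a using that K subgroup.subset by blast
  have RG: "r \<in> carrier G" if "r \<in> R" for r using that R(2) by blast
  note pc = nat_pow_consistent[symmetric]
  obtain k where k1: "\<And>a. a \<in> A \<Longrightarrow> \<exists>c\<in>A. c [^] (n ^ Suc k) = a [^] (n ^ k)"
    and k2: "\<And>a. a \<in> A \<Longrightarrow> \<exists>c\<in>A. \<exists>t\<in>A. a = c [^] (n ^ Suc k) \<otimes> t \<and> t [^] (n ^ k) = \<one>"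
  proof (rule A.torsion_power_stable[OF n])
    show "\<exists>j. x [^]\<^bsub>?A\<^esub> (n ^ j) = \<one>\<^bsub>?A\<^esub>" if "x \<in> carrier (?A)" for x
      using tors that by (simp add: pc)
    show "finite {x \<in> carrier (?A). x [^]\<^bsub>?A\<^esub> n = \<one>\<^bsub>?A\<^esub>}"
      using fin by (simp add: pc)
  qed (rule that, simp_all add: pc)
  define B where "B = (\<lambda>a. a [^] (n ^ k)) ` A"
  have BA: "B \<subseteq> A" using power_mem_subgroup[OF A(1)] by (auto simp: B_def)
  have B: "subgroup B G"
  proof (rule subgroupI)
    show "B \<subseteq> carrier G" using BA AG by blast
    show "B \<noteq> {}" using subgroup.one_closed[OF A(1)] by (auto simp: B_def)
    show "inv b \<in> B" if "b \<in> B" for b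
      using that AG subgroup.m_inv_closed[OF A(1)] by (auto simp: B_def simp flip: nat_pow_inv)
    show "b \<otimes> c \<in> B" if "b \<in> B" "c \<in> B" for b c
    proof -
      obtain x y where xy: "x \<in> A" "y \<in> A" "b = x [^] (n ^ k)" "c = y [^] (n ^ k)"
        using \<open>b \<in> B\<close> \<open>c \<in> B\<close> by (auto simp: B_def)
      then have "b \<otimes> c = (x \<otimes> y) [^] (n ^ k)" using pow_mult_distrib[OF comm] AG by simp
      then show ?thesis using xy subgroup.m_closed[OF A(1)] by (auto simp: B_def)
    qed
  qed
  have normB: "B \<lhd> ?K"
  proof (rule K.normal_invI)
    show "subgroup B (?K)"
      using subgroup_incl[OF B K] BA A(2) by blast
    fix x b assume x: "x \<in> carrier (?K)" and b: "b \<in> B"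
    then obtain a where a: "a \<in> A" "b = a [^] (n ^ k)" by (auto simp: B_def)
    have "x \<otimes> b \<otimes> inv x \<in> B" using a norm[OF x[simplified] a(1)] conj_nat_pow[OF KG AG, OF x[simplified] a(1)] by (auto simp: B_def)
    then show "x \<otimes>\<^bsub>?K\<^esub> b \<otimes>\<^bsub>?K\<^esub> inv\<^bsub>?K\<^esub> x \<in> B"
      using x K by simp
  qed
  define S where "S = (\<lambda>(t, r). t \<otimes> r) ` ({t \<in> A. t [^] (n ^ k) = \<one>} \<times> (R \<inter> K))"
  have "finite {t \<in> A. t [^] (n ^ k) = \<one>}"
    using A.finite_power_torsion[of n k] fin by (simp add: pc)
  then have finS: "finite S" using R(1) by (simp add: S_def)
  have "B #>\<^bsub>?K\<^esub> x \<in> (\<lambda>s. B #>\<^bsub>?K\<^esub> s) ` S" if x: "x \<in> K" for x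
  proof -
    obtain a r where ar: "a \<in> A" "r \<in> R" "x = a \<otimes> r" using R(3) x by blast
    then have "r = inv a \<otimes> x"
      using RG[OF ar(2)] AG[OF ar(1)] by (simp flip: m_assoc)
    moreover have "inv a \<otimes> x \<in> K"
      using x ar(1) A(2) by (intro subgroup.m_closed[OF K] subgroup.m_inv_closed[OF K]) auto
    ultimately have rK: "r \<in> K" by simp
    obtain c t where ct: "c \<in> A" "t \<in> A" "a = c [^] (n ^ Suc k) \<otimes> t" "t [^] (n ^ k) = \<one>" using k2 ar(1) by blast
    have "c [^] (n ^ Suc k) = (c [^] n) [^] (n ^ k)" using ct AG by (simp add: nat_pow_pow)
    then have b: "c [^] (n ^ Suc k) \<in> B" using power_mem_subgroup[OF A(1) ct(1)] by (auto simp: B_def)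
    have s: "t \<otimes> r \<in> S" using ct rK ar by (auto simp: S_def)
    have "x = c [^] (n ^ Suc k) \<otimes> (t \<otimes> r)" using ar ct AG KG[OF rK] by (simp add: m_assoc)
    then have "x \<in> B #> (t \<otimes> r)" using b by (auto simp: r_coset_def)
    then have "B #> (t \<otimes> r) = B #> x"
      using repr_independence[OF _ _ B] AG ct KG rK by blast
    then show ?thesis using s by auto
  qed
  then have "carrier (?K Mod B) \<subseteq> (\<lambda>s. B #>\<^bsub>?K\<^esub> s) ` S"
    by (auto simp: carrier_FactGroup)
  then have finM: "finite (carrier (?K Mod B))" using finS finite_surj by blast
  interpret B: comm_group "G\<lparr>carrier := B\<rparr>" using comm_group_subgroup[OF B] comm BA by blast
  have "\<exists>c\<in>B. c [^] n = b" if b: "b \<in> B" for b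
  proof -
    obtain a where a: "a \<in> A" "b = a [^] (n ^ k)" using b by (auto simp: B_def)
    obtain c where c: "c \<in> A" "c [^] (n ^ Suc k) = b" using k1 a by blast
    then have "(c [^] (n ^ k)) [^] n = b" using AG by (simp add: nat_pow_pow mult.commute)
    then show ?thesis using c by (auto simp: B_def)
  qed
  moreover have "\<exists>j. x [^] (n ^ j) = \<one>" if "x \<in> B" for x using tors BA that by blast
  moreover have "finite {x \<in> B. x [^] n = \<one>}" by (rule finite_subset[OF _ fin]) (use BA in auto)
  ultimately obtain l p where "\<And>i. i < (l::nat) \<Longrightarrow> prime (p i)" "G\<lparr>carrier := B\<rparr> \<cong> pruefer_product l p"
    using n B.divisible_iso_pruefer_product[of n] by (simp add: pc) blast
  then show ?thesis
    unfolding chernikov_group_def pruefer_product_def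
    using normB finM K.group_axioms by auto
qed

text \<open>\<open>D\<close> is a divisible abelian subgroup of \<open>G\<close> satisfying the minimal condition. The latter is
  expressed by torsion: element orders divide powers of \<open>n\<close>, so that only finitely many primes
  occur, and there are finitely many elements of each order.\<close>

definition divisible_min :: "('a, 'b) monoid_scheme \<Rightarrow> 'a set \<Rightarrow> nat \<Rightarrow> bool" where
  "divisible_min G D n \<longleftrightarrow> subgroup D G \<and> (\<forall>a\<in>D. \<forall>b\<in>D. a \<otimes>\<^bsub>G\<^esub> b = b \<otimes>\<^bsub>G\<^esub> a) \<and>
     (\<forall>d\<in>D. \<forall>N::nat. N > 0 \<longrightarrow> (\<exists>e\<in>D. e [^]\<^bsub>G\<^esub> N = d)) \<and>
     n > 0 \<and> (\<forall>d\<in>D. \<exists>j. d [^]\<^bsub>G\<^esub> (n ^ j) = \<one>\<^bsub>G\<^esub>) \<and>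
     (\<forall>N::nat. N > 0 \<longrightarrow> finite {d \<in> D. d [^]\<^bsub>G\<^esub> N = \<one>\<^bsub>G\<^esub>})"

lemma divisible_minD:
  assumes "divisible_min G D n"
  shows "subgroup D G" "\<And>a b. a \<in> D \<Longrightarrow> b \<in> D \<Longrightarrow> a \<otimes>\<^bsub>G\<^esub> b = b \<otimes>\<^bsub>G\<^esub> a"
    "\<And>d N. d \<in> D \<Longrightarrow> N > (0::nat) \<Longrightarrow> \<exists>e\<in>D. e [^]\<^bsub>G\<^esub> N = d" "n > 0"
    "\<And>d. d \<in> D \<Longrightarrow> \<exists>j. d [^]\<^bsub>G\<^esub> (n ^ j) = \<one>\<^bsub>G\<^esub>"
    "\<And>N. N > (0::nat) \<Longrightarrow> finite {d \<in> D. d [^]\<^bsub>G\<^esub> N = \<one>\<^bsub>G\<^esub>}" "\<And>d. d \<in> D \<Longrightarrow> d \<in> carrier G"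
  using assms subgroup.subset unfolding divisible_min_def by blast+

text \<open>The divisible part \<open>D\<close> of a Chernikov subgroup \<open>K\<close>. It consists of the \<open>N\<close>-th powers of
  elements of \<open>K\<close>: by the choice of \<open>N\<close> they lie in \<open>D\<close>, and \<open>D\<close> is divisible. So \<open>D\<close> is characteristic.\<close>

lemma (in group) chernikov_subgroupE:
  assumes K: "subgroup K G" and ch: "chernikov_group (G\<lparr>carrier := K\<rparr>)"
  obtains D n N R where "divisible_min G D n" "D \<subseteq> K"
    "\<And>x d. x \<in> K \<Longrightarrow> d \<in> D \<Longrightarrow> x \<otimes> d \<otimes> inv x \<in> D"
    "N > (0::nat)" "\<And>x. x \<in> K \<Longrightarrow> x [^] N \<in> D"
    "finite R" "R \<subseteq> K" "\<And>x. x \<in> K \<Longrightarrow> \<exists>d\<in>D. \<exists>r\<in>R. x = d \<otimes> r"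
proof -
  let ?K = "G\<lparr>carrier := K\<rparr>"
  interpret K: group "?K" using K by (rule subgroup_imp_group)
  note pc = nat_pow_consistent[symmetric]
  obtain D k p where norm: "D \<lhd> ?K" and finM: "finite (carrier (?K Mod D))"
    and p: "\<And>i. i < k \<Longrightarrow> prime (p i)" and iso: "G\<lparr>carrier := D\<rparr> \<cong> pruefer_product k p"
    using ch unfolding chernikov_group_def pruefer_product_def by auto
  let ?P = "pruefer_product k p"
  interpret N: normal D "?K" by (rule norm)
  have DK: "D \<subseteq> K" using N.subset by simp
  have D: "subgroup D G" using N.subgroup_axioms K incl_subgroup by blast
  interpret D: group "G\<lparr>carrier := D\<rparr>" using D by (rule subgroup_imp_group)
  interpret P: comm_group "?P" using comm_group_pruefer_product p by blast
  obtain h where h: "h \<in> iso (?P) (G\<lparr>carrier := D\<rparr>)"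
    using iso D.iso_sym by (auto simp: is_iso_def)
  interpret h: group_hom "?P" "G\<lparr>carrier := D\<rparr>" h
    by unfold_locales (use h in \<open>auto simp: iso_def\<close>)
  have im: "h ` carrier (?P) = D" and inj: "inj_on h (carrier (?P))"
    using h by (auto simp: iso_iff)
  have hp: "h x [^] N = h (x [^]\<^bsub>?P\<^esub> N)" if "x \<in> carrier (?P)" for x and N :: nat
    using h.hom_nat_pow[OF that, of N] by (simp add: pc)
  have h1: "h x = \<one> \<longleftrightarrow> x = \<one>\<^bsub>?P\<^esub>" if "x \<in> carrier (?P)" for x
    using inj_onD[OF inj, of x "\<one>\<^bsub>?P\<^esub>"] that h.hom_one by auto
  define n where "n = (\<Prod>i<k. p i)"
  have n0: "n > 0" unfolding n_def using p by (intro prod_pos) (auto intro: prime_gt_0_nat)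
  have "divisible_min G D n"
    unfolding divisible_min_def
  proof (intro conjI ballI allI impI)
    show "a \<otimes> b = b \<otimes> a" if ab: "a \<in> D" "b \<in> D" for a b
    proof -
      obtain x y where "x \<in> carrier (?P)" "a = h x" "y \<in> carrier (?P)" "b = h y"
        using ab im by blast
      then show ?thesis using h.hom_mult[of x y] h.hom_mult[of y x] P.m_comm[of x y] by simp
    qed
    show "\<exists>e\<in>D. e [^] N = d" if d: "d \<in> D" and N: "N > 0" for d and N :: nat
    proof -
      obtain x where x: "x \<in> carrier (?P)" "d = h x" using d im by blast
      obtain y where y: "y \<in> carrier (?P)" "y [^]\<^bsub>?P\<^esub> N = x"
        using divisible_pruefer_product[OF p N x(1)] by blast
      have "h y [^] N = d" using hp[OF y(1)] x(2) y(2) by simp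
      moreover have "h y \<in> D" using y(1) im by blast
      ultimately show ?thesis by blast
    qed
    show "\<exists>j. d [^] (n ^ j) = \<one>" if d: "d \<in> D" for d
    proof -
      obtain x where x: "x \<in> carrier (?P)" "d = h x" using d im by blast
      obtain j where "x [^]\<^bsub>?P\<^esub> (n ^ j) = \<one>\<^bsub>?P\<^esub>"
        using torsion_pruefer_product[OF p x(1)] by (auto simp: n_def)
      then have "d [^] (n ^ j) = \<one>" using hp[OF x(1)] h.hom_one x(2) by simp
      then show ?thesis ..
    qed
    show "finite {d \<in> D. d [^] N = \<one>}" if N: "N > 0" for N :: nat
    proof (rule finite_subset)
      show "{d \<in> D. d [^] N = \<one>} \<subseteq> h ` {x \<in> carrier (?P). x [^]\<^bsub>?P\<^esub> N = \<one>\<^bsub>?P\<^esub>}"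
      proof
        fix d assume d: "d \<in> {d \<in> D. d [^] N = \<one>}"
        then obtain x where x: "x \<in> carrier (?P)" "d = h x" using im by blast
        then have "x [^]\<^bsub>?P\<^esub> N = \<one>\<^bsub>?P\<^esub>"
          using d hp[OF x(1)] h1[OF P.nat_pow_closed[OF x(1)]] by auto
        then show "d \<in> h ` {x \<in> carrier (?P). x [^]\<^bsub>?P\<^esub> N = \<one>\<^bsub>?P\<^esub>}"
          using x by blast
      qed
      show "finite (h ` {x \<in> carrier (?P). x [^]\<^bsub>?P\<^esub> N = \<one>\<^bsub>?P\<^esub>})"
        by (intro finite_imageI finite_torsion_pruefer_product p N)
    qed
  qed (use D n0 in auto)
  moreover have "x \<otimes> d \<otimes> inv x \<in> D" if "x \<in> K" "d \<in> D" for x d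
    using N.inv_op_closed2[of x d] that K by simp
  moreover
  interpret M: group "?K Mod D" by (rule N.factorgroup_is_group)
  define N where "N = order (?K Mod D)"
  have "N > 0" using finM M.order_gt_0_iff_finite by (simp add: N_def)
  moreover have "x [^] N \<in> D" if x: "x \<in> K" for x
  proof -
    have "D #>\<^bsub>?K\<^esub> x \<in> carrier (?K Mod D)" using x by (auto simp: carrier_FactGroup)
    then have "(D #>\<^bsub>?K\<^esub> x) [^]\<^bsub>?K Mod D\<^esub> N = D"
      using M.pow_order_eq_1 by (simp add: N_def)
    then have "D #>\<^bsub>?K\<^esub> (x [^]\<^bsub>?K\<^esub> N) = D" using N.FactGroup_pow x by simp
    then have "x [^]\<^bsub>?K\<^esub> N \<in> D"
      using K.rcos_self[of "x [^]\<^bsub>?K\<^esub> N" D] N.subgroup_axioms K.nat_pow_closed x by simp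
    then show ?thesis by (simp add: pc)
  qed
  moreover
  obtain R where R: "finite R" "R \<subseteq> K" "carrier (?K Mod D) = (\<lambda>x. D #>\<^bsub>?K\<^esub> x) ` R"
    using finite_subset_image[OF finM, of "\<lambda>x. D #>\<^bsub>?K\<^esub> x" K] by (auto simp: carrier_FactGroup)
  have "\<exists>d\<in>D. \<exists>r\<in>R. x = d \<otimes> r" if x: "x \<in> K" for x
  proof -
    have "D #>\<^bsub>?K\<^esub> x \<in> (\<lambda>x. D #>\<^bsub>?K\<^esub> x) ` R"
      using x R(3) by (auto simp: carrier_FactGroup)
    then obtain r where r: "r \<in> R" "D #>\<^bsub>?K\<^esub> x = D #>\<^bsub>?K\<^esub> r" by blast
    then have "x \<in> D #>\<^bsub>?K\<^esub> r" using K.rcos_self[of x D] x N.subgroup_axioms by simp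
    then show ?thesis using r by (auto simp: r_coset_def)
  qed
  ultimately show thesis using that DK R(1,2) by blast
qed

section \<open>Rigidity of divisible subgroups\<close>

text \<open>If \<open>g\<close> centralizes the elements of \<open>D\<close> of order dividing \<open>n\<^sup>j\<close>, consider
  \<open>d = d'\<^sup>n\<close> of order dividing \<open>n\<^sup>j\<^sup>+\<^sup>1\<close> and the commutator \<open>e\<close> of \<open>g\<close> and
  \<open>d'\<close>. Its order divides \<open>n\<^sup>2\<close>, so \<open>g\<close> commutes with \<open>e\<close>; as \<open>g\<^sup>q\<close> commutes with \<open>d'\<close>, it follows that
  \<open>e\<^sup>q = \<one>\<close>. The two divisibilities give
  \<open>e\<^sup>n = \<one>\<close>, and \<open>e\<^sup>n\<close> is the commutator of \<open>g\<close> and \<open>d\<close>.\<close>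

lemma (in group) centralizes_divisible_prime_step:
  assumes D: "divisible_min G D n"
    and q: "prime (q::nat)" and g: "g \<in> carrier G" "\<And>d. d \<in> D \<Longrightarrow> g \<otimes> d \<otimes> inv g \<in> D"
    and gq: "\<And>d. d \<in> D \<Longrightarrow> g [^] q \<otimes> d = d \<otimes> g [^] q"
    and fixed: "\<And>d. d \<in> D \<Longrightarrow> d [^] (n ^ 2) = \<one> \<Longrightarrow> g \<otimes> d = d \<otimes> g"
    and d: "d \<in> D"
  shows "g \<otimes> d = d \<otimes> g"
proof -
  note D' = divisible_minD[OF D]
  note DG = D'(7)
  have "g \<otimes> d = d \<otimes> g" if "d \<in> D" "d [^] (n ^ j) = \<one>" for d j
    using that
  proof (induction j arbitrary: d)
    case 0
    then show ?case using g(1) DG by simp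
  next
    case (Suc j)
    have dG: "d \<in> carrier G" using Suc.prems DG by blast
    obtain d' where d': "d' \<in> D" "d' [^] n = d" using D'(3)[OF Suc.prems(1) D'(4)] by blast
    have d'G: "d' \<in> carrier G" using d' DG by blast
    define e where "e = (g \<otimes> d' \<otimes> inv g) \<otimes> inv d'"
    have eD: "e \<in> D"
      using subgroup.m_closed[OF D'(1) g(2)[OF d'(1)] subgroup.m_inv_closed[OF D'(1) d'(1)]] by (simp add: e_def)
    have eG: "e \<in> carrier G" using eD DG by blast
    have e_pow: "e [^] m = (g \<otimes> d' [^] m \<otimes> inv g) \<otimes> inv (d' [^] m)" for m :: nat
    proof -
      have "e [^] m = (g \<otimes> d' \<otimes> inv g) [^] m \<otimes> inv d' [^] m"
        unfolding e_def
        by (rule pow_mult_distrib) (use D'(2)[OF g(2)[OF d'(1)] subgroup.m_inv_closed[OF D'(1) d'(1)]] d'G g(1) in auto)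
      then show ?thesis using conj_nat_pow[OF g(1) d'G] nat_pow_inv[OF d'G] by simp
    qed
    have "d [^] n \<in> D" using power_mem_subgroup[OF D'(1) Suc.prems(1)] .
    moreover have "(d [^] n) [^] (n ^ j) = \<one>" using Suc.prems dG by (simp add: nat_pow_pow)
    ultimately have "g \<otimes> d [^] n = d [^] n \<otimes> g" using Suc.IH by blast
    then have "g \<otimes> d [^] n \<otimes> inv g = d [^] n" using conj_eq_iff_commute[OF g(1) nat_pow_closed[OF dG]] by blast
    moreover have "d [^] n = d' [^] (n ^ 2)" using d'G by (simp add: d'(2)[symmetric] nat_pow_pow power2_eq_square)
    ultimately have e1: "e [^] (n ^ 2) = \<one>" using e_pow[of "n ^ 2"] d'G by simp
    then have ge: "g \<otimes> e = e \<otimes> g" using fixed eD by blast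
    have ed': "g \<otimes> d' = e \<otimes> d' \<otimes> g" using d'G g(1) by (simp add: e_def m_assoc)
    have "g [^] i \<otimes> d' = e [^] i \<otimes> d' \<otimes> g [^] i" for i :: nat
    proof (induction i)
      case 0
      then show ?case using d'G by simp
    next
      case (Suc i)
      have gi: "g [^] i \<otimes> e = e \<otimes> g [^] i"
        using group_commutes_pow[OF ge g(1) eG] by simp
      have "g [^] Suc i \<otimes> d' = g [^] i \<otimes> (e \<otimes> d' \<otimes> g)" using d'G g(1) by (simp add: m_assoc ed')
      also have "\<dots> = (g [^] i \<otimes> e) \<otimes> (d' \<otimes> g)" using d'G g(1) eG by (simp add: m_assoc)
      also have "\<dots> = e \<otimes> (g [^] i \<otimes> d') \<otimes> g" using d'G g(1) eG by (simp add: m_assoc gi)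
      also have "\<dots> = e [^] Suc i \<otimes> d' \<otimes> g [^] Suc i"
        unfolding Suc using d'G g(1) eG nat_pow_Suc2[OF eG] by (simp add: m_assoc)
      finally show ?case .
    qed
    then have "d' \<otimes> g [^] q = e [^] q \<otimes> d' \<otimes> g [^] q" using gq[OF d'(1)] by metis
    then have "e [^] q = \<one>" using d'G g(1) eG by simp
    then have "ord e dvd q" "ord e dvd n ^ 2" using e1 eG pow_eq_id by auto
    then have "ord e dvd n" using q by (metis one_dvd prime_nat_iff prime_dvd_power)
    then have "e [^] n = \<one>" using eG pow_eq_id by simp
    then have "(g \<otimes> d \<otimes> inv g) \<otimes> inv d = \<one>" using e_pow[of n] d'(2) by simp
    then have "g \<otimes> d \<otimes> inv g = d" using dG g(1) by (metis inv_closed inv_equality inv_inv m_closed)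
    then show ?case using conj_eq_iff_commute[OF g(1) dG] by blast
  qed
  then show ?thesis using d D'(5) by blast
qed

lemma (in group) centralizes_divisible:
  assumes D: "divisible_min G D n"
    and g: "g \<in> carrier G" "\<And>d. d \<in> D \<Longrightarrow> g \<otimes> d \<otimes> inv g \<in> D"
    and t: "g [^] (t::nat) = \<one>" "t > 0"
    and fixed: "\<And>d. d \<in> D \<Longrightarrow> d [^] (n ^ 2) = \<one> \<Longrightarrow> g \<otimes> d = d \<otimes> g"
    and d: "d \<in> D"
  shows "g \<otimes> d = d \<otimes> g"
  using g t fixed d
proof (induction t arbitrary: g d rule: less_induct)
  case (less t)
  note DG = divisible_minD(7)[OF D]
  note g = \<open>g \<in> carrier G\<close>
  show ?case
  proof (cases "t = 1")
    case True
    then show ?thesis using less.prems DG by simp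
  next
    case False
    then obtain q where q: "prime q" "q dvd t" using prime_factor_nat by blast
    then obtain s where s: "t = q * s" by blast
    have pow_norm: "\<forall>d\<in>D. g [^] (i::nat) \<otimes> d \<otimes> inv (g [^] i) \<in> D" for i
    proof (induction i)
      case 0
      then show ?case using DG by simp
    next
      case (Suc i)
      show ?case
      proof
        fix d assume d: "d \<in> D"
        have "g [^] Suc i \<otimes> d \<otimes> inv (g [^] Suc i) = g [^] i \<otimes> (g \<otimes> d \<otimes> inv g) \<otimes> inv (g [^] i)"
          using g DG[OF d] by (simp add: inv_mult_group m_assoc)
        then show "g [^] Suc i \<otimes> d \<otimes> inv (g [^] Suc i) \<in> D" using Suc less.prems(2)[OF d] by simp
      qed
    qed
    have "g [^] q \<otimes> d = d \<otimes> g [^] q" if d: "d \<in> D" for d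
    proof (rule less.IH[of s])
      show "s < t" "0 < s" using s less.prems(4) prime_gt_1_nat[OF q(1)] by auto
      show "(g [^] q) [^] s = \<one>" using less.prems(3) g s by (simp add: nat_pow_pow)
      show "g [^] q \<otimes> d \<otimes> inv (g [^] q) \<in> D" if "d \<in> D" for d using pow_norm that by blast
      show "g [^] q \<otimes> d = d \<otimes> g [^] q" if "d \<in> D" "d [^] (n ^ 2) = \<one>" for d
        using group_commutes_pow[OF less.prems(5)[OF that] g DG[OF that(1)]] .
    qed (use g d in auto)
    then show ?thesis
      using centralizes_divisible_prime_step[OF D q(1) g less.prems(2) _ less.prems(5)] less.prems(6) by blast
  qed
qed

lemma (in group) power_fixes_finite_set:
  assumes S: "finite S" "S \<subseteq> carrier G" and g: "g \<in> carrier G" "\<And>s. s \<in> S \<Longrightarrow> g \<otimes> s \<otimes> inv g \<in> S" and s: "s \<in> S"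
  shows "g [^] (fact (card S) :: nat) \<otimes> s = s \<otimes> g [^] (fact (card S) :: nat)"
proof -
  have sG: "s \<in> carrier G" using s S by blast
  define f where "f i = g [^] (i::nat) \<otimes> s \<otimes> inv (g [^] i)" for i
  have f_Suc: "f (Suc i) = g \<otimes> f i \<otimes> inv g" for i
    using nat_pow_Suc2[OF g(1)] g sG by (simp add: f_def m_assoc inv_mult_group)
  have fS: "f i \<in> S" for i
  proof (induction i)
    case 0
    then show ?case using s sG by (simp add: f_def)
  next
    case (Suc i)
    then show ?case using f_Suc g(2) by simp
  qed
  have "\<not> inj_on f {0..card S}"
  proof
    assume "inj_on f {0..card S}"
    then have "card {0..card S} \<le> card S" using fS by (intro card_inj_on_le[of f]) (use S(1) in auto)
    then show False by simp
  qed
  then obtain i j where ij: "i < j" "j \<le> card S" "f i = f j"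
    unfolding inj_on_def by (metis atLeastAtMost_iff linorder_neqE_nat)
  have "f j = g [^] i \<otimes> f (j - i) \<otimes> inv (g [^] i)"
  proof -
    have "g [^] j = g [^] i \<otimes> g [^] (j - i)" using ij g by (simp add: nat_pow_mult)
    then show ?thesis using g sG by (simp add: f_def m_assoc inv_mult_group)
  qed
  then have "g [^] i \<otimes> s \<otimes> inv (g [^] i) = g [^] i \<otimes> f (j - i) \<otimes> inv (g [^] i)"
    using ij(3) by (simp add: f_def)
  moreover have "f (j - i) \<in> carrier G" using fS S(2) by blast
  ultimately have "f (j - i) = s" using g sG by simp
  then have "g [^] (j - i) \<otimes> s = s \<otimes> g [^] (j - i)"
    using conj_eq_iff_commute[of "g [^] (j - i)" s] g sG unfolding f_def by blast
  moreover have "(j - i) dvd fact (card S)" using ij by (intro dvd_fact) auto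
  then obtain m :: nat where "fact (card S) = (j - i) * m" by blast
  ultimately show ?thesis
    using group_commutes_pow[of "g [^] (j - i)" s m] g sG by (simp add: nat_pow_pow)
qed

text \<open>A divisible group acting on \<open>D\<close> acts trivially on the finite set of elements of order dividing
  \<open>n\<^sup>2\<close>, because each element is a sufficiently divisible power of another one; rigidity does the rest.\<close>

lemma (in group) divisible_min_commute:
  assumes D: "divisible_min G D n" and E: "divisible_min G E m"
    and norm: "\<And>e d. e \<in> E \<Longrightarrow> d \<in> D \<Longrightarrow> e \<otimes> d \<otimes> inv e \<in> D"
    and d: "d \<in> D" and e: "e \<in> E"
  shows "e \<otimes> d = d \<otimes> e"
proof -
  note D' = divisible_minD[OF D] and E' = divisible_minD[OF E]
  define S where "S = {d \<in> D. d [^] (n ^ 2) = \<one>}"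
  have S: "finite S" "S \<subseteq> carrier G" using D'(6)[of "n ^ 2"] D'(4,7) by (auto simp: S_def)
  obtain g where g: "g \<in> E" "g [^] (fact (card S) :: nat) = e" using E'(3)[OF e, of "fact (card S)"] by auto
  obtain j where j: "e [^] (m ^ j) = \<one>" using E'(5)[OF e] by blast
  show ?thesis
  proof (rule centralizes_divisible[OF D _ _ j])
    show "e \<otimes> s = s \<otimes> e" if s: "s \<in> D" "s [^] (n ^ 2) = \<one>" for s
    proof -
      have "g \<otimes> x \<otimes> inv g \<in> S" if "x \<in> S" for x
        using that norm[OF g(1)] conj_nat_pow[of g x "n ^ 2", symmetric] E'(7)[OF g(1)] D'(7) by (auto simp: S_def)
      then show ?thesis
        using power_fixes_finite_set[OF S E'(7)[OF g(1)], of s] s g(2) by (simp add: S_def)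
    qed
  qed (use norm e d E' in auto)
qed

text \<open>For normal \<open>K\<close> the divisible part \<open>D\<close> is normal in the whole group.\<close>

lemma (in group) chernikov_normalE:
  assumes K: "K \<lhd> G" and ch: "chernikov_group (G\<lparr>carrier := K\<rparr>)"
  obtains D n N R where "divisible_min G D n" "D \<subseteq> K"
    "\<And>x d. x \<in> carrier G \<Longrightarrow> d \<in> D \<Longrightarrow> x \<otimes> d \<otimes> inv x \<in> D"
    "N > (0::nat)" "\<And>x. x \<in> K \<Longrightarrow> x [^] N \<in> D"
    "finite R" "R \<subseteq> K" "\<And>x. x \<in> K \<Longrightarrow> \<exists>d\<in>D. \<exists>r\<in>R. x = d \<otimes> r"
proof (rule chernikov_subgroupE[OF normal_imp_subgroup[OF K] ch])
  fix D n N R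
  assume D: "divisible_min G D n" "D \<subseteq> K" and N: "N > (0::nat)" "\<And>x. x \<in> K \<Longrightarrow> x [^] N \<in> D"
    and R: "finite R" "R \<subseteq> K" "\<And>x. x \<in> K \<Longrightarrow> \<exists>d\<in>D. \<exists>r\<in>R. x = d \<otimes> r"
  have "x \<otimes> d \<otimes> inv x \<in> D" if x: "x \<in> carrier G" and d: "d \<in> D" for x d
  proof -
    obtain e where e: "e \<in> D" "e [^] N = d" using divisible_minD(3)[OF D(1) d N(1)] by blast
    have "e \<in> carrier G" using divisible_minD(7)[OF D(1) e(1)] .
    then have "x \<otimes> d \<otimes> inv x = (x \<otimes> e \<otimes> inv x) [^] N" using conj_nat_pow[OF x] e(2) by metis
    also have "\<dots> \<in> D" using N(2) normal_invE(2)[OF K x] e(1) D(2) by blast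
    finally show ?thesis .
  qed
  then show thesis using that D N R by blast
qed

section \<open>Products of normal Chernikov subgroups\<close>

text \<open>If \<open>(d e)\<^sup>N = \<one>\<close>, then \<open>d\<^sup>N\<close> lies in \<open>K = D \<inter> E\<close>. Since \<open>K\<close> is divisible by
  \<open>N\<close> up to a finite subgroup, an element of \<open>K\<close> can be moved from \<open>d\<close> to \<open>e\<close> so that both
  factors get bounded order.\<close>

lemma (in group) finite_torsion_set_mult:
  assumes D: "divisible_min G D n" and E: "divisible_min G E m"
    and comm: "\<And>a b. a \<in> D \<Longrightarrow> b \<in> E \<Longrightarrow> a \<otimes> b = b \<otimes> a" and N: "N > (0::nat)"
    and tors: "\<And>d. d \<in> D \<Longrightarrow> \<exists>j. d [^] (N ^ j) = \<one>"
  shows "finite {a \<in> D <#> E. a [^] N = \<one>}"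
proof -
  note D' = divisible_minD[OF D] and E' = divisible_minD[OF E]
  define K where "K = D \<inter> E"
  have K: "subgroup K G" unfolding K_def by (rule subgroups_Inter_pair[OF D'(1) E'(1)])
  let ?K = "G\<lparr>carrier := K\<rparr>"
  interpret K: comm_group "?K"
    by (rule comm_group_subgroup[OF K]) (use D'(2) in \<open>auto simp: K_def\<close>)
  note pc = nat_pow_consistent[symmetric]
  obtain k where k: "\<And>a. a \<in> K \<Longrightarrow> \<exists>c\<in>K. \<exists>t\<in>K. a = c [^] (N ^ Suc k) \<otimes> t \<and> t [^] (N ^ k) = \<one>"
  proof (rule K.torsion_power_stable[OF N])
    show "\<exists>j. x [^]\<^bsub>?K\<^esub> (N ^ j) = \<one>\<^bsub>?K\<^esub>" if "x \<in> carrier (?K)" for x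
      using tors that by (simp add: pc K_def)
    show "finite {x \<in> carrier (?K). x [^]\<^bsub>?K\<^esub> N = \<one>\<^bsub>?K\<^esub>}"
      by (rule finite_subset[OF _ D'(6)[OF N]]) (auto simp: pc K_def)
  qed (rule that, simp add: pc)
  define T where "T F = {x \<in> F. x [^] (N ^ Suc k) = \<one>}" for F
  have "{a \<in> D <#> E. a [^] N = \<one>} \<subseteq> (\<lambda>(x, y). x \<otimes> y) ` (T D \<times> T E)"
  proof
    fix a assume a: "a \<in> {a \<in> D <#> E. a [^] N = \<one>}"
    then obtain d e where de: "d \<in> D" "e \<in> E" "a = d \<otimes> e" by (auto simp: set_mult_def)
    have G: "d \<in> carrier G" "e \<in> carrier G" using de D'(7) E'(7) by auto
    have "d [^] N \<otimes> e [^] N = \<one>" using a de(3) pow_mult_distrib[OF comm[OF de(1,2)] G] by simp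
    then have dN: "d [^] N = inv (e [^] N)" using G by (metis inv_equality nat_pow_closed)
    have "d [^] N \<in> K"
      using power_mem_subgroup[OF D'(1) de(1), of N]
        subgroup.m_inv_closed[OF E'(1) power_mem_subgroup[OF E'(1) de(2), of N]] dN by (simp add: K_def)
    then obtain c t where ct: "c \<in> K" "t \<in> K" "d [^] N = c [^] (N ^ Suc k) \<otimes> t" "t [^] (N ^ k) = \<one>"
      using k by blast
    define l where "l = c [^] (N ^ k)"
    have lK: "l \<in> K" using power_mem_subgroup[OF K ct(1)] by (simp add: l_def)
    have lG: "l \<in> carrier G" "t \<in> carrier G" "c \<in> carrier G" 
      using subgroup.mem_carrier[OF K lK] subgroup.mem_carrier[OF K ct(2)] subgroup.mem_carrier[OF K ct(1)] by simp_all
    have lN: "l [^] N = c [^] (N ^ Suc k)" using lG by (simp add: l_def nat_pow_pow mult.commute)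
    have dl: "d \<otimes> inv l = inv l \<otimes> d"
      using D'(2)[OF de(1) subgroup.m_inv_closed[OF D'(1)]] lK by (simp add: K_def)
    have le: "l \<otimes> e = e \<otimes> l" using comm lK de(2) by (simp add: K_def)
    have tl: "t \<otimes> l [^] N = l [^] N \<otimes> t"
      using D'(2)[of t "l [^] N"] power_mem_subgroup[OF D'(1), of l N] lK ct(2) by (simp add: K_def)
    have dN': "d [^] N = t \<otimes> l [^] N" by (rule trans[OF ct(3)]) (simp only: lN[symmetric] tl)
    have "(d \<otimes> inv l) [^] N = d [^] N \<otimes> inv (l [^] N)"
      using pow_mult_distrib[OF dl] G lG by (simp add: nat_pow_inv)
    also have "\<dots> = t" using lG by (simp add: dN' m_assoc)
    finally have 1: "(d \<otimes> inv l) [^] N = t" .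
    have "(l \<otimes> e) [^] N = l [^] N \<otimes> e [^] N" using pow_mult_distrib[OF le] G lG by simp
    also have "e [^] N = inv (t \<otimes> l [^] N)"
    proof -
      have "e [^] N = inv (d [^] N)" using dN G by simp
      then show ?thesis by (simp only: dN')
    qed
    also have "l [^] N \<otimes> inv (t \<otimes> l [^] N) = inv t"
      using lG by (simp add: inv_mult_group)
    finally have 2: "(l \<otimes> e) [^] N = inv t" .
    have "d \<otimes> inv l \<in> T D"
    proof -
      have "(d \<otimes> inv l) [^] (N ^ Suc k) = ((d \<otimes> inv l) [^] N) [^] (N ^ k)"
        using G lG by (simp add: nat_pow_pow)
      also have "\<dots> = \<one>" using 1 ct(4) by simp
      finally show ?thesis
        using subgroup.m_closed[OF D'(1) de(1) subgroup.m_inv_closed[OF D'(1)]] lK by (simp add: T_def K_def)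
    qed
    moreover have "l \<otimes> e \<in> T E"
    proof -
      have "(l \<otimes> e) [^] (N ^ Suc k) = ((l \<otimes> e) [^] N) [^] (N ^ k)" using G lG by (simp add: nat_pow_pow)
      also have "\<dots> = \<one>" using 2 ct(4) lG by (simp add: nat_pow_inv)
      finally show ?thesis using subgroup.m_closed[OF E'(1) _ de(2)] lK by (simp add: T_def K_def)
    qed
    moreover have "a = (d \<otimes> inv l) \<otimes> (l \<otimes> e)" using G lG by (simp add: de(3) m_assoc)
    ultimately show "a \<in> (\<lambda>(x, y). x \<otimes> y) ` (T D \<times> T E)" by force
  qed
  moreover have "finite (T D)" "finite (T E)"
    unfolding T_def using D'(6)[of "N ^ Suc k"] E'(6)[of "N ^ Suc k"] N by auto
  ultimately show ?thesis by (meson finite_SigmaI finite_surj)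
qed

lemma (in group) chernikov_normal_set_mult:
  assumes P: "P \<lhd> G" "chernikov_group (G\<lparr>carrier := P\<rparr>)"
    and Q: "Q \<lhd> G" "chernikov_group (G\<lparr>carrier := Q\<rparr>)"
  shows "chernikov_group (G\<lparr>carrier := P <#> Q\<rparr>)"
proof -
  obtain D n N R where D: "divisible_min G D n" "D \<subseteq> P"
      "\<And>x d. x \<in> carrier G \<Longrightarrow> d \<in> D \<Longrightarrow> x \<otimes> d \<otimes> inv x \<in> D"
    and R: "finite R" "R \<subseteq> P" "\<And>x. x \<in> P \<Longrightarrow> \<exists>d\<in>D. \<exists>r\<in>R. x = d \<otimes> r"
    using chernikov_normalE[OF P] by (metis (no_types, lifting))
  obtain E m M S where E: "divisible_min G E m" "E \<subseteq> Q"
      "\<And>x d. x \<in> carrier G \<Longrightarrow> d \<in> E \<Longrightarrow> x \<otimes> d \<otimes> inv x \<in> E"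
    and S: "finite S" "S \<subseteq> Q" "\<And>x. x \<in> Q \<Longrightarrow> \<exists>d\<in>E. \<exists>r\<in>S. x = d \<otimes> r"
    using chernikov_normalE[OF Q] by (metis (no_types, lifting))
  note D' = divisible_minD[OF D(1)] and E' = divisible_minD[OF E(1)]
  have nD: "D \<lhd> G" and nE: "E \<lhd> G" using normal_invI D'(1) D(3) E'(1) E(3) by blast+
  have PG: "x \<in> carrier G" if "x \<in> P" for x using subgroup.mem_carrier[OF normal_imp_subgroup[OF P(1)] that] .
  have QG: "x \<in> carrier G" if "x \<in> Q" for x using subgroup.mem_carrier[OF normal_imp_subgroup[OF Q(1)] that] .
  have comm: "a \<otimes> b = b \<otimes> a" if "a \<in> D" "b \<in> E" for a b
    using divisible_min_commute[OF D(1) E(1) _ that] D(3) E'(7) by metis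
  define A where "A = D <#> E"
  have nA: "A \<lhd> G" unfolding A_def by (rule normal_set_mult[OF nD nE])
  define l where "l = n * m"
  have torsD: "\<exists>j. d [^] (l ^ j) = \<one>" if "d \<in> D" for d
  proof -
    obtain j where "d [^] (n ^ j) = \<one>" using D'(5) \<open>d \<in> D\<close> by blast
    then have "(d [^] (n ^ j)) [^] (m ^ j) = \<one>" by simp
    then show ?thesis using D'(7)[OF \<open>d \<in> D\<close>] by (auto simp: l_def nat_pow_pow power_mult_distrib)
  qed
  have torsE: "\<exists>j. d [^] (l ^ j) = \<one>" if "d \<in> E" for d
  proof -
    obtain j where "d [^] (m ^ j) = \<one>" using E'(5) \<open>d \<in> E\<close> by blast
    then have "(d [^] (m ^ j)) [^] (n ^ j) = \<one>" by simp
    then show ?thesis using E'(7)[OF \<open>d \<in> E\<close>] by (auto simp: l_def nat_pow_pow power_mult_distrib mult.commute)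
  qed
  show ?thesis
  proof (rule chernikov_subgroupI[where A = A and n = l and R = "R <#> S"])
    show "subgroup (P <#> Q) G" using normal_imp_subgroup[OF normal_set_mult[OF P(1) Q(1)]] .
    then have PQG: "\<And>x. x \<in> P <#> Q \<Longrightarrow> x \<in> carrier G" by (rule subgroup.mem_carrier)
    show "subgroup A G" using normal_imp_subgroup[OF nA] .
    show "A \<subseteq> P <#> Q" unfolding A_def using mono_set_mult[OF D(2) E(2)] .
    show "a \<otimes> b = b \<otimes> a" if ab: "a \<in> A" "b \<in> A" for a b
    proof -
      obtain d e d' e' where de: "d \<in> D" "e \<in> E" "a = d \<otimes> e" "d' \<in> D" "e' \<in> E" "b = d' \<otimes> e'"
        using ab by (auto simp: A_def set_mult_def)
      note G = D'(7)[OF de(1)] E'(7)[OF de(2)] D'(7)[OF de(4)] E'(7)[OF de(5)]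
      have "a \<otimes> b = d \<otimes> (e \<otimes> d') \<otimes> e'" using de G by (simp add: m_assoc)
      also have "\<dots> = (d \<otimes> d') \<otimes> (e \<otimes> e')" using G by (simp add: m_assoc flip: comm[OF de(4,2)])
      also have "\<dots> = (d' \<otimes> d) \<otimes> (e' \<otimes> e)" using D'(2) E'(2) de by simp
      also have "\<dots> = d' \<otimes> (d \<otimes> e') \<otimes> e" using G by (simp add: m_assoc)
      also have "\<dots> = b \<otimes> a" using de G by (simp add: m_assoc comm[OF de(1,5)])
      finally show ?thesis .
    qed
    show "x \<otimes> a \<otimes> inv x \<in> A" if "x \<in> P <#> Q" "a \<in> A" for x a
      using normal_invE(2)[OF nA PQG[OF that(1)] that(2)] .
    show l0: "l > 0" using D'(4) E'(4) by (simp add: l_def)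
    show "\<exists>j. a [^] (l ^ j) = \<one>" if a: "a \<in> A" for a
    proof -
      obtain d e where de: "d \<in> D" "e \<in> E" "a = d \<otimes> e" using a by (auto simp: A_def set_mult_def)
      note G = D'(7)[OF de(1)] E'(7)[OF de(2)]
      obtain i j where ij: "d [^] (l ^ i) = \<one>" "e [^] (l ^ j) = \<one>" using torsD torsE de by blast
      have "d [^] (l ^ (i + j)) = (d [^] (l ^ i)) [^] (l ^ j)" "e [^] (l ^ (i + j)) = (e [^] (l ^ j)) [^] (l ^ i)"
        using G by (simp_all add: nat_pow_pow power_add mult.commute)
      then have "d [^] (l ^ (i + j)) = \<one>" "e [^] (l ^ (i + j)) = \<one>" using ij by simp_all
      then have "a [^] (l ^ (i + j)) = \<one>" using pow_mult_distrib[OF comm[OF de(1,2)] G] de(3) by simp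
      then show ?thesis ..
    qed
    show "finite {a \<in> A. a [^] l = \<one>}"
      unfolding A_def using finite_torsion_set_mult[OF D(1) E(1) comm l0 torsD] by simp
    show "finite (R <#> S)" using R(1) S(1) by (auto simp: set_mult_def)
    show "R <#> S \<subseteq> carrier G" 
      by (rule set_mult_closed) (use R(2) S(2) PG QG in blast)+
    show "\<exists>a\<in>A. \<exists>r\<in>R <#> S. x = a \<otimes> r" if x: "x \<in> P <#> Q" for x
    proof -
      obtain p q where pq: "p \<in> P" "q \<in> Q" "x = p \<otimes> q" using x by (auto simp: set_mult_def)
      obtain d r where dr: "d \<in> D" "r \<in> R" "p = d \<otimes> r" using R(3)[OF pq(1)] by blast
      obtain e s where es: "e \<in> E" "s \<in> S" "q = e \<otimes> s" using S(3)[OF pq(2)] by blast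
      note G = D'(7)[OF dr(1)] E'(7)[OF es(1)] PG[OF subsetD[OF R(2) dr(2)]] QG[OF subsetD[OF S(2) es(2)]]
      have "x = (d \<otimes> (r \<otimes> e \<otimes> inv r)) \<otimes> (r \<otimes> s)" using pq dr es G by (simp add: m_assoc)
      moreover have "d \<otimes> (r \<otimes> e \<otimes> inv r) \<in> A"
        unfolding A_def using mem_set_multI[OF dr(1) E(3)[OF G(3) es(1)]] .
      ultimately show ?thesis using mem_set_multI[OF dr(2) es(2)] by blast
    qed
  qed
qed

lemma (in group) chernikov_finite_subgroup:
  assumes K: "subgroup K G" and fin: "finite K"
  shows "chernikov_group (G\<lparr>carrier := K\<rparr>)"
proof (rule chernikov_subgroupI[where A = "{\<one>}" and n = 1 and R = K])
  show "K \<subseteq> carrier G" using K by (rule subgroup.subset)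
  show "\<exists>a\<in>{\<one>}. \<exists>r\<in>K. x = a \<otimes> r" if "x \<in> K" for x
    using subgroup.mem_carrier[OF K that] that by force
  show "{\<one>} \<subseteq> K" using K subgroup.one_closed by blast
  show "x \<otimes> a \<otimes> inv x \<in> {\<one>}" if "x \<in> K" "a \<in> {\<one>}" for x a using subgroup.mem_carrier[OF K] that by auto
qed (use K fin triv_subgroup in auto)

lemma (in group) chernikov_normal_finite_family:
  assumes "finite \<N>" "\<And>K. K \<in> \<N> \<Longrightarrow> K \<lhd> G" "\<And>K. K \<in> \<N> \<Longrightarrow> chernikov_group (G\<lparr>carrier := K\<rparr>)"
  shows "\<exists>Y. Y \<lhd> G \<and> chernikov_group (G\<lparr>carrier := Y\<rparr>) \<and> (\<forall>K\<in>\<N>. K \<subseteq> Y)"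
  using assms
proof (induction \<N> rule: finite_induct)
  case empty
  then show ?case using one_is_normal chernikov_finite_subgroup[OF triv_subgroup] by auto
next
  case (insert K \<N>)
  then obtain Y where Y: "Y \<lhd> G" "chernikov_group (G\<lparr>carrier := Y\<rparr>)" "\<forall>K\<in>\<N>. K \<subseteq> Y" by auto
  have K: "K \<lhd> G" "chernikov_group (G\<lparr>carrier := K\<rparr>)" using insert.prems by auto
  have "K \<subseteq> K <#> Y"
  proof
    fix x assume x: "x \<in> K"
    have "x \<otimes> \<one> \<in> K <#> Y"
      using mem_set_multI[OF x subgroup.one_closed[OF normal_imp_subgroup[OF Y(1)]]] .
    then show "x \<in> K <#> Y" using subgroup.mem_carrier[OF normal_imp_subgroup[OF K(1)] x] by simp
  qed
  moreover have "Y \<subseteq> K <#> Y"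
  proof
    fix x assume x: "x \<in> Y"
    have "\<one> \<otimes> x \<in> K <#> Y"
      using mem_set_multI[OF subgroup.one_closed[OF normal_imp_subgroup[OF K(1)]] x] .
    then show "x \<in> K <#> Y" using subgroup.mem_carrier[OF normal_imp_subgroup[OF Y(1)] x] by simp
  qed
  ultimately show ?case
    using normal_set_mult[OF K(1) Y(1)] chernikov_normal_set_mult[OF K Y(1,2)] Y(3)
    by (intro exI[of _ "K <#> Y"]) auto
qed

section \<open>Action on a normal Chernikov subgroup\<close>

lemma (in group) normal_centralizer:
  assumes M: "M \<lhd> G"
  shows "centralizer G M \<lhd> G"
proof (rule normal_invI)
  note M' = normal_invE[OF M]
  note MG = subgroup.mem_carrier[OF M'(1)]
  show "subgroup (centralizer G M) G"
  proof (rule subgroupI)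
    show "centralizer G M \<subseteq> carrier G" by (auto simp: centralizer_def)
    show "centralizer G M \<noteq> {}" using MG by (auto simp: centralizer_def intro!: exI[of _ \<one>])
    show "inv a \<in> centralizer G M" if a: "a \<in> centralizer G M" for a
    proof -
      have "inv a \<otimes> s = s \<otimes> inv a" if s: "s \<in> M" for s
      proof -
        have aG: "a \<in> carrier G" and as: "a \<otimes> s = s \<otimes> a" using a s by (auto simp: centralizer_def)
        have "inv a \<otimes> (a \<otimes> s) \<otimes> inv a = inv a \<otimes> (s \<otimes> a) \<otimes> inv a" by (simp add: as)
        then show ?thesis using aG MG[OF s] by (simp add: m_assoc)
      qed
      then show ?thesis using a by (simp add: centralizer_def)
    qed
    show "a \<otimes> b \<in> centralizer G M" if a: "a \<in> centralizer G M" and b: "b \<in> centralizer G M" for a b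
    proof -
      have "a \<otimes> b \<otimes> s = s \<otimes> (a \<otimes> b)" if s: "s \<in> M" for s
      proof -
        have G: "a \<in> carrier G" "b \<in> carrier G" "s \<in> carrier G" and c: "a \<otimes> s = s \<otimes> a" "b \<otimes> s = s \<otimes> b"
          using a b s MG by (auto simp: centralizer_def)
        have "a \<otimes> b \<otimes> s = (a \<otimes> s) \<otimes> b" using G by (simp add: m_assoc c(2))
        then show ?thesis using G by (simp add: m_assoc c(1))
      qed
      then show ?thesis using a b by (simp add: centralizer_def)
    qed
  qed
  show "x \<otimes> h \<otimes> inv x \<in> centralizer G M" if x: "x \<in> carrier G" and h: "h \<in> centralizer G M" for x h
  proof -
    have hG: "h \<in> carrier G" using h by (simp add: centralizer_def)
    have "x \<otimes> h \<otimes> inv x \<otimes> s = s \<otimes> (x \<otimes> h \<otimes> inv x)" if s: "s \<in> M" for s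
    proof -
      define t where "t = inv x \<otimes> s \<otimes> x"
      have "t \<in> M" using M'(2)[of "inv x" s] x s by (simp add: t_def)
      then have ht: "h \<otimes> t = t \<otimes> h" and tG: "t \<in> carrier G" using h MG by (auto simp: centralizer_def)
      have s_eq: "s = x \<otimes> t \<otimes> inv x" using x MG[OF s] by (simp add: t_def m_assoc)
      have "x \<otimes> h \<otimes> inv x \<otimes> s = x \<otimes> (h \<otimes> t) \<otimes> inv x" using x hG tG by (simp add: s_eq m_assoc)
      also have "\<dots> = s \<otimes> (x \<otimes> h \<otimes> inv x)" unfolding ht using x hG tG by (simp add: s_eq m_assoc)
      finally show ?thesis .
    qed
    then show ?thesis using x hG by (simp add: centralizer_def)
  qed
qed

text \<open>Finite index of \<open>C\<close>, witnessed by a map to a finite set that separates the cosets of \<open>C\<close>.\<close>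

lemma (in group) finite_transversal:
  assumes fin: "finite (F ` carrier G)"
    and eq: "\<And>g h. g \<in> carrier G \<Longrightarrow> h \<in> carrier G \<Longrightarrow> F g = F h \<Longrightarrow> inv h \<otimes> g \<in> C" and C: "C \<lhd> G"
  obtains T where "finite T" "T \<subseteq> carrier G" "\<And>g. g \<in> carrier G \<Longrightarrow> \<exists>c\<in>C. \<exists>t\<in>T. g = c \<otimes> t"
proof -
  obtain T where T: "T \<subseteq> carrier G" "finite T" "F ` carrier G = F ` T"
    using finite_subset_image[OF fin order_refl] by metis
  have "\<exists>c\<in>C. \<exists>t\<in>T. g = c \<otimes> t" if g: "g \<in> carrier G" for g
  proof -
    obtain t where t: "t \<in> T" "F g = F t" using g T(3) by (metis imageE imageI)
    have tG: "t \<in> carrier G" using t T by blast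
    have "inv t \<otimes> g \<in> C" using eq[OF g tG t(2)] .
    then have "t \<otimes> (inv t \<otimes> g) \<otimes> inv t \<in> C" by (rule normal_invE(2)[OF C tG])
    then have "g \<otimes> inv t \<in> C" using g tG by simp
    moreover have "g = (g \<otimes> inv t) \<otimes> t" using g tG by (simp add: m_assoc)
    ultimately show ?thesis using t by blast
  qed
  then show thesis using that T by blast
qed

text \<open>Let \<open>D\<close> be the divisible part of \<open>L\<close>, and \<open>C\<^sub>0\<close> the set of all \<open>g\<close> that
  centralize \<open>D\<close> and act trivially on \<open>M\<close> modulo \<open>D\<close>. By rigidity \<open>C\<^sub>0\<close> has finite
  index, as it contains the kernel of an action on finite sets. For fixed \<open>y \<in> M\<close> the commutator with \<open>y\<close> is a homomorphism from
  \<open>C\<^sub>0\<close> to \<open>D\<close>. Taking representatives \<open>y\<close> of \<open>M\<close> modulo \<open>D\<close>, one embeds the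
  image of \<open>C\<^sub>0\<close> modulo the centralizer of \<open>M\<close> into a finite power of \<open>D\<close>.\<close>

theorem (in group) chernikov_quotient_centralizer:
  assumes periodic: "\<And>g. g \<in> carrier G \<Longrightarrow> ord g \<noteq> 0"
    and L: "L \<lhd> G" "chernikov_group (G\<lparr>carrier := L\<rparr>)" and M: "M \<lhd> G" "M \<subseteq> L"
  shows "chernikov_group (G Mod centralizer G M)"
proof -
  define C where "C = centralizer G M"
  have C: "C \<lhd> G" unfolding C_def by (rule normal_centralizer[OF M(1)])
  interpret C: normal C G by (rule C)
  let ?Q = "G Mod C"
  interpret Q: group "?Q" by (rule C.factorgroup_is_group)
  define \<phi> where "\<phi> g = C #> g" for g
  interpret \<phi>: group_hom G "?Q" \<phi> using C.group_hom_FactGroup by (simp add: \<phi>_def[abs_def])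
  have \<phi>1: "\<phi> g = \<one>\<^bsub>?Q\<^esub> \<longleftrightarrow> g \<in> C" if "g \<in> carrier G" for g
    using C.rcos_eq_one_FactGroup_iff[OF that] by (simp add: \<phi>_def)
  have carQ: "carrier (?Q) = \<phi> ` carrier G" by (simp add: carrier_FactGroup \<phi>_def)
  obtain D n N R where D: "divisible_min G D n" "D \<subseteq> L"
      and normD: "\<And>x d. x \<in> carrier G \<Longrightarrow> d \<in> D \<Longrightarrow> x \<otimes> d \<otimes> inv x \<in> D"
      and R: "finite R" "R \<subseteq> L" "\<And>x. x \<in> L \<Longrightarrow> \<exists>d\<in>D. \<exists>r\<in>R. x = d \<otimes> r"
    using chernikov_normalE[OF L] by (metis (no_types, lifting))
  note D' = divisible_minD[OF D(1)]
  note Dm = subgroup.m_closed[OF D'(1)] and Di = subgroup.m_inv_closed[OF D'(1)]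
  note M' = normal_invE[OF M(1)]
  have MG: "x \<in> carrier G" if "x \<in> M" for x using subgroup.mem_carrier[OF M'(1) that] .
  have LG: "x \<in> carrier G" if "x \<in> L" for x using subgroup.mem_carrier[OF normal_imp_subgroup[OF L(1)] that] .
  \<comment> \<open>the commutator with \<open>y\<close>\<close>
  define \<delta> where "\<delta> g y = g \<otimes> y \<otimes> inv g \<otimes> inv y" for g y
  define C0 where "C0 = {g \<in> carrier G. (\<forall>d\<in>D. g \<otimes> d = d \<otimes> g) \<and> (\<forall>y\<in>M. \<delta> g y \<in> D)}"
  have C0G: "g \<in> carrier G" if "g \<in> C0" for g using that by (simp add: C0_def)
  have C0D: "g \<otimes> d = d \<otimes> g" if "g \<in> C0" "d \<in> D" for g d using that by (simp add: C0_def)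
  have C0\<delta>: "\<delta> g y \<in> D" if "g \<in> C0" "y \<in> M" for g y using that by (simp add: C0_def)
  have \<delta>_mult: "\<delta> (g \<otimes> h) y = \<delta> h y \<otimes> \<delta> g y" if g: "g \<in> C0" and h: "h \<in> C0" and y: "y \<in> M" for g h y
  proof -
    note G = C0G[OF g] C0G[OF h] MG[OF y] D'(7)[OF C0\<delta>[OF h y]]
    have "\<delta> (g \<otimes> h) y = (g \<otimes> \<delta> h y) \<otimes> (y \<otimes> inv g \<otimes> inv y)"
      using G(1-3) by (simp add: \<delta>_def m_assoc inv_mult_group)
    also have "\<dots> = \<delta> h y \<otimes> \<delta> g y"
      unfolding C0D[OF g C0\<delta>[OF h y]] using G by (simp add: \<delta>_def[of g] m_assoc)
    finally show ?thesis .
  qed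
  have C0: "C0 \<lhd> G"
  proof (rule normal_invI)
    show "subgroup C0 G"
    proof (rule subgroupI)
      show "C0 \<subseteq> carrier G" using C0G by blast
      have "\<one> \<in> C0" using D'(7) subgroup.one_closed[OF D'(1)] MG by (simp add: C0_def \<delta>_def)
      then show "C0 \<noteq> {}" by blast
      show "g \<otimes> h \<in> C0" if g: "g \<in> C0" and h: "h \<in> C0" for g h
      proof -
        have "g \<otimes> h \<otimes> d = d \<otimes> (g \<otimes> h)" if d: "d \<in> D" for d
        proof -
          note G = C0G[OF g] C0G[OF h] D'(7)[OF d]
          have "g \<otimes> h \<otimes> d = (g \<otimes> d) \<otimes> h" using G by (simp add: m_assoc C0D[OF h d])
          then show ?thesis using G by (simp add: m_assoc C0D[OF g d])
        qed
        moreover have "\<delta> (g \<otimes> h) y \<in> D" if "y \<in> M" for y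
          using \<delta>_mult[OF g h that] Dm[OF C0\<delta>[OF h that] C0\<delta>[OF g that]] by simp
        ultimately show ?thesis using C0G[OF g] C0G[OF h] by (simp add: C0_def)
      qed
      show "inv g \<in> C0" if g: "g \<in> C0" for g
      proof -
        note gG = C0G[OF g]
        have "inv g \<otimes> d = d \<otimes> inv g" if d: "d \<in> D" for d
        proof -
          have "inv g \<otimes> (g \<otimes> d) \<otimes> inv g = inv g \<otimes> (d \<otimes> g) \<otimes> inv g" by (simp add: C0D[OF g d])
          then show ?thesis using gG D'(7)[OF d] by (simp add: m_assoc)
        qed
        moreover have "\<delta> (inv g) y \<in> D" if y: "y \<in> M" for y
        proof -
          have "\<delta> (inv g) y = inv g \<otimes> inv (\<delta> g y) \<otimes> inv (inv g)"
            using gG MG[OF y] by (simp add: \<delta>_def m_assoc inv_mult_group)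
          then show ?thesis using normD[OF inv_closed[OF gG] Di[OF C0\<delta>[OF g y]]] by simp
        qed
        ultimately show ?thesis using gG by (simp add: C0_def)
      qed
    qed
    show "x \<otimes> g \<otimes> inv x \<in> C0" if x: "x \<in> carrier G" and g: "g \<in> C0" for x g
    proof -
      note gG = C0G[OF g]
      have "x \<otimes> g \<otimes> inv x \<otimes> d = d \<otimes> (x \<otimes> g \<otimes> inv x)" if d: "d \<in> D" for d
      proof -
        define e where "e = inv x \<otimes> d \<otimes> x"
        have eD: "e \<in> D" using normD[OF inv_closed[OF x] d] x by (simp add: e_def)
        note eG = D'(7)[OF eD]
        have d_eq: "d = x \<otimes> e \<otimes> inv x" using x D'(7)[OF d] by (simp add: e_def m_assoc)
        have "x \<otimes> g \<otimes> inv x \<otimes> d = x \<otimes> (g \<otimes> e) \<otimes> inv x" using x gG eG by (simp add: d_eq m_assoc)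
        also have "\<dots> = d \<otimes> (x \<otimes> g \<otimes> inv x)" unfolding C0D[OF g eD] using x gG eG by (simp add: d_eq m_assoc)
        finally show ?thesis .
      qed
      moreover have "\<delta> (x \<otimes> g \<otimes> inv x) y \<in> D" if y: "y \<in> M" for y
      proof -
        define z where "z = inv x \<otimes> y \<otimes> x"
        have zM: "z \<in> M" using M'(2)[OF inv_closed[OF x] y] x by (simp add: z_def)
        have "\<delta> (x \<otimes> g \<otimes> inv x) y = x \<otimes> \<delta> g z \<otimes> inv x"
          using x gG MG[OF y] by (simp add: \<delta>_def z_def m_assoc inv_mult_group)
        then show ?thesis using normD[OF x C0\<delta>[OF g zM]] by simp
      qed
      ultimately show ?thesis using x gG by (simp add: C0_def)
    qed
  qed
  \<comment> \<open>finitely many representatives of \<open>M\<close> modulo \<open>D\<close>\<close>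
  obtain S where S: "finite S" "S \<subseteq> M" "\<And>y. y \<in> M \<Longrightarrow> \<exists>d\<in>D. \<exists>s\<in>S. y = d \<otimes> s"
  proof -
    define f where "f r = (SOME y. y \<in> M \<and> (\<exists>d\<in>D. y = d \<otimes> r))" for r
    define R' where "R' = {r \<in> R. \<exists>d\<in>D. d \<otimes> r \<in> M}"
    have f: "f r \<in> M \<and> (\<exists>d\<in>D. f r = d \<otimes> r)" if "r \<in> R'" for r
      unfolding f_def by (rule someI_ex) (use that in \<open>auto simp: R'_def\<close>)
    have "\<exists>d\<in>D. \<exists>s\<in>f ` R'. y = d \<otimes> s" if y: "y \<in> M" for y
    proof -
      obtain d r where dr: "d \<in> D" "r \<in> R" "y = d \<otimes> r" using R(3) M(2) y by blast
      then have r: "r \<in> R'" using y by (auto simp: R'_def)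
      then obtain e where e: "e \<in> D" "f r = e \<otimes> r" using f by blast
      have "y = (d \<otimes> inv e) \<otimes> f r"
        using dr(3) e D'(7)[OF dr(1)] D'(7)[OF e(1)] LG[OF subsetD[OF R(2) dr(2)]] by (simp add: m_assoc)
      then show ?thesis using Dm[OF dr(1) Di[OF e(1)]] r by blast
    qed
    moreover have "finite (f ` R')" using R(1) by (simp add: R'_def)
    moreover have "f ` R' \<subseteq> M" using f by blast
    ultimately show thesis using that by blast
  qed
  have SG: "s \<in> carrier G" if "s \<in> S" for s using that S(2) MG by blast
  have ker: "g \<in> C" if g: "g \<in> C0" and s: "\<And>s. s \<in> S \<Longrightarrow> \<delta> g s = \<one>" for g
  proof -
    have "g \<otimes> y = y \<otimes> g" if y: "y \<in> M" for y
    proof -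
      obtain d t where dt: "d \<in> D" "t \<in> S" "y = d \<otimes> t" using S(3)[OF y] by blast
      note G = C0G[OF g] D'(7)[OF dt(1)] SG[OF dt(2)]
      have "\<delta> g t \<otimes> t \<otimes> g = t \<otimes> g" using s[OF dt(2)] G by simp
      then have gt: "g \<otimes> t = t \<otimes> g" using G by (simp add: \<delta>_def m_assoc)
      have "g \<otimes> y = (g \<otimes> d) \<otimes> t" using G by (simp add: dt(3) m_assoc)
      also have "\<dots> = d \<otimes> (g \<otimes> t)" unfolding C0D[OF g dt(1)] using G by (simp add: m_assoc)
      also have "\<dots> = y \<otimes> g" unfolding gt using G by (simp add: dt(3) m_assoc)
      finally show ?thesis .
    qed
    then show ?thesis using C0G[OF g] unfolding C_def centralizer_def by blast
  qed
  have \<delta>C: "\<delta> g y = \<one>" if "g \<in> C" "y \<in> M" for g y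
  proof -
    have gG: "g \<in> carrier G" and gy: "g \<otimes> y = y \<otimes> g"
      using that unfolding C_def centralizer_def by blast+
    show ?thesis unfolding \<delta>_def gy using gG MG[OF that(2)] by (simp add: m_assoc)
  qed
  have \<delta>_pow: "\<delta> (g [^] (i::nat)) y = \<delta> g y [^] i" if g: "g \<in> C0" and y: "y \<in> M" for g y i
  proof (induction i)
    case 0
    then show ?case using MG[OF y] by (simp add: \<delta>_def)
  next
    case (Suc i)
    have gi: "g [^] i \<in> C0" using power_mem_subgroup[OF normal_imp_subgroup[OF C0] g] .
    have "\<delta> (g [^] Suc i) y = \<delta> g y \<otimes> \<delta> (g [^] i) y" using \<delta>_mult[OF gi g y] by simp
    then show ?case using Suc nat_pow_Suc2[OF D'(7)[OF C0\<delta>[OF g y]]] by simp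
  qed
  \<comment> \<open>The coset of \<open>g\<close> modulo \<open>C0\<close> is determined by the conjugates of the elements of \<open>S2\<close>
    and the classes modulo \<open>D\<close> of the conjugates of the elements of \<open>S\<close>.\<close>
  define S2 where "S2 = {d \<in> D. d [^] (n ^ 2) = \<one>}"
  have finS2: "finite S2" using D'(6)[of "n ^ 2"] D'(4) by (simp add: S2_def)
  have conjS2: "g \<otimes> s \<otimes> inv g \<in> S2" if g: "g \<in> carrier G" and s: "s \<in> S2" for g s
    using s normD[OF g] conj_nat_pow[OF g, of s "n ^ 2", symmetric] D'(7) g by (auto simp: S2_def)
  define \<rho> where "\<rho> y = (SOME r. r \<in> R \<and> (\<exists>d\<in>D. y = d \<otimes> r))" for y
  have \<rho>: "\<rho> y \<in> R \<and> (\<exists>d\<in>D. y = d \<otimes> \<rho> y)" if "y \<in> L" for y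
    unfolding \<rho>_def by (rule someI_ex) (use R(3)[OF that] in blast)
  define F where "F g = (restrict (\<lambda>s. g \<otimes> s \<otimes> inv g) S2, restrict (\<lambda>s. \<rho> (g \<otimes> s \<otimes> inv g)) S)" for g
  have conjM: "g \<otimes> y \<otimes> inv g \<in> L" if "g \<in> carrier G" "y \<in> M" for g y using M'(2)[OF that] M(2) by blast
  have "F ` carrier G \<subseteq> (S2 \<rightarrow>\<^sub>E S2) \<times> (S \<rightarrow>\<^sub>E R)"
    using conjS2 \<rho> conjM S(2) by (auto simp: F_def)
  then have finF: "finite (F ` carrier G)"
    by (rule finite_subset) (intro finite_cartesian_product finite_PiE finS2 S(1) R(1))
  have eqF: "inv h \<otimes> g \<in> C0" if g: "g \<in> carrier G" and h: "h \<in> carrier G" and e: "F g = F h" for g h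
  proof -
    define k where "k = inv h \<otimes> g"
    have k: "k \<in> carrier G" using g h by (simp add: k_def)
    have e1: "restrict (\<lambda>s. g \<otimes> s \<otimes> inv g) S2 = restrict (\<lambda>s. h \<otimes> s \<otimes> inv h) S2"
      and e2: "restrict (\<lambda>s. \<rho> (g \<otimes> s \<otimes> inv g)) S = restrict (\<lambda>s. \<rho> (h \<otimes> s \<otimes> inv h)) S"
      using e unfolding F_def by blast+
    have 1: "k \<otimes> s = s \<otimes> k" if s: "s \<in> S2" for s
    proof -
      have sG: "s \<in> carrier G" using s D'(7) by (simp add: S2_def)
      have "g \<otimes> s \<otimes> inv g = h \<otimes> s \<otimes> inv h" using fun_cong[OF e1, of s] s by simp
      then have "inv h \<otimes> (g \<otimes> s \<otimes> inv g) \<otimes> g = inv h \<otimes> (h \<otimes> s \<otimes> inv h) \<otimes> g" by simp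
      then show ?thesis using g h sG by (simp add: k_def m_assoc)
    qed
    have kD: "k \<otimes> d = d \<otimes> k" if d: "d \<in> D" for d
    proof (rule centralizes_divisible[OF D(1) k _ pow_ord_eq_1[OF k] _ _ d])
      show "0 < ord k" using periodic[OF k] by simp
      show "k \<otimes> s = s \<otimes> k" if "s \<in> D" "s [^] n\<^sup>2 = \<one>" for s using 1[of s] that by (simp add: S2_def)
    qed (rule normD[OF k])
    have 2: "\<delta> k s \<in> D" if s: "s \<in> S" for s
    proof -
      note sG = SG[OF s]
      have r: "\<rho> (g \<otimes> s \<otimes> inv g) = \<rho> (h \<otimes> s \<otimes> inv h)"
        using fun_cong[OF e2, of s] s by simp
      obtain r0 where r0: "r0 = \<rho> (g \<otimes> s \<otimes> inv g)" by simp
      have sM: "s \<in> M" using s S(2) by blast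
      obtain d1 where d1: "d1 \<in> D" "g \<otimes> s \<otimes> inv g = d1 \<otimes> r0"
        unfolding r0 using \<rho>[OF conjM[OF g sM]] by blast
      obtain d2 where d2: "d2 \<in> D" "h \<otimes> s \<otimes> inv h = d2 \<otimes> r0"
        unfolding r0 r using \<rho>[OF conjM[OF h sM]] by blast
      have rG: "r0 \<in> carrier G" unfolding r0 using \<rho>[OF conjM[OF g sM]] R(2) LG by blast
      have "h \<otimes> \<delta> k s \<otimes> inv h = (g \<otimes> s \<otimes> inv g) \<otimes> inv (h \<otimes> s \<otimes> inv h)"
        using g h sG by (simp add: \<delta>_def k_def m_assoc inv_mult_group)
      also have "\<dots> = d1 \<otimes> inv d2"
        unfolding d1(2) d2(2) using D'(7)[OF d1(1)] D'(7)[OF d2(1)] rG by (simp add: m_assoc inv_mult_group)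
      finally have "h \<otimes> \<delta> k s \<otimes> inv h \<in> D" using Dm[OF d1(1) Di[OF d2(1)]] by simp
      then have "inv h \<otimes> (h \<otimes> \<delta> k s \<otimes> inv h) \<otimes> inv (inv h) \<in> D" by (rule normD[OF inv_closed[OF h]])
      moreover have "\<delta> k s \<in> carrier G" using k sG by (simp add: \<delta>_def)
      ultimately show ?thesis using h by (simp add: m_assoc)
    qed
    have "\<delta> k y \<in> D" if y: "y \<in> M" for y
    proof -
      obtain d t where dt: "d \<in> D" "t \<in> S" "y = d \<otimes> t" using S(3)[OF y] by blast
      note G = k D'(7)[OF dt(1)] SG[OF dt(2)]
      have "\<delta> k y = (k \<otimes> d) \<otimes> (t \<otimes> inv k \<otimes> inv t \<otimes> inv d)"
        using G by (simp add: \<delta>_def dt(3) m_assoc inv_mult_group)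
      also have "\<dots> = d \<otimes> \<delta> k t \<otimes> inv d" unfolding kD[OF dt(1)] using G by (simp add: \<delta>_def m_assoc)
      also have "\<dots> \<in> D" using normD[OF D'(7)[OF dt(1)] 2[OF dt(2)]] .
      finally show ?thesis .
    qed
    then have "k \<in> C0" using k kD unfolding C0_def by blast
    then show ?thesis by (simp add: k_def)
  qed
  obtain T where T: "finite T" "T \<subseteq> carrier G" "\<And>g. g \<in> carrier G \<Longrightarrow> \<exists>c\<in>C0. \<exists>t\<in>T. g = c \<otimes> t"
  proof (rule finite_transversal[OF finF _ C0])
    show "inv h \<otimes> g \<in> C0" if "g \<in> carrier G" "h \<in> carrier G" "F g = F h" for g h
      using eqF[OF that] .
  qed (rule that)
  have "chernikov_group ((?Q)\<lparr>carrier := carrier (?Q)\<rparr>)"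
  proof (rule Q.chernikov_subgroupI[where A = "\<phi> ` C0" and n = n and R = "\<phi> ` T"])
    show "subgroup (carrier (?Q)) (?Q)" by (rule Q.subgroup_self)
    show "subgroup (\<phi> ` C0) (?Q)" by (rule \<phi>.subgroup_img_is_subgroup[OF normal_imp_subgroup[OF C0]])
    then show "\<phi> ` C0 \<subseteq> carrier (?Q)" by (rule subgroup.subset)
    show "a \<otimes>\<^bsub>?Q\<^esub> b = b \<otimes>\<^bsub>?Q\<^esub> a" if ab: "a \<in> \<phi> ` C0" "b \<in> \<phi> ` C0" for a b
    proof -
      obtain g h where gh: "g \<in> C0" "h \<in> C0" "a = \<phi> g" "b = \<phi> h" using ab by blast
      note G = C0G[OF gh(1)] C0G[OF gh(2)]
      define k where "k = inv (h \<otimes> g) \<otimes> (g \<otimes> h)"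
      have kG: "k \<in> carrier G" using G by (simp add: k_def)
      have "k \<otimes> y = y \<otimes> k" if y: "y \<in> M" for y
      proof -
        have "\<delta> (g \<otimes> h) y = \<delta> (h \<otimes> g) y"
          using \<delta>_mult[OF gh(1,2) y] \<delta>_mult[OF gh(2,1) y] D'(2)[OF C0\<delta>[OF gh(1) y] C0\<delta>[OF gh(2) y]] by simp
        then have "(inv (h \<otimes> g) \<otimes> \<delta> (g \<otimes> h) y) \<otimes> (y \<otimes> (g \<otimes> h)) = (inv (h \<otimes> g) \<otimes> \<delta> (h \<otimes> g) y) \<otimes> (y \<otimes> (g \<otimes> h))"
          by simp
        then show ?thesis using G MG[OF y] by (simp add: \<delta>_def k_def m_assoc inv_mult_group)
      qed
      then have "k \<in> C" using kG unfolding C_def centralizer_def by blast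
      then have "\<phi> k = \<one>\<^bsub>?Q\<^esub>" using \<phi>1 kG by blast
      moreover have "g \<otimes> h = (h \<otimes> g) \<otimes> k" using G by (simp add: k_def m_assoc inv_mult_group)
      ultimately have "\<phi> (g \<otimes> h) = \<phi> (h \<otimes> g)" 
        using \<phi>.hom_mult[of "h \<otimes> g" k] Q.r_one[OF \<phi>.hom_closed[of "h \<otimes> g"]] G kG by (simp del: \<phi>.hom_mult)
      then show ?thesis unfolding gh(3,4) using G by simp
    qed
    show "x \<otimes>\<^bsub>?Q\<^esub> a \<otimes>\<^bsub>?Q\<^esub> inv\<^bsub>?Q\<^esub> x \<in> \<phi> ` C0" if x: "x \<in> carrier (?Q)" and a: "a \<in> \<phi> ` C0" for x a
    proof -
      obtain h g where gh: "h \<in> carrier G" "g \<in> C0" "x = \<phi> h" "a = \<phi> g" using x a carQ by blast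
      have "\<phi> (h \<otimes> g \<otimes> inv h) = x \<otimes>\<^bsub>?Q\<^esub> a \<otimes>\<^bsub>?Q\<^esub> inv\<^bsub>?Q\<^esub> x"
        unfolding gh(3,4) using gh(1) C0G[OF gh(2)] by simp
      then show ?thesis using normal_invE(2)[OF C0 gh(1,2)] by (metis imageI)
    qed
    show "n > 0" by (rule D'(4))
    show "\<exists>j. a [^]\<^bsub>?Q\<^esub> (n ^ j) = \<one>\<^bsub>?Q\<^esub>" if a: "a \<in> \<phi> ` C0" for a
    proof -
      obtain g where g: "g \<in> C0" "a = \<phi> g" using a by blast
      have "\<forall>s\<in>S. \<exists>j. \<delta> g s [^] (n ^ j) = \<one>" using D'(5) C0\<delta>[OF g(1)] S(2) by blast
      then obtain j where j: "\<And>s. s \<in> S \<Longrightarrow> \<delta> g s [^] (n ^ j s) = \<one>" by metis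
      define J where "J = sum j S"
      have "\<delta> (g [^] (n ^ J)) s = \<one>" if s: "s \<in> S" for s
      proof -
        have "j s \<le> J" unfolding J_def by (rule member_le_sum[OF s _ S(1)]) simp
        then have "n ^ J = n ^ j s * n ^ (J - j s)" by (simp flip: power_add)
        moreover have sM: "s \<in> M" using s S(2) by blast
        moreover have "(\<delta> g s [^] (n ^ j s)) [^] (n ^ (J - j s)) = \<one>" using j[OF s] by simp
        ultimately show ?thesis
          using \<delta>_pow[OF g(1) sM, of "n ^ J"] D'(7)[OF C0\<delta>[OF g(1) sM]] by (simp add: nat_pow_pow)
      qed
      then have "g [^] (n ^ J) \<in> C" by (rule ker[OF power_mem_subgroup[OF normal_imp_subgroup[OF C0] g(1)]])
      then have "\<phi> (g [^] (n ^ J)) = \<one>\<^bsub>?Q\<^esub>" using \<phi>1 C0G[OF g(1)] by simp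
      then have "a [^]\<^bsub>?Q\<^esub> (n ^ J) = \<one>\<^bsub>?Q\<^esub>"
        unfolding g(2) using \<phi>.hom_nat_pow[OF C0G[OF g(1)], of "n ^ J"] by simp
      then show ?thesis ..
    qed
    show "finite {a \<in> \<phi> ` C0. a [^]\<^bsub>?Q\<^esub> n = \<one>\<^bsub>?Q\<^esub>}"
    proof -
      define W where "W = {g \<in> C0. g [^] n \<in> C}"
      define V where "V g = restrict (\<delta> g) S" for g
      have W: "\<delta> g s \<in> {d \<in> D. d [^] n = \<one>}" if g: "g \<in> W" and s: "s \<in> S" for g s
      proof -
        have sM: "s \<in> M" using s S(2) by blast
        have "\<delta> g s [^] n = \<delta> (g [^] n) s" using \<delta>_pow[of g s n] g sM by (simp add: W_def)
        also have "\<dots> = \<one>" using \<delta>C[of "g [^] n" s] g sM by (simp add: W_def)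
        finally show ?thesis using C0\<delta>[of g s] g sM by (simp add: W_def)
      qed
      have "V ` W \<subseteq> (S \<rightarrow>\<^sub>E {d \<in> D. d [^] n = \<one>})" using W by (auto simp: V_def)
      then have finV: "finite (V ` W)"
        by (rule finite_subset) (intro finite_PiE S(1) D'(6)[OF D'(4)])
      have eqV: "\<phi> g = \<phi> h" if g: "g \<in> W" and h: "h \<in> W" and e: "V g = V h" for g h
      proof -
        have gC: "g \<in> C0" "h \<in> C0" using g h by (auto simp: W_def)
        have ihC: "inv h \<in> C0" using subgroup.m_inv_closed[OF normal_imp_subgroup[OF C0] gC(2)] .
        have "inv h \<otimes> g \<in> C"
        proof (rule ker)
          show "inv h \<otimes> g \<in> C0" using subgroup.m_closed[OF normal_imp_subgroup[OF C0] ihC gC(1)] .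
          show "\<delta> (inv h \<otimes> g) s = \<one>" if s: "s \<in> S" for s
          proof -
            have sM: "s \<in> M" using s S(2) by blast
            have "\<delta> g s = \<delta> h s" using fun_cong[OF e[unfolded V_def], of s] s by simp
            then have "\<delta> (inv h \<otimes> g) s = \<delta> (inv h \<otimes> h) s"
              using \<delta>_mult[OF ihC gC(1) sM] \<delta>_mult[OF ihC gC(2) sM] by simp
            then show ?thesis using C0G[OF gC(2)] MG[OF sM] by (simp add: \<delta>_def)
          qed
        qed
        then have "\<phi> (inv h \<otimes> g) = \<one>\<^bsub>?Q\<^esub>" using \<phi>1[of "inv h \<otimes> g"] C0G[OF gC(1)] C0G[OF gC(2)] by (simp del: \<phi>.hom_mult)
        moreover have "g = h \<otimes> (inv h \<otimes> g)" using C0G[OF gC(1)] C0G[OF gC(2)] by simp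
        ultimately show ?thesis
          using \<phi>.hom_mult[of h "inv h \<otimes> g"] Q.r_one[OF \<phi>.hom_closed[of h]] C0G[OF gC(1)] C0G[OF gC(2)]
          by (simp del: \<phi>.hom_mult)
      qed
      have "{a \<in> \<phi> ` C0. a [^]\<^bsub>?Q\<^esub> n = \<one>\<^bsub>?Q\<^esub>} \<subseteq> \<phi> ` W"
      proof
        fix a assume a: "a \<in> {a \<in> \<phi> ` C0. a [^]\<^bsub>?Q\<^esub> n = \<one>\<^bsub>?Q\<^esub>}"
        then obtain g where g: "g \<in> C0" "a = \<phi> g" by blast
        have "\<phi> (g [^] n) = \<one>\<^bsub>?Q\<^esub>" using a g(2) \<phi>.hom_nat_pow[OF C0G[OF g(1)]] by simp
        then have "g \<in> W" using \<phi>1[of "g [^] n"] g(1) C0G[OF g(1)] by (simp add: W_def)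
        then show "a \<in> \<phi> ` W" using g(2) by blast
      qed
      moreover have "finite (\<phi> ` W)"
      proof -
        obtain W' where W': "W' \<subseteq> W" "finite W'" "V ` W = V ` W'"
          using finite_subset_image[OF finV order_refl] by metis
        have "\<phi> ` W \<subseteq> \<phi> ` W'"
        proof
          fix a assume "a \<in> \<phi> ` W"
          then obtain g where g: "g \<in> W" "a = \<phi> g" by blast
          then obtain h where "h \<in> W'" "V g = V h" using W'(3) by (metis imageE imageI)
          then show "a \<in> \<phi> ` W'" using eqV[OF g(1), of h] W'(1) g(2) by blast
        qed
        then show ?thesis using W'(2) finite_surj by blast
      qed
      ultimately show ?thesis by (rule finite_subset)
    qed
    show "finite (\<phi> ` T)" using T(1) by simp
    show "\<phi> ` T \<subseteq> carrier (?Q)" using T(2) carQ by blast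
    show "\<exists>a\<in>\<phi> ` C0. \<exists>r\<in>\<phi> ` T. x = a \<otimes>\<^bsub>?Q\<^esub> r" if x: "x \<in> carrier (?Q)" for x
    proof -
      obtain g where g: "g \<in> carrier G" "x = \<phi> g" using x carQ by blast
      obtain c t where ct: "c \<in> C0" "t \<in> T" "g = c \<otimes> t" using T(3)[OF g(1)] by blast
      then have "x = \<phi> c \<otimes>\<^bsub>?Q\<^esub> \<phi> t" using \<phi>.hom_mult[of c t] C0G T(2) g(2) by blast
      then show ?thesis using ct by blast
    qed
  qed
  then show ?thesis by (simp add: C_def)
qed

section \<open>Layers, and \<open>CL\<close>-groups as \<open>CC\<close>-groups\<close>

lemma (in group) ord_subgroup_eq:
  assumes "subgroup H G"
  shows "group.ord (G\<lparr>carrier := H\<rparr>) x = ord x"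
  using group.ord_def[OF subgroup_imp_group[OF assms]] by (simp add: ord_def nat_pow_consistent[symmetric])

lemma (in group) ord_conj:
  assumes "g \<in> carrier G" "x \<in> carrier G"
  shows "ord (g \<otimes> x \<otimes> inv g) = ord x"
proof -
  have "(g \<otimes> x \<otimes> inv g) [^] n = \<one> \<longleftrightarrow> x [^] n = \<one>" for n :: nat
  proof -
    have "(g \<otimes> x \<otimes> inv g) [^] n = g \<otimes> x [^] n \<otimes> inv g" using conj_nat_pow[OF assms] by simp
    moreover have "g \<otimes> x [^] n \<otimes> inv g = \<one> \<longleftrightarrow> g \<otimes> x [^] n = g"
      using assms by (metis inv_closed inv_equality inv_inv m_closed nat_pow_closed r_inv)
    ultimately show ?thesis using assms by simp
  qed
  then show ?thesis by (simp add: ord_def)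
qed

lemma (in group) layer_subgroup_eq:
  assumes "subgroup H G"
  shows "layer (G\<lparr>carrier := H\<rparr>) m = generate G {x \<in> H. element_order G x = m}"
proof -
  have "element_order (G\<lparr>carrier := H\<rparr>) x = element_order G x" for x
    by (simp add: element_order_def ord_subgroup_eq[OF assms])
  then have "layer (G\<lparr>carrier := H\<rparr>) m = generate (G\<lparr>carrier := H\<rparr>) {x \<in> H. element_order G x = m}"
    by (simp add: layer_def)
  also have "\<dots> = generate G {x \<in> H. element_order G x = m}" by (rule generate_consistent[OF _ assms]) auto
  finally show ?thesis .
qed

lemma (in group) layer_normal:
  assumes H: "H \<lhd> G"
  shows "layer (G\<lparr>carrier := H\<rparr>) m \<lhd> G"
  unfolding layer_subgroup_eq[OF normal_imp_subgroup[OF H]]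
proof (rule normal_generateI)
  have HG: "h \<in> carrier G" if "h \<in> H" for h using subgroup.mem_carrier[OF normal_imp_subgroup[OF H] that] .
  then show "{x \<in> H. element_order G x = m} \<subseteq> carrier G" by blast
  show "g \<otimes> h \<otimes> inv g \<in> {x \<in> H. element_order G x = m}"
    if "h \<in> {x \<in> H. element_order G x = m}" "g \<in> carrier G" for h g
    using that normal_invE(2)[OF H] HG ord_conj[of g h] by (auto simp: element_order_def)
qed

lemma (in group) mem_layer:
  assumes "subgroup H G" "x \<in> H" "ord x \<noteq> 0"
  shows "x \<in> layer (G\<lparr>carrier := H\<rparr>) (enat (ord x))"
  unfolding layer_subgroup_eq[OF assms(1)] using assms by (intro generate.incl) (simp add: element_order_def)

lemma (in group) layer_subset:
  assumes "subgroup H G"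
  shows "layer (G\<lparr>carrier := H\<rparr>) m \<subseteq> H"
  unfolding layer_subgroup_eq[OF assms] by (rule generate_subgroup_incl[OF _ assms]) auto

lemma (in group) chernikov_periodic:
  assumes K: "subgroup K G" "chernikov_group (G\<lparr>carrier := K\<rparr>)" and x: "x \<in> K"
  shows "ord x \<noteq> 0"
proof -
  obtain D n N R where D: "divisible_min G D n" and N: "N > (0::nat)" "\<And>x. x \<in> K \<Longrightarrow> x [^] N \<in> D"
    using chernikov_subgroupE[OF K] by (metis (no_types, lifting))
  have xG: "x \<in> carrier G" using subgroup.mem_carrier[OF K(1) x] .
  obtain j where "(x [^] N) [^] (n ^ j) = \<one>" using divisible_minD(5)[OF D N(2)[OF x]] by blast
  then have "ord x dvd N * n ^ j" using xG pow_eq_id by (simp add: nat_pow_pow)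
  moreover have "N * n ^ j \<noteq> 0" using N(1) divisible_minD(4)[OF D] by simp
  ultimately show ?thesis by (metis dvd_0_left)
qed

lemma CL_group_layer:
  assumes "CL_group G" "m > 0"
  shows "chernikov_group (G\<lparr>carrier := layer G m\<rparr>)"
  using assms by (simp add: CL_group_def)

lemma CL_group_periodic:
  assumes CL: "CL_group G" and x: "x \<in> carrier G"
  shows "group.ord G x \<noteq> 0"
proof
  interpret group G using CL by (simp add: CL_group_def)
  assume o: "ord x = 0"
  have "x \<in> layer G \<infinity>" unfolding layer_def using x o by (intro generate.incl) (simp add: element_order_def)
  moreover have "subgroup (layer G \<infinity>) G" unfolding layer_def by (rule generate_is_subgroup) auto
  moreover have "chernikov_group (G\<lparr>carrier := layer G \<infinity>\<rparr>)" using CL_group_layer[OF CL] by simp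
  ultimately show False using chernikov_periodic o by blast
qed

lemma (in group) normal_closure_props:
  assumes S: "S \<subseteq> carrier G"
  shows "normal_closure G S \<lhd> G" "S \<subseteq> normal_closure G S"
    and "\<And>N. N \<lhd> G \<Longrightarrow> S \<subseteq> N \<Longrightarrow> normal_closure G S \<subseteq> N"
proof -
  have "carrier G \<lhd> G" by (rule normal_invI[OF subgroup_self]) auto
  then have ne: "{N. N \<lhd> G \<and> S \<subseteq> N} \<noteq> {}" using S by blast
  show "normal_closure G S \<lhd> G"
    unfolding normal_closure_def
  proof (rule normal_invI)
    show "subgroup (\<Inter> {N. N \<lhd> G \<and> S \<subseteq> N}) G"
      by (rule subgroups_Inter) (use ne normal_imp_subgroup in auto)
    show "x \<otimes> h \<otimes> inv x \<in> \<Inter> {N. N \<lhd> G \<and> S \<subseteq> N}"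
      if "x \<in> carrier G" "h \<in> \<Inter> {N. N \<lhd> G \<and> S \<subseteq> N}" for x h
      using that normal_invE(2) by blast
  qed
qed (auto simp: normal_closure_def)

theorem CL_group_imp_CC_group:
  assumes CL: "CL_group G"
  shows "CC_group G"
  unfolding CC_group_def
proof (intro conjI ballI)
  show gr: "group G" using CL by (simp add: CL_group_def)
  interpret group G by (rule gr)
  fix x assume x: "x \<in> carrier G"
  have o: "ord x \<noteq> 0" using CL_group_periodic[OF CL x] .
  define L where "L = layer G (enat (ord x))"
  have carn: "carrier G \<lhd> G" by (rule normal_invI[OF subgroup_self]) auto
  have "L \<lhd> G" using layer_normal[OF carn, of "enat (ord x)"] by (simp add: L_def)
  moreover have "chernikov_group (G\<lparr>carrier := L\<rparr>)"
    unfolding L_def using o by (intro CL_group_layer[OF CL]) (simp add: zero_enat_def)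
  moreover have "x \<in> L" using mem_layer[OF subgroup_self x o] by (simp add: L_def)
  then have "generate G {x} \<subseteq> L"
    using generate_subgroup_incl[of "{x}" L] normal_imp_subgroup[OF \<open>L \<lhd> G\<close>] by simp
  moreover have "generate G {x} \<subseteq> carrier G" using generate_incl x by simp
  ultimately show "chernikov_group (G Mod centralizer G (normal_closure G (generate G {x})))"
    using chernikov_quotient_centralizer[OF CL_group_periodic[OF CL]] normal_closure_props by metis
qed

text \<open>The layer of the order of \<open>y\<close> in \<open>N\<close> is normal in the whole group and contains \<open>y\<close>,
  so it is all of \<open>N\<close>.\<close>

lemma (in group) normal_closure_chernikov:
  assumes N: "N \<lhd> G" and CL: "CL_group (G\<lparr>carrier := N\<rparr>)" and y: "y \<in> N"
    and eq: "N = normal_closure G (generate G {y})"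
  shows "chernikov_group (G\<lparr>carrier := N\<rparr>)"
proof -
  note sN = normal_imp_subgroup[OF N]
  have o: "ord y \<noteq> 0" using CL_group_periodic[OF CL, of y] y ord_subgroup_eq[OF sN] by simp
  define L where "L = layer (G\<lparr>carrier := N\<rparr>) (enat (ord y))"
  have nL: "L \<lhd> G" unfolding L_def by (rule layer_normal[OF N])
  have "y \<in> L" unfolding L_def by (rule mem_layer[OF sN y o])
  then have "generate G {y} \<subseteq> L" using generate_subgroup_incl[of "{y}" L] normal_imp_subgroup[OF nL] by simp
  then have "N \<subseteq> L"
    unfolding eq using normal_closure_props(3)[of "generate G {y}" L] nL generate_incl[of "{y}"]
      subgroup.mem_carrier[OF sN y] by simp
  then have "L = N" using layer_subset[OF sN] by (auto simp: L_def)
  then show ?thesis using CL_group_layer[OF CL, of "enat (ord y)"] o by (simp add: L_def zero_enat_def)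
qed

section \<open>Chernikov quotients and the transfer\<close>

text \<open>The divisible part of \<open>G / C\<close>, pulled back to \<open>G\<close>.\<close>

lemma (in group) chernikov_quotientE:
  assumes C: "C \<lhd> G" and ch: "chernikov_group (G Mod C)"
  obtains E n R where "E \<lhd> G" "C \<subseteq> E" "finite R" "R \<subseteq> carrier G" "\<And>x. x \<in> carrier G \<Longrightarrow> \<exists>a\<in>E. \<exists>r\<in>R. x = a \<otimes> r"
    "\<And>a b. a \<in> E \<Longrightarrow> b \<in> E \<Longrightarrow> \<exists>c\<in>C. a \<otimes> b = c \<otimes> (b \<otimes> a)"
    "\<And>a N. a \<in> E \<Longrightarrow> N > (0::nat) \<Longrightarrow> \<exists>e\<in>E. \<exists>c\<in>C. a = c \<otimes> e [^] N"
    "n > 0" "\<And>a. a \<in> E \<Longrightarrow> \<exists>j. a [^] ((n::nat) ^ j) \<in> C"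
proof -
  interpret C: normal C G by (rule C)
  let ?Q = "G Mod C"
  interpret Q: group "?Q" by (rule C.factorgroup_is_group)
  define \<phi> where "\<phi> g = C #> g" for g
  interpret \<phi>: group_hom G "?Q" \<phi> using C.group_hom_FactGroup by (simp add: \<phi>_def[abs_def])
  have carQ: "carrier (?Q) = \<phi> ` carrier G" by (simp add: carrier_FactGroup \<phi>_def)
  have \<phi>eq: "\<exists>c\<in>C. a = c \<otimes> b" if "a \<in> carrier G" "\<phi> a = \<phi> b" for a b
  proof -
    have "a \<in> C #> b" using that rcos_self[OF that(1) C.subgroup_axioms] by (simp add: \<phi>_def)
    then show ?thesis by (auto simp: r_coset_def)
  qed
  have \<phi>1: "\<phi> g = \<one>\<^bsub>?Q\<^esub> \<longleftrightarrow> g \<in> C" if "g \<in> carrier G" for g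
    using C.rcos_eq_one_FactGroup_iff[OF that] by (simp add: \<phi>_def)
  have "chernikov_group ((?Q)\<lparr>carrier := carrier (?Q)\<rparr>)" using ch by simp
  then obtain D n N R where D: "divisible_min (?Q) D n" "D \<subseteq> carrier (?Q)"
      and normD: "\<And>x d. x \<in> carrier (?Q) \<Longrightarrow> d \<in> D \<Longrightarrow> x \<otimes>\<^bsub>?Q\<^esub> d \<otimes>\<^bsub>?Q\<^esub> inv\<^bsub>?Q\<^esub> x \<in> D"
      and R: "finite R" "R \<subseteq> carrier (?Q)"
        "\<And>x. x \<in> carrier (?Q) \<Longrightarrow> \<exists>d\<in>D. \<exists>r\<in>R. x = d \<otimes>\<^bsub>?Q\<^esub> r"
    using Q.chernikov_subgroupE[OF Q.subgroup_self] by (metis (no_types, lifting))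
  note D' = divisible_minD[OF D(1)]
  define E where "E = {g \<in> carrier G. \<phi> g \<in> D}"
  have EG: "a \<in> carrier G" if "a \<in> E" for a using that by (simp add: E_def)
  have nE: "E \<lhd> G"
  proof (rule normal_invI)
    show "subgroup E G"
    proof (rule subgroupI)
      show "E \<subseteq> carrier G" using EG by blast
      have "\<one> \<in> E" using subgroup.one_closed[OF D'(1)] \<phi>.hom_one by (simp add: E_def)
      then show "E \<noteq> {}" by blast
      show "inv a \<in> E" if "a \<in> E" for a
        using that subgroup.m_inv_closed[OF D'(1), of "\<phi> a"] \<phi>.hom_inv[of a] by (simp add: E_def)
      show "a \<otimes> b \<in> E" if "a \<in> E" "b \<in> E" for a b
        using that subgroup.m_closed[OF D'(1), of "\<phi> a" "\<phi> b"] \<phi>.hom_mult[of a b] by (simp add: E_def)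
    qed
    show "x \<otimes> h \<otimes> inv x \<in> E" if "x \<in> carrier G" "h \<in> E" for x h
      using that normD[of "\<phi> x" "\<phi> h"] \<phi>.hom_mult[of "x \<otimes> h" "inv x"] \<phi>.hom_mult[of x h] \<phi>.hom_inv[of x]
        \<phi>.hom_closed[of x] by (simp add: E_def del: mult_FactGroup)
  qed
  have CE: "C \<subseteq> E"
  proof
    fix c assume c: "c \<in> C"
    have cG: "c \<in> carrier G" using C.subset c by blast
    have "\<phi> c = \<one>\<^bsub>?Q\<^esub>" using \<phi>1[OF cG] c by blast
    then show "c \<in> E" using cG subgroup.one_closed[OF D'(1)] by (simp add: E_def)
  qed
  obtain T where T: "T \<subseteq> carrier G" "finite T" "R = \<phi> ` T"
    using finite_subset_image[OF R(1), of \<phi> "carrier G"] R(2) carQ by metis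
  show thesis
  proof (rule that[OF nE CE T(2,1)])
    show "\<exists>a\<in>E. \<exists>r\<in>T. x = a \<otimes> r" if x: "x \<in> carrier G" for x
    proof -
      obtain d t where dt: "d \<in> D" "t \<in> T" "\<phi> x = d \<otimes>\<^bsub>?Q\<^esub> \<phi> t"
        using R(3)[OF \<phi>.hom_closed[OF x]] T(3) by blast
      have tG: "t \<in> carrier G" using dt(2) T(1) by blast
      have "\<phi> (x \<otimes> inv t) = d \<otimes>\<^bsub>?Q\<^esub> \<phi> t \<otimes>\<^bsub>?Q\<^esub> inv\<^bsub>?Q\<^esub> \<phi> t"
        using \<phi>.hom_mult[OF x inv_closed[OF tG]] \<phi>.hom_inv[OF tG] dt(3) by (simp del: mult_FactGroup)
      also have "\<dots> = d" using D'(7)[OF dt(1)] \<phi>.hom_closed[OF tG] Q.m_assoc Q.r_inv Q.r_one Q.inv_closed by metis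
      finally have "x \<otimes> inv t \<in> E" using x tG dt(1) by (simp add: E_def)
      moreover have "x = (x \<otimes> inv t) \<otimes> t" using x tG by (simp add: m_assoc)
      ultimately show ?thesis using dt(2) by blast
    qed
    show "\<exists>c\<in>C. a \<otimes> b = c \<otimes> (b \<otimes> a)" if ab: "a \<in> E" "b \<in> E" for a b
    proof (rule \<phi>eq)
      show "a \<otimes> b \<in> carrier G" using EG ab by simp
      show "\<phi> (a \<otimes> b) = \<phi> (b \<otimes> a)"
        using \<phi>.hom_mult[OF EG EG, OF ab] \<phi>.hom_mult[OF EG EG, OF ab(2,1)] D'(2)[of "\<phi> a" "\<phi> b"] ab
        by (simp add: E_def del: mult_FactGroup)
    qed
    show "\<exists>e\<in>E. \<exists>c\<in>C. a = c \<otimes> e [^] N" if a: "a \<in> E" and N: "N > 0" for a and N :: nat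
    proof -
      obtain d where d: "d \<in> D" "d [^]\<^bsub>?Q\<^esub> N = \<phi> a" using D'(3)[OF _ N, of "\<phi> a"] a by (auto simp: E_def)
      then obtain e where e: "e \<in> carrier G" "d = \<phi> e" using D(2) carQ by blast
      have "\<phi> a = \<phi> (e [^] N)" using \<phi>.hom_nat_pow[OF e(1), of N] d e by simp
      then obtain c where "c \<in> C" "a = c \<otimes> e [^] N" using \<phi>eq[OF EG[OF a]] by blast
      moreover have "e \<in> E" using e d by (simp add: E_def)
      ultimately show ?thesis by blast
    qed
    show "n > 0" by (rule D'(4))
    show "\<exists>j. a [^] (n ^ j) \<in> C" if a: "a \<in> E" for a
    proof -
      obtain j where "\<phi> a [^]\<^bsub>?Q\<^esub> (n ^ j) = \<one>\<^bsub>?Q\<^esub>" using D'(5)[of "\<phi> a"] a by (auto simp: E_def)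
      then have "\<phi> (a [^] (n ^ j)) = \<one>\<^bsub>?Q\<^esub>" using \<phi>.hom_nat_pow[OF EG[OF a], of "n ^ j"] by simp
      then show ?thesis using \<phi>1[of "a [^] (n ^ j)"] EG[OF a] by auto
    qed
  qed
qed

text \<open>The transfer into an abelian subgroup of finite index. On right cosets \<open>X\<close> with representatives \<open>\<rho> X\<close>,
  it is the product of the elements \<open>\<rho> X \<otimes> g \<otimes> inv \<rho> (X #> g)\<close>. For central \<open>z\<close> in \<open>A\<close>
  each factor is \<open>z\<close>.\<close>

lemma (in group) transfer:
  assumes A: "subgroup A G" "\<And>a b. a \<in> A \<Longrightarrow> b \<in> A \<Longrightarrow> a \<otimes> b = b \<otimes> a" and fin: "finite (rcosets A)"
  obtains \<tau> where "\<tau> \<in> hom G (G\<lparr>carrier := A\<rparr>)"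
    "\<And>z. z \<in> A \<Longrightarrow> (\<And>g. g \<in> carrier G \<Longrightarrow> z \<otimes> g = g \<otimes> z) \<Longrightarrow> \<tau> z = z [^] card (rcosets A)"
proof -
  let ?A = "G\<lparr>carrier := A\<rparr>"
  interpret A: comm_group "?A" using comm_group_subgroup A by blast
  note AG = subgroup.mem_carrier[OF A(1)]
  have Asub: "A \<subseteq> carrier G" using AG by blast
  define \<rho> where "\<rho> X = (SOME x. x \<in> X)" for X :: "'a set"
  have cos: "X \<subseteq> carrier G" if "X \<in> rcosets A" for X
    using that r_coset_subset_G[OF Asub] by (auto simp: RCOSETS_def)
  have \<rho>: "\<rho> X \<in> X" "\<rho> X \<in> carrier G" "X = A #> \<rho> X" if X: "X \<in> rcosets A" for X
  proof -
    obtain x where x: "x \<in> carrier G" "X = A #> x" using X by (auto simp: RCOSETS_def)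
    then have "x \<in> X" using rcos_self A(1) by blast
    then show 1: "\<rho> X \<in> X" unfolding \<rho>_def by (rule someI)
    then show "\<rho> X \<in> carrier G" using cos X by blast
    show "X = A #> \<rho> X" using repr_independence[OF _ x(1) A(1), of "\<rho> X"] 1 x(2) by simp
  qed
  have act: "X #> g \<in> rcosets A" if "X \<in> rcosets A" "g \<in> carrier G" for X g
    using that coset_mult_assoc[OF Asub] by (auto simp: RCOSETS_def)
  define t where "t g X = \<rho> X \<otimes> g \<otimes> inv (\<rho> (X #> g))" for g X
  have tA: "t g X \<in> A" if g: "g \<in> carrier G" and X: "X \<in> rcosets A" for g X
  proof -
    have "\<rho> X \<otimes> g \<in> X #> g" using \<rho>(1)[OF X] by (auto simp: r_coset_def)
    also have "X #> g = A #> \<rho> (X #> g)" using \<rho>(3)[OF act[OF X g]] .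
    finally obtain a where a: "a \<in> A" "\<rho> X \<otimes> g = a \<otimes> \<rho> (X #> g)" by (auto simp: r_coset_def)
    have "t g X = a" unfolding t_def a(2) using AG[OF a(1)] \<rho>(2)[OF act[OF X g]] by (simp add: m_assoc)
    then show ?thesis using a(1) by simp
  qed
  define \<tau> where "\<tau> g = finprod (?A) (t g) (rcosets A)" for g
  have "\<tau> \<in> hom G (?A)"
  proof (rule homI)
    show "\<tau> g \<in> carrier (?A)" if "g \<in> carrier G" for g
      unfolding \<tau>_def by (rule A.finprod_closed) (use tA that in auto)
    show "\<tau> (g \<otimes> h) = \<tau> g \<otimes>\<^bsub>?A\<^esub> \<tau> h" if g: "g \<in> carrier G" and h: "h \<in> carrier G" for g h
    proof -
      have inj: "inj_on (\<lambda>X. X #> g) (rcosets A)"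
      proof (rule inj_onI)
        fix X Y assume XY: "X \<in> rcosets A" "Y \<in> rcosets A" "X #> g = Y #> g"
        then have "X #> g #> inv g = Y #> g #> inv g" by simp
        then show "X = Y" using coset_mult_assoc[OF cos[OF XY(1)] g] coset_mult_assoc[OF cos[OF XY(2)] g] g cos XY(1,2) by simp
      qed
      have im: "(\<lambda>X. X #> g) ` (rcosets A) = rcosets A"
        by (rule endo_inj_surj[OF fin _ inj]) (use act g in blast)
      have "\<tau> (g \<otimes> h) = finprod (?A) (\<lambda>X. t g X \<otimes>\<^bsub>?A\<^esub> t h (X #> g)) (rcosets A)"
        unfolding \<tau>_def
      proof (rule A.finprod_cong')
        show "(\<lambda>X. t g X \<otimes>\<^bsub>?A\<^esub> t h (X #> g)) \<in> rcosets A \<rightarrow> carrier (?A)"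
          using tA g h act subgroup.m_closed[OF A(1)] by auto
        show "t (g \<otimes> h) X = t g X \<otimes>\<^bsub>?A\<^esub> t h (X #> g)" if X: "X \<in> rcosets A" for X
        proof -
          have "X #> (g \<otimes> h) = X #> g #> h" using coset_mult_assoc[OF cos[OF X] g h] by simp
          then show ?thesis
            using \<rho>(2)[OF X] \<rho>(2)[OF act[OF X g]] \<rho>(2)[OF act[OF act[OF X g] h]] g h by (simp add: t_def m_assoc)
        qed
      qed simp
      also have "\<dots> = finprod (?A) (t g) (rcosets A) \<otimes>\<^bsub>?A\<^esub>
          finprod (?A) (\<lambda>X. t h (X #> g)) (rcosets A)"
        by (rule A.finprod_multf) (use tA g h act in auto)
      also have "finprod (?A) (\<lambda>X. t h (X #> g)) (rcosets A)
          = finprod (?A) (t h) ((\<lambda>X. X #> g) ` (rcosets A))"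
        by (rule A.finprod_reindex[symmetric]) (use tA h im inj in auto)
      finally show ?thesis unfolding im \<tau>_def .
    qed
  qed
  moreover have "\<tau> z = z [^] card (rcosets A)" if z: "z \<in> A" "\<And>g. g \<in> carrier G \<Longrightarrow> z \<otimes> g = g \<otimes> z" for z
  proof -
    have "t z X = z" if X: "X \<in> rcosets A" for X
    proof -
      note r = \<rho>(2)[OF X]
      have "X #> z = A #> (\<rho> X \<otimes> z)" using coset_mult_assoc[OF Asub r AG[OF z(1)]] \<rho>(3)[OF X] by simp
      also have "\<dots> = A #> z #> \<rho> X" unfolding z(2)[OF r, symmetric] using coset_mult_assoc[OF Asub AG[OF z(1)] r] by simp
      also have "\<dots> = X" using coset_join2[OF AG[OF z(1)] A(1) z(1)] \<rho>(3)[OF X] by simp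
      finally have "X #> z = X" .
      then have "t z X = z \<otimes> \<rho> X \<otimes> inv (\<rho> X)" unfolding t_def z(2)[OF r] by simp
      then show ?thesis using AG[OF z(1)] r by (simp add: m_assoc)
    qed
    then have "\<tau> z = finprod (?A) (\<lambda>_. z) (rcosets A)"
      unfolding \<tau>_def by (intro A.finprod_cong') (use z in auto)
    also have "\<dots> = z [^]\<^bsub>?A\<^esub> card (rcosets A)" by (rule A.finprod_const) (use z in simp)
    finally show ?thesis by (simp add: nat_pow_consistent[symmetric])
  qed
  ultimately show thesis using that by blast
qed

lemma (in group) central_torsion_transfer:
  assumes A: "subgroup A G" "\<And>a b. a \<in> A \<Longrightarrow> b \<in> A \<Longrightarrow> a \<otimes> b = b \<otimes> a" and fin: "finite (rcosets A)"
    and gen: "carrier G = generate G X" "\<And>x. x \<in> X \<Longrightarrow> x [^] (m::nat) = \<one>" "X \<subseteq> carrier G"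
    and z: "z \<in> A" "\<And>g. g \<in> carrier G \<Longrightarrow> z \<otimes> g = g \<otimes> z"
  shows "z [^] (card (rcosets A) * m) = \<one>"
proof -
  let ?A = "G\<lparr>carrier := A\<rparr>"
  interpret A: comm_group "?A" using comm_group_subgroup A by blast
  obtain \<tau> where \<tau>: "\<tau> \<in> hom G (?A)" and \<tau>z: "\<tau> z = z [^] card (rcosets A)"
    using transfer[OF A fin] z by metis
  interpret \<tau>: group_hom G "?A" \<tau> by unfold_locales (rule \<tau>)
  have "\<tau> g [^]\<^bsub>?A\<^esub> m = \<one>\<^bsub>?A\<^esub>" if g: "g \<in> generate G X" for g
    using g
  proof (induction rule: generate.induct)
    case one
    then show ?case using \<tau>.hom_one A.nat_pow_one by metis
  next
    case (incl h)
    have h: "h \<in> carrier G" using incl gen(3) by blast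
    show ?case using \<tau>.hom_nat_pow[OF h, of m] gen(2)[OF incl] \<tau>.hom_one by metis
  next
    case (inv h)
    have h: "h \<in> carrier G" using inv gen(3) by blast
    have "\<tau> (inv h) [^]\<^bsub>?A\<^esub> m = \<tau> (inv h [^] m)" using \<tau>.hom_nat_pow[OF inv_closed[OF h], of m] by simp
    also have "inv h [^] m = \<one>" using nat_pow_inv[OF h] gen(2)[OF inv] by simp
    finally show ?case using \<tau>.hom_one by simp
  next
    case (eng g h)
    have gh: "g \<in> carrier G" "h \<in> carrier G" using eng gen(1) by auto
    show ?case
      unfolding \<tau>.hom_mult[OF gh] A.nat_pow_distrib[OF \<tau>.hom_closed[OF gh(1)] \<tau>.hom_closed[OF gh(2)]] eng.IH
      by (rule A.l_one[OF A.one_closed])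
  qed
  moreover have zG: "z \<in> carrier G" using subgroup.mem_carrier[OF A(1) z(1)] .
  ultimately have "\<tau> z [^] m = \<one>" using gen(1) by (simp add: nat_pow_consistent[symmetric])
  then show ?thesis unfolding \<tau>z using zG by (simp add: nat_pow_pow)
qed

lemma (in group) finite_rcosets_transversal:
  assumes A: "subgroup A G" and R: "finite R" "R \<subseteq> carrier G" "\<And>x. x \<in> carrier G \<Longrightarrow> \<exists>a\<in>A. \<exists>r\<in>R. x = a \<otimes> r"
  shows "finite (rcosets A)"
proof (rule finite_subset)
  show "rcosets A \<subseteq> (\<lambda>r. A #> r) ` R"
  proof
    fix X assume "X \<in> rcosets A"
    then obtain x where x: "x \<in> carrier G" "X = A #> x" by (auto simp: RCOSETS_def)
    obtain a r where ar: "a \<in> A" "r \<in> R" "x = a \<otimes> r" using R(3)[OF x(1)] by blast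
    have "x \<in> A #> r" using ar by (auto simp: r_coset_def)
    then have "A #> r = A #> x" using repr_independence[OF _ _ A] ar(2) R(2) by blast
    then show "X \<in> (\<lambda>r. A #> r) ` R" using x ar(2) by blast
  qed
qed (use R(1) in simp)

lemma (in group) power_mem_finite_index:
  assumes H: "H \<lhd> G" and R: "finite R" "R \<subseteq> carrier G" "\<And>x. x \<in> carrier G \<Longrightarrow> \<exists>a\<in>H. \<exists>r\<in>R. x = a \<otimes> r"
  obtains k where "k > (0::nat)" "\<And>x. x \<in> carrier G \<Longrightarrow> x [^] k \<in> H"
proof
  interpret H: normal H G by (rule H)
  interpret M: group "G Mod H" by (rule H.factorgroup_is_group)
  have "finite (rcosets H)" using finite_rcosets_transversal[OF H.subgroup_axioms R] .
  then show "order (G Mod H) > 0" using M.order_gt_0_iff_finite by (simp add: FactGroup_def)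
  show "x [^] order (G Mod H) \<in> H" if x: "x \<in> carrier G" for x
  proof -
    have "H #> x \<in> carrier (G Mod H)" using x by (auto simp: carrier_FactGroup)
    then have "(H #> x) [^]\<^bsub>G Mod H\<^esub> order (G Mod H) = H" using M.pow_order_eq_1 by simp
    then have "H #> (x [^] order (G Mod H)) = H" using H.FactGroup_pow x by simp
    then show ?thesis using coset_join1[OF _ _ H.subgroup_axioms] x by simp
  qed
qed

lemma (in group) exponent_mod_of_generators:
  assumes C: "C \<lhd> G" and ab: "\<And>a b. a \<in> carrier G \<Longrightarrow> b \<in> carrier G \<Longrightarrow> \<exists>c\<in>C. a \<otimes> b = c \<otimes> (b \<otimes> a)"
    and gen: "carrier G = generate G X" "\<And>x. x \<in> X \<Longrightarrow> x [^] (m::nat) \<in> C" "X \<subseteq> carrier G"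
    and g: "g \<in> carrier G"
  shows "g [^] m \<in> C"
proof -
  interpret C: normal C G by (rule C)
  let ?Q = "G Mod C"
  interpret Q: group "?Q" by (rule C.factorgroup_is_group)
  define \<phi> where "\<phi> g = C #> g" for g
  interpret \<phi>: group_hom G "?Q" \<phi> using C.group_hom_FactGroup by (simp add: \<phi>_def[abs_def])
  have \<phi>1: "\<phi> g = \<one>\<^bsub>?Q\<^esub> \<longleftrightarrow> g \<in> C" if "g \<in> carrier G" for g
    using C.rcos_eq_one_FactGroup_iff[OF that] by (simp add: \<phi>_def)
  have comm: "\<phi> a \<otimes>\<^bsub>?Q\<^esub> \<phi> b = \<phi> b \<otimes>\<^bsub>?Q\<^esub> \<phi> a" if a: "a \<in> carrier G" and b: "b \<in> carrier G" for a b
  proof -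
    obtain c where c: "c \<in> C" "a \<otimes> b = c \<otimes> (b \<otimes> a)" using ab[OF a b] by blast
    have cG: "c \<in> carrier G" using C.subset c(1) by blast
    have "\<phi> (a \<otimes> b) = \<phi> c \<otimes>\<^bsub>?Q\<^esub> \<phi> (b \<otimes> a)" unfolding c(2) using \<phi>.hom_mult[OF cG m_closed[OF b a]] .
    also have "\<phi> c = \<one>\<^bsub>?Q\<^esub>" using \<phi>1[OF cG] c(1) by blast
    also have "\<one>\<^bsub>?Q\<^esub> \<otimes>\<^bsub>?Q\<^esub> \<phi> (b \<otimes> a) = \<phi> (b \<otimes> a)" using \<phi>.hom_closed[OF m_closed[OF b a]] by (rule Q.l_one)
    finally show ?thesis unfolding \<phi>.hom_mult[OF a b] \<phi>.hom_mult[OF b a] .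
  qed
  have "\<phi> g [^]\<^bsub>?Q\<^esub> m = \<one>\<^bsub>?Q\<^esub>" if "g \<in> generate G X" for g
    using that
  proof (induction rule: generate.induct)
    case one
    then show ?case using \<phi>.hom_one Q.nat_pow_one by metis
  next
    case (incl h)
    have h: "h \<in> carrier G" using incl gen(3) by blast
    show ?case using \<phi>.hom_nat_pow[OF h, of m] gen(2)[OF incl] \<phi>1[of "h [^] m"] h by simp
  next
    case (inv h)
    have h: "h \<in> carrier G" using inv gen(3) by blast
    have "\<phi> (inv h) [^]\<^bsub>?Q\<^esub> m = \<phi> (inv h [^] m)" using \<phi>.hom_nat_pow[OF inv_closed[OF h], of m] by simp
    also have "inv h [^] m \<in> C" using nat_pow_inv[OF h] subgroup.m_inv_closed[OF C.subgroup_axioms gen(2)[OF inv]] by simp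
    then have "\<phi> (inv h [^] m) = \<one>\<^bsub>?Q\<^esub>" using \<phi>1[of "inv h [^] m"] h by blast
    finally show ?case .
  next
    case (eng g h)
    have gh: "g \<in> carrier G" "h \<in> carrier G" using eng gen(1) by auto
    show ?case
      unfolding \<phi>.hom_mult[OF gh] Q.pow_mult_distrib[OF comm[OF gh] \<phi>.hom_closed[OF gh(1)] \<phi>.hom_closed[OF gh(2)]] eng.IH
      by (rule Q.l_one[OF Q.one_closed])
  qed
  then have "\<phi> g [^]\<^bsub>?Q\<^esub> m = \<one>\<^bsub>?Q\<^esub>" using g unfolding gen(1) by blast
  then show ?thesis using \<phi>.hom_nat_pow[OF g, of m] \<phi>1[OF nat_pow_closed[OF g]] by metis
qed

lemma (in group) generate_exponent:
  assumes X: "X \<subseteq> carrier G" "\<And>x. x \<in> X \<Longrightarrow> x [^] (m::nat) = \<one>"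
    and comm: "\<And>a b. a \<in> generate G X \<Longrightarrow> b \<in> generate G X \<Longrightarrow> a \<otimes> b = b \<otimes> a" and g: "g \<in> generate G X"
  shows "g [^] m = \<one>"
  using g
proof (induction rule: generate.induct)
  case (inv h)
  then show ?case using X nat_pow_inv[of h m] by auto
next
  case (eng g h)
  have gh: "g \<in> carrier G" "h \<in> carrier G" using eng generate_in_carrier[OF X(1)] by auto
  show ?case using pow_mult_distrib[OF comm[OF eng(1,2)] gh] eng.IH by simp
qed (use X in auto)

section \<open>Abelian subgroups and orders modulo a divisible subgroup\<close>

lemma (in group) CL_abelian_finite_torsion:
  assumes E: "subgroup E G" "\<And>a b. a \<in> E \<Longrightarrow> b \<in> E \<Longrightarrow> a \<otimes> b = b \<otimes> a" and CL: "CL_group (G\<lparr>carrier := E\<rparr>)"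
    and j: "j > (0::nat)"
  shows "finite {a \<in> E. a [^] j = \<one>}"
proof -
  define L where "L i = layer (G\<lparr>carrier := E\<rparr>) (enat i)" for i
  have EG: "a \<in> carrier G" if "a \<in> E" for a using subgroup.mem_carrier[OF E(1) that] .
  have finL: "finite (L i)" if i: "i > 0" for i
  proof -
    define X where "X = {x \<in> E. element_order G x = enat i}"
    have L: "L i = generate G X" unfolding L_def X_def by (rule layer_subgroup_eq[OF E(1)])
    have X: "X \<subseteq> carrier G" "\<And>x. x \<in> X \<Longrightarrow> x [^] i = \<one>"
      using EG by (auto simp: X_def element_order_def split: if_splits)
    have sL: "subgroup (L i) G" unfolding L by (rule generate_is_subgroup[OF X(1)])
    have LE: "L i \<subseteq> E" unfolding L_def by (rule layer_subset[OF E(1)])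
    have "chernikov_group (G\<lparr>carrier := L i\<rparr>)"
      using CL_group_layer[OF CL, of "enat i"] i by (simp add: L_def zero_enat_def)
    then obtain D n N R where D: "divisible_min G D n" "D \<subseteq> L i"
      and R: "finite R" "R \<subseteq> L i" "\<And>x. x \<in> L i \<Longrightarrow> \<exists>d\<in>D. \<exists>r\<in>R. x = d \<otimes> r"
      using chernikov_subgroupE[OF sL] by (metis (no_types, lifting))
    have "g [^] i = \<one>" if "g \<in> L i" for g
      using generate_exponent[OF X, of g] E(2) LE that unfolding L by blast
    then have "D = {d \<in> D. d [^] i = \<one>}" using D(2) by blast
    then have "finite D" using divisible_minD(6)[OF D(1) i] by simp
    moreover have "L i \<subseteq> (\<lambda>(d, r). d \<otimes> r) ` (D \<times> R)" using R(3) by force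
    ultimately show ?thesis using R(1) by (meson finite_SigmaI finite_surj)
  qed
  have "{a \<in> E. a [^] j = \<one>} \<subseteq> (\<Union>i\<in>{1..j}. L i)"
  proof
    fix a assume a: "a \<in> {a \<in> E. a [^] j = \<one>}"
    then have "ord a dvd j" using pow_eq_id[OF EG, of a j] by blast
    then have "ord a \<noteq> 0" "ord a \<le> j" using j by (auto intro: dvd_imp_le)
    moreover have "a \<in> L (ord a)" unfolding L_def using mem_layer[OF E(1)] a \<open>ord a \<noteq> 0\<close> by blast
    ultimately show "a \<in> (\<Union>i\<in>{1..j}. L i)" by (intro UN_I[of "ord a"]) auto
  qed
  then show ?thesis by (rule finite_subset) (use finL in auto)
qed

text \<open>Put \<open>\<nu> i x = h\<^sup>-\<^sup>i (h x)\<^sup>i\<close>. This is a homomorphism from \<open>D\<close> to \<open>D\<close>, and it is the \<open>i\<close>-th power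
  map on elements that commute with \<open>h\<close>. With \<open>d = h\<^sup>M\<close> and \<open>e\<^sup>M = d\<^sup>-\<^sup>1\<close> it follows that
  \<open>(\<nu> M e)\<^sup>M = \<nu> M (d\<^sup>-\<^sup>1) = d\<^sup>-\<^sup>M\<close>, while \<open>(h e)\<^sup>M = d \<otimes> \<nu> M e\<close>.\<close>

lemma (in group) bounded_order_correction:
  assumes D: "subgroup D G" "\<And>a b. a \<in> D \<Longrightarrow> b \<in> D \<Longrightarrow> a \<otimes> b = b \<otimes> a"
    and h: "h \<in> carrier G" "\<And>d. d \<in> D \<Longrightarrow> inv h \<otimes> d \<otimes> h \<in> D"
    and e: "e \<in> D" "h [^] (M::nat) \<in> D" "e [^] M = inv (h [^] M)"
  shows "(h \<otimes> e) [^] (M * M) = \<one>"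
proof -
  note DG = subgroup.mem_carrier[OF D(1)]
  define \<nu> where "\<nu> i x = inv (h [^] i) \<otimes> (h \<otimes> x) [^] i" for i :: nat and x
  have \<nu>_Suc: "\<nu> (Suc i) x = inv h \<otimes> \<nu> i x \<otimes> h \<otimes> x" if "x \<in> D" for i x
    using h(1) DG[OF that] by (simp add: \<nu>_def m_assoc inv_mult_group)
  have \<nu>0: "\<nu> 0 x = \<one>" for x by (simp add: \<nu>_def)
  have \<nu>D: "\<nu> i x \<in> D" if x: "x \<in> D" for i x
  proof (induction i)
    case 0
    show ?case using \<nu>0 subgroup.one_closed[OF D(1)] by simp
  next
    case (Suc i)
    show ?case unfolding \<nu>_Suc[OF x] using subgroup.m_closed[OF D(1) h(2)[OF Suc] x] .
  qed
  have \<nu>_mult: "\<nu> i (x \<otimes> y) = \<nu> i x \<otimes> \<nu> i y" if x: "x \<in> D" and y: "y \<in> D" for i x y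
  proof (induction i)
    case 0
    show ?case using \<nu>0 by simp
  next
    case (Suc i)
    note G = h(1) DG[OF x] DG[OF y] DG[OF \<nu>D[OF x]] DG[OF \<nu>D[OF y]]
    have "\<nu> (Suc i) (x \<otimes> y) = (inv h \<otimes> \<nu> i x \<otimes> h) \<otimes> ((inv h \<otimes> \<nu> i y \<otimes> h) \<otimes> x) \<otimes> y"
      unfolding \<nu>_Suc[OF subgroup.m_closed[OF D(1) x y]] Suc using G by (simp add: m_assoc)
    also have "\<dots> = \<nu> (Suc i) x \<otimes> \<nu> (Suc i) y"
      unfolding D(2)[OF h(2)[OF \<nu>D[OF y]] x] \<nu>_Suc[OF x] \<nu>_Suc[OF y] using G by (simp add: m_assoc)
    finally show ?case .
  qed
  have \<nu>_pow: "\<nu> i (x [^] j) = \<nu> i x [^] j" if x: "x \<in> D" for i x and j :: nat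
  proof (induction j)
    case 0
    have "\<nu> i \<one> = \<one>" using h(1) by (simp add: \<nu>_def)
    then show ?case by simp
  next
    case (Suc j)
    then show ?case using \<nu>_mult[OF power_mem_subgroup[OF D(1) x] x] by simp
  qed
  define d where "d = h [^] M"
  have dD: "d \<in> D" using e(2) by (simp add: d_def)
  have idD: "inv d \<in> D" using subgroup.m_inv_closed[OF D(1) dD] .
  note G = h(1) DG[OF dD] DG[OF e(1)]
  have "h \<otimes> d = d \<otimes> h" using nat_pow_Suc2[OF h(1), of M] by (simp add: d_def)
  then have "inv d \<otimes> (h \<otimes> d) \<otimes> inv d = inv d \<otimes> (d \<otimes> h) \<otimes> inv d" by simp
  then have hd: "h \<otimes> inv d = inv d \<otimes> h" using G by (simp add: m_assoc)
  have "\<nu> i (inv d) = inv d [^] i" for i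
  proof -
    have "(h \<otimes> inv d) [^] i = h [^] i \<otimes> inv d [^] i" using pow_mult_distrib[OF hd] G by simp
    then show ?thesis using G by (simp add: \<nu>_def)
  qed
  then have \<nu>M: "\<nu> M e [^] M = inv d [^] M" using \<nu>_pow[OF e(1), of M M] e(3) by (simp add: d_def)
  have he: "(h \<otimes> e) [^] M = d \<otimes> \<nu> M e" using G by (simp add: \<nu>_def d_def)
  have "(h \<otimes> e) [^] (M * M) = (d \<otimes> \<nu> M e) [^] M" using G he nat_pow_pow[of "h \<otimes> e" M M] by simp
  also have "\<dots> = d [^] M \<otimes> \<nu> M e [^] M"
    using pow_mult_distrib[OF D(2)[OF dD \<nu>D[OF e(1)]]] G DG[OF \<nu>D[OF e(1)]] by simp
  also have "\<dots> = \<one>" unfolding \<nu>M using G by (simp add: nat_pow_inv)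
  finally show ?thesis .
qed

text \<open>Choose a prime \<open>p\<close> for which not every element is a \<open>p\<close>-th power, and by Zorn's lemma a
  subgroup \<open>M\<close> that contains all \<open>p\<close>-th powers and does not contain a given
  element \<open>x\<close> that is no \<open>p\<close>-th power, and is maximal with these properties.
  Each \<open>y\<close> outside \<open>M\<close> satisfies \<open>x = a y\<^sup>k\<close> with \<open>a \<in> M\<close> and \<open>k\<close> prime to
  \<open>p\<close>, and this can be solved for \<open>y\<close> modulo \<open>M\<close>.\<close>

lemma (in comm_group) bounded_proper_finite_index:
  assumes exp: "\<And>g. g \<in> carrier G \<Longrightarrow> g [^] (m::nat) = \<one>" "m > 0" and nt: "carrier G \<noteq> {\<one>}"
  obtains M R where "subgroup M G" "M \<noteq> carrier G" "finite R" "R \<subseteq> carrier G"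
    "\<And>x. x \<in> carrier G \<Longrightarrow> \<exists>a\<in>M. \<exists>r\<in>R. x = a \<otimes> r"
proof -
  define P where "P p = (\<lambda>g. g [^] p) ` carrier G" for p :: nat
  have P: "subgroup (P p) G" for p
  proof (rule subgroupI)
    show "P p \<subseteq> carrier G" by (auto simp: P_def)
    show "P p \<noteq> {}" using one_closed by (auto simp: P_def)
    show "inv a \<in> P p" if "a \<in> P p" for a
      using that by (auto simp: P_def simp flip: nat_pow_inv)
    show "a \<otimes> b \<in> P p" if "a \<in> P p" "b \<in> P p" for a b
      using that by (auto simp: P_def simp flip: nat_pow_distrib)
  qed
  obtain p where p: "prime p" "P p \<noteq> carrier G"
  proof -
    define good where "good k \<longleftrightarrow> k > 0 \<and> (\<forall>g\<in>carrier G. g [^] k = \<one>)" for k :: nat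
    define m0 where "m0 = (LEAST k. good k)"
    have "good m0" unfolding m0_def by (rule LeastI[of good m]) (use exp in \<open>simp add: good_def\<close>)
    then have m0: "m0 > 0" "\<And>g. g \<in> carrier G \<Longrightarrow> g [^] m0 = \<one>"
      by (simp_all add: good_def)
    have "m0 \<noteq> 1"
    proof
      assume "m0 = 1"
      then have "g = \<one>" if "g \<in> carrier G" for g using m0(2)[OF that] that by simp
      then show False using nt one_closed by blast
    qed
    then obtain p where q: "prime p" "p dvd m0" using prime_factor_nat by blast
    then obtain k where k: "m0 = p * k" by blast
    have "P p \<noteq> carrier G"
    proof
      assume eq: "P p = carrier G"
      have "g [^] k = \<one>" if g: "g \<in> carrier G" for g
      proof -
        obtain h where h: "h \<in> carrier G" "g = h [^] p" using g eq unfolding P_def by blast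
        then show ?thesis using m0(2)[OF h(1)] by (simp add: nat_pow_pow k)
      qed
      moreover have "k > 0" "k < m0" using k m0(1) prime_gt_1_nat[OF q(1)] by auto
      ultimately show False using not_less_Least[of k good] by (auto simp: m0_def good_def)
    qed
    then show thesis using that q(1) by blast
  qed
  obtain x where x: "x \<in> carrier G" "x \<notin> P p" using p(2) subgroup.subset[OF P] by blast
  define \<A> where "\<A> = {M. subgroup M G \<and> P p \<subseteq> M \<and> x \<notin> M}"
  have "\<exists>M\<in>\<A>. \<forall>X\<in>\<A>. M \<subseteq> X \<longrightarrow> X = M"
  proof (rule subset_Zorn_nonempty)
    show "\<A> \<noteq> {}" using P x(2) by (auto simp: \<A>_def)
    fix \<C> assume C: "\<C> \<noteq> {}" "subset.chain \<A> \<C>"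
    then have CA: "M \<in> \<A>" if "M \<in> \<C>" for M using that by (auto simp: subset_chain_def)
    have "subgroup (\<Union>\<C>) G"
    proof (rule subgroupI)
      show "\<Union>\<C> \<subseteq> carrier G" using CA subgroup.subset by (fastforce simp: \<A>_def)
      show "\<Union>\<C> \<noteq> {}" using C(1) CA subgroup.one_closed by (fastforce simp: \<A>_def)
      show "inv a \<in> \<Union>\<C>" if "a \<in> \<Union>\<C>" for a using that CA subgroup.m_inv_closed by (fastforce simp: \<A>_def)
      show "a \<otimes> b \<in> \<Union>\<C>" if ab: "a \<in> \<Union>\<C>" "b \<in> \<Union>\<C>" for a b
      proof -
        obtain M N where MN: "M \<in> \<C>" "N \<in> \<C>" "a \<in> M" "b \<in> N" using ab by blast
        then have "M \<subseteq> N \<or> N \<subseteq> M" using C(2) by (auto simp: subset_chain_def)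
        then obtain K where K: "K \<in> \<C>" "a \<in> K" "b \<in> K" using MN by blast
        then have "subgroup K G" using CA by (simp add: \<A>_def)
        then have "a \<otimes> b \<in> K" using subgroup.m_closed K by metis
        then show ?thesis using K(1) by blast
      qed
    qed
    then show "\<Union>\<C> \<in> \<A>" using C(1) CA by (fastforce simp: \<A>_def)
  qed
  then obtain M where M0: "M \<in> \<A>" "\<forall>X\<in>\<A>. M \<subseteq> X \<longrightarrow> X = M" by blast
  have M: "subgroup M G" "P p \<subseteq> M" "x \<notin> M" using M0(1) by (simp_all add: \<A>_def)
  have max: "X = M" if "subgroup X G" "P p \<subseteq> X" "x \<notin> X" "M \<subseteq> X" for X
    using M0(2) that by (simp add: \<A>_def)
  note MG = subgroup.mem_carrier[OF M(1)]
  have mem: "\<exists>a\<in>M. \<exists>r\<in>generate G {x}. y = a \<otimes> r" if y: "y \<in> carrier G" for y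
  proof (cases "y \<in> M")
    case True
    then show ?thesis using y generate.one[of G "{x}"] by (intro bexI[of _ y] bexI[of _ \<one>]) auto
  next
    case False
    define Y where "Y = M <#> generate G {y}"
    have sy: "subgroup (generate G {y}) G" using generate_is_subgroup y by simp
    have sub: "subgroup Y G"
      using normal_imp_subgroup[OF normal_set_mult] normal_iff_subgroup M(1) sy by (simp add: Y_def)
    have MY: "M \<subseteq> Y"
    proof
      fix a assume a: "a \<in> M"
      have "a \<otimes> \<one> \<in> Y" unfolding Y_def by (rule mem_set_multI[OF a generate.one])
      then show "a \<in> Y" using MG[OF a] by simp
    qed
    have "\<one> \<otimes> y \<in> Y" unfolding Y_def by (rule mem_set_multI[OF subgroup.one_closed[OF M(1)]]) (rule generate.incl, simp)
    then have "y \<in> Y" using y by simp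
    then have "Y \<noteq> M" using False by blast
    then have "x \<in> Y" using max[OF sub _ _ MY] order_trans[OF M(2) MY] by blast
    then obtain a b where ab: "a \<in> M" "b \<in> generate G {y}" "x = a \<otimes> b"
      by (auto simp: Y_def set_mult_def)
    then obtain k where ak: "a \<in> M" "x = a \<otimes> y [^] (k::int)" unfolding generate_pow[OF y] by blast
    note aG = MG[OF ak(1)]
    have pM: "(g [^] (v::int)) [^] int p \<in> M" if "g \<in> carrier G" for g v
      using M(2) that by (auto simp: P_def int_pow_int)
    have "\<not> int p dvd k"
    proof
      assume "int p dvd k"
      then obtain v where "k = int p * v" by blast
      then have "y [^] k \<in> M" using pM[OF y, of v] y by (simp add: int_pow_pow mult.commute)
      then show False using M(3) subgroup.m_closed[OF M(1) ak(1)] ak(2) by blast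
    qed
    then have "coprime k (int p)" using p(1) prime_imp_coprime[of "int p" k] by (simp add: coprime_commute)
    then obtain u v where uv: "u * k + v * int p = 1" using bezout_int[of k "int p"] by auto
    have "y [^] k = inv a \<otimes> x" using ak(2) aG y by simp
    then have "y [^] (k * u) = (inv a \<otimes> x) [^] u" using int_pow_pow[OF y, of k u] by simp
    also have "\<dots> = inv a [^] u \<otimes> x [^] u" using int_pow_distrib aG x(1) by simp
    finally have ku: "y [^] (k * u) = inv a [^] u \<otimes> x [^] u" .
    have "y = y [^] (k * u + v * int p)" using uv y by (simp add: mult.commute)
    also have "\<dots> = y [^] (k * u) \<otimes> (y [^] v) [^] int p" using y by (simp add: int_pow_mult int_pow_pow)
    also have "\<dots> = (inv a [^] u \<otimes> (y [^] v) [^] int p) \<otimes> x [^] u"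
      unfolding ku using aG x(1) y by (simp add: m_ac)
    finally have "y = (inv a [^] u \<otimes> (y [^] v) [^] int p) \<otimes> x [^] u" .
    moreover have "inv a [^] u \<otimes> (y [^] v) [^] int p \<in> M"
      using subgroup.m_closed[OF M(1) subgroup_int_pow_closed[OF M(1) subgroup.m_inv_closed[OF M(1) ak(1)]] pM[OF y]] .
    moreover have "x [^] u \<in> generate G {x}" using generate_pow[OF x(1)] by blast
    ultimately show ?thesis by blast
  qed
  have "ord x dvd m" using exp(1)[OF x(1)] pow_eq_id x(1) by blast
  then have "ord x \<noteq> 0" using exp(2) by (metis dvd_0_left_iff less_numeral_extra(3))
  then have "card (generate G {x}) \<noteq> 0" using generate_pow_card[OF x(1)] by simp
  then have "finite (generate G {x})" by (metis card.infinite)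
  moreover have "generate G {x} \<subseteq> carrier G" using generate_incl x(1) by simp
  moreover have "M \<noteq> carrier G" using x(1) M(3) by blast
  ultimately show thesis using that[OF M(1)] mem by blast
qed

section \<open>\<open>CC\<close>-groups whose proper subgroups are \<open>CL\<close>-groups\<close>

text \<open>If \<open>E / C\<close> is abelian, divisible and periodic with \<open>C\<close> central, then \<open>E\<close> is abelian: the
  commutator is bilinear, and modulo \<open>C\<close> the element \<open>a\<close> is a \<open>t\<close>-th power \<open>e\<^sup>t\<close> with \<open>b\<^sup>t \<in> C\<close>, so
  \<open>[a, b] = [e, b]\<^sup>t = [e, b\<^sup>t] = \<one>\<close>.\<close>

lemma (in group) divisible_mod_center_commute:
  assumes E: "subgroup E G" and C: "C \<subseteq> E" "\<And>c g. c \<in> C \<Longrightarrow> g \<in> carrier G \<Longrightarrow> c \<otimes> g = g \<otimes> c"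
    and comm: "\<And>a b. a \<in> E \<Longrightarrow> b \<in> E \<Longrightarrow> \<exists>c\<in>C. a \<otimes> b = c \<otimes> (b \<otimes> a)"
    and div: "\<And>a N. a \<in> E \<Longrightarrow> N > (0::nat) \<Longrightarrow> \<exists>e\<in>E. \<exists>c\<in>C. a = c \<otimes> e [^] N"
    and n: "n > 0" "\<And>a. a \<in> E \<Longrightarrow> \<exists>j. a [^] ((n::nat) ^ j) \<in> C"
    and a: "a \<in> E" and b: "b \<in> E"
  shows "a \<otimes> b = b \<otimes> a"
proof -
  note EG = subgroup.mem_carrier[OF E]
  obtain j where j: "b [^] (n ^ j) \<in> C" using n(2)[OF b] by blast
  define t where "t = n ^ j"
  have t: "t > 0" "b [^] t \<in> C" using n(1) j by (simp_all add: t_def)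
  obtain e z where e: "e \<in> E" "z \<in> C" "a = z \<otimes> e [^] t" using div[OF a t(1)] by blast
  obtain c where c: "c \<in> C" "e \<otimes> b = c \<otimes> (b \<otimes> e)" using comm[OF e(1) b] by blast
  have cG: "c \<in> carrier G" and zG: "z \<in> carrier G" using c(1) e(2) C(1) EG by blast+
  note G = EG[OF e(1)] EG[OF b] cG zG
  have 1: "e [^] i \<otimes> b = c [^] i \<otimes> (b \<otimes> e [^] i)" for i :: nat
  proof (induction i)
    case 0
    then show ?case using G by simp
  next
    case (Suc i)
    have ci: "e [^] i \<otimes> c = c \<otimes> e [^] i" using C(2)[OF c(1), of "e [^] i"] G by simp
    have "e [^] Suc i \<otimes> b = e [^] i \<otimes> (e \<otimes> b)" using G by (simp add: m_assoc)
    also have "\<dots> = (e [^] i \<otimes> c) \<otimes> (b \<otimes> e)" unfolding c(2) using G by (simp add: m_assoc)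
    also have "\<dots> = c \<otimes> (e [^] i \<otimes> b) \<otimes> e" unfolding ci using G by (simp add: m_assoc)
    also have "\<dots> = c [^] Suc i \<otimes> (b \<otimes> e [^] Suc i)"
      unfolding Suc nat_pow_Suc2[OF cG] using G by (simp add: m_assoc)
    finally show ?case .
  qed
  have 2: "e \<otimes> b [^] i = c [^] i \<otimes> (b [^] i \<otimes> e)" for i :: nat
  proof (induction i)
    case 0
    then show ?case using G by simp
  next
    case (Suc i)
    have ci: "b [^] i \<otimes> c = c \<otimes> b [^] i" using C(2)[OF c(1), of "b [^] i"] G by simp
    have "e \<otimes> b [^] Suc i = (e \<otimes> b [^] i) \<otimes> b" using G by (simp add: m_assoc)
    also have "\<dots> = c [^] i \<otimes> b [^] i \<otimes> (e \<otimes> b)" unfolding Suc using G by (simp add: m_assoc)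
    also have "\<dots> = c [^] i \<otimes> (b [^] i \<otimes> c) \<otimes> (b \<otimes> e)" unfolding c(2) using G by (simp add: m_assoc)
    also have "\<dots> = c [^] Suc i \<otimes> (b [^] Suc i \<otimes> e)" unfolding ci using G by (simp add: m_assoc)
    finally show ?case .
  qed
  have "c [^] t \<otimes> (b [^] t \<otimes> e) = b [^] t \<otimes> e" using 2[of t] C(2)[OF t(2) G(1)] by simp
  then have ct: "c [^] t = \<one>" using G by simp
  have eb: "e [^] t \<otimes> b = b \<otimes> e [^] t" using 1[of t] ct G by simp
  have "a \<otimes> b = z \<otimes> (e [^] t \<otimes> b)" using G by (simp add: e(3) m_assoc)
  also have "\<dots> = (z \<otimes> b) \<otimes> e [^] t" unfolding eb using G by (simp add: m_assoc)
  also have "\<dots> = b \<otimes> a" unfolding C(2)[OF e(2) G(2)] using G by (simp add: e(3) m_assoc)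
  finally show ?thesis .
qed

lemma (in group) chernikov_of_center_quotient:
  assumes periodic: "\<And>g. g \<in> carrier G \<Longrightarrow> ord g \<noteq> 0"
    and gen: "carrier G = generate G X" "\<And>x. x \<in> X \<Longrightarrow> x [^] (m::nat) = \<one>" "X \<subseteq> carrier G" "m > 0"
    and CL: "\<And>H. subgroup H G \<Longrightarrow> H \<noteq> carrier G \<Longrightarrow> CL_group (G\<lparr>carrier := H\<rparr>)"
    and x: "x \<in> carrier G" "normal_closure G (generate G {x}) = carrier G"
    and ch: "chernikov_group (G Mod centralizer G (carrier G))"
  shows "chernikov_group (G\<lparr>carrier := carrier G\<rparr>)"
proof -
  define Z where "Z = centralizer G (carrier G)"
  have "carrier G \<lhd> G" by (rule normal_invI[OF subgroup_self]) auto
  then have nZ: "Z \<lhd> G" unfolding Z_def by (rule normal_centralizer)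
  have Zc: "z \<otimes> g = g \<otimes> z" if "z \<in> Z" "g \<in> carrier G" for z g
    using that unfolding Z_def centralizer_def by blast
  obtain E n R where E: "E \<lhd> G" "Z \<subseteq> E"
    and R: "finite R" "R \<subseteq> carrier G" "\<And>x. x \<in> carrier G \<Longrightarrow> \<exists>a\<in>E. \<exists>r\<in>R. x = a \<otimes> r"
    and Ec: "\<And>a b. a \<in> E \<Longrightarrow> b \<in> E \<Longrightarrow> \<exists>c\<in>Z. a \<otimes> b = c \<otimes> (b \<otimes> a)"
    and Ed: "\<And>a N. a \<in> E \<Longrightarrow> N > (0::nat) \<Longrightarrow> \<exists>e\<in>E. \<exists>c\<in>Z. a = c \<otimes> e [^] N"
    and n: "n > 0" "\<And>a. a \<in> E \<Longrightarrow> \<exists>j. a [^] ((n::nat) ^ j) \<in> Z"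
    by (rule chernikov_quotientE[OF nZ ch[folded Z_def]]) (rule that)
  note sE = normal_imp_subgroup[OF E(1)]
  note EG = subgroup.mem_carrier[OF sE]
  have comm: "a \<otimes> b = b \<otimes> a" if "a \<in> E" "b \<in> E" for a b
    using divisible_mod_center_commute[OF sE E(2) Zc Ec Ed n that] .
  show ?thesis
  proof (cases "E = carrier G")
    case True
    interpret ab: comm_group G by (rule group_comm_groupI) (use comm True in auto)
    have sx: "subgroup (generate G {x}) G" using generate_is_subgroup x(1) by simp
    then have "generate G {x} \<lhd> G" using ab.normal_iff_subgroup by blast
    then have "carrier G \<subseteq> generate G {x}"
      using normal_closure_props(3)[OF subgroup.subset[OF sx], of "generate G {x}"] x(2) by simp
    then have eq: "carrier G = generate G {x}" using subgroup.subset[OF sx] by blast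
    have "card (generate G {x}) \<noteq> 0" using generate_pow_card[OF x(1)] periodic[OF x(1)] by simp
    then have "finite (carrier G)" unfolding eq by (metis card.infinite)
    then show ?thesis by (rule chernikov_finite_subgroup[OF subgroup_self])
  next
    case False
    have fin: "finite {a \<in> E. a [^] j = \<one>}" if "j > 0" for j :: nat
      by (rule CL_abelian_finite_torsion[OF sE _ CL[OF sE False] that]) (rule comm)
    have finR: "finite (rcosets E)" by (rule finite_rcosets_transversal[OF sE R])
    define k where "k = card (rcosets E)"
    have "E #> \<one> \<in> rcosets E" by (auto simp: RCOSETS_def)
    then have k0: "k > 0" using finR by (auto simp: k_def card_gt_0_iff)
    have Zkm: "z [^] (k * m) = \<one>" if z: "z \<in> Z" for z
      unfolding k_def by (rule central_torsion_transfer[OF sE comm finR gen(1-3)]) (use z E(2) Zc in blast)+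
    show ?thesis
    proof (rule chernikov_subgroupI[where A = E and n = "n * (k * m)" and R = R])
      show "subgroup (carrier G) G" by (rule subgroup_self)
      show "E \<subseteq> carrier G" by (rule subgroup.subset[OF sE])
      show n0: "n * (k * m) > 0" using n(1) k0 gen(4) by simp
      show "finite {a \<in> E. a [^] (n * (k * m)) = \<one>}" by (rule fin[OF n0])
      show "\<exists>j. a [^] ((n * (k * m)) ^ j) = \<one>" if a: "a \<in> E" for a
      proof -
        obtain j where j: "a [^] (n ^ j) \<in> Z" using n(2)[OF a] by blast
        have "a [^] ((n * (k * m)) ^ Suc j) = ((a [^] (n ^ j)) [^] (k * m)) [^] (n * (k * m) ^ j)"
          using EG[OF a] by (simp add: nat_pow_pow power_mult_distrib mult_ac)
        then show ?thesis using Zkm[OF j] by (metis nat_pow_one)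
      qed
      show "x \<otimes> a \<otimes> inv x \<in> E" if "x \<in> carrier G" "a \<in> E" for x a using normal_invE(2)[OF E(1) that] .
    qed (use sE comm R in auto)
  qed
qed

text \<open>For nonabelian \<open>G\<close>, the quotient by the centralizer of a noncentral normal closure is
  nontrivial and Chernikov. If it had no proper subgroup of finite index, it would be divisible abelian,
  but it is generated by elements of bounded order.\<close>

lemma (in group) ex_proper_finite_index:
  assumes gen: "carrier G = generate G X" "\<And>x. x \<in> X \<Longrightarrow> x [^] (m::nat) = \<one>" "X \<subseteq> carrier G" "m > 0"
    and nt: "carrier G \<noteq> {\<one>}"
    and ch: "\<And>x. x \<in> carrier G \<Longrightarrow> chernikov_group (G Mod centralizer G (normal_closure G (generate G {x})))"
  obtains H R where "H \<lhd> G" "H \<noteq> carrier G" "finite R" "R \<subseteq> carrier G"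
    "\<And>x. x \<in> carrier G \<Longrightarrow> \<exists>a\<in>H. \<exists>r\<in>R. x = a \<otimes> r"
proof (cases "\<forall>a\<in>carrier G. \<forall>b\<in>carrier G. a \<otimes> b = b \<otimes> a")
  case True
  interpret ab: comm_group G by (rule group_comm_groupI) (use True in auto)
  have "g [^] m = \<one>" if "g \<in> carrier G" for g
    using generate_exponent[OF gen(3,2), of g] that gen(1) True by blast
  then show thesis using ab.bounded_proper_finite_index[OF _ gen(4) nt] ab.normal_iff_subgroup that by metis
next
  case False
  then obtain a b where ab: "a \<in> carrier G" "b \<in> carrier G" "a \<otimes> b \<noteq> b \<otimes> a" by blast
  define N where "N = normal_closure G (generate G {a})"
  have sub: "generate G {a} \<subseteq> carrier G" using generate_incl ab(1) by simp
  have N: "N \<lhd> G" and "generate G {a} \<subseteq> N" unfolding N_def by (rule normal_closure_props[OF sub])+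
  then have aN: "a \<in> N" using generate.incl[of a "{a}" G] by blast
  define C where "C = centralizer G N"
  have nC: "C \<lhd> G" unfolding C_def by (rule normal_centralizer[OF N])
  have bC: "b \<notin> C" using ab(3) aN unfolding C_def centralizer_def by force
  obtain E n R where E: "E \<lhd> G" "C \<subseteq> E"
    and R: "finite R" "R \<subseteq> carrier G" "\<And>x. x \<in> carrier G \<Longrightarrow> \<exists>a\<in>E. \<exists>r\<in>R. x = a \<otimes> r"
    and Ec: "\<And>a b. a \<in> E \<Longrightarrow> b \<in> E \<Longrightarrow> \<exists>c\<in>C. a \<otimes> b = c \<otimes> (b \<otimes> a)"
    and Ed: "\<And>a N. a \<in> E \<Longrightarrow> N > (0::nat) \<Longrightarrow> \<exists>e\<in>E. \<exists>c\<in>C. a = c \<otimes> e [^] N"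
    by (rule chernikov_quotientE[OF nC ch[OF ab(1), folded N_def, folded C_def]]) (rule that; assumption)
  have "E \<noteq> carrier G"
  proof
    assume eq: "E = carrier G"
    obtain e c where e: "e \<in> E" "c \<in> C" "b = c \<otimes> e [^] m" using Ed[OF _ gen(4), of b] ab(2) eq by blast
    have sC: "subgroup C G" using normal_imp_subgroup[OF nC] .
    have "e [^] m \<in> C"
    proof (rule exponent_mod_of_generators[OF nC _ gen(1) _ gen(3)])
      show "\<exists>c\<in>C. a \<otimes> b = c \<otimes> (b \<otimes> a)" if "a \<in> carrier G" "b \<in> carrier G" for a b using Ec that eq by simp
      show "x [^] m \<in> C" if "x \<in> X" for x using gen(2)[OF that] subgroup.one_closed[OF sC] by simp
    qed (use e(1) eq in simp)
    then have "b \<in> C" using subgroup.m_closed[OF sC e(2)] e(3) by simp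
    then show False using bC by simp
  qed
  then show thesis using that[OF E(1) _ R] by blast
qed

lemma (in group) chernikov_of_proper_finite_index:
  assumes periodic: "\<And>g. g \<in> carrier G \<Longrightarrow> ord g \<noteq> 0"
    and gen: "carrier G = generate G X" "\<And>x. x \<in> X \<Longrightarrow> x [^] (m::nat) = \<one>" "X \<subseteq> carrier G" "m > 0"
    and H: "H \<lhd> G" and CL: "CL_group (G\<lparr>carrier := H\<rparr>)"
    and R: "finite R" "R \<subseteq> carrier G" "\<And>x. x \<in> carrier G \<Longrightarrow> \<exists>a\<in>H. \<exists>r\<in>R. x = a \<otimes> r"
    and ch: "\<And>x. x \<in> carrier G \<Longrightarrow> chernikov_group (G\<lparr>carrier := normal_closure G (generate G {x})\<rparr>)"
  shows "chernikov_group (G\<lparr>carrier := carrier G\<rparr>)"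
proof -
  note sH = normal_imp_subgroup[OF H]
  have nc: "normal_closure G (generate G {x}) \<lhd> G" "x \<in> normal_closure G (generate G {x})" if x: "x \<in> carrier G" for x
  proof -
    have sub: "generate G {x} \<subseteq> carrier G" using generate_incl x by simp
    show "normal_closure G (generate G {x}) \<lhd> G" by (rule normal_closure_props(1)[OF sub])
    show "x \<in> normal_closure G (generate G {x})"
      using normal_closure_props(2)[OF sub] generate.incl[of x "{x}" G] by blast
  qed
  obtain K where K: "K \<lhd> G" "chernikov_group (G\<lparr>carrier := K\<rparr>)" "R \<subseteq> K"
  proof -
    have "\<exists>Y. Y \<lhd> G \<and> chernikov_group (G\<lparr>carrier := Y\<rparr>) \<and>
        (\<forall>K\<in>(\<lambda>r. normal_closure G (generate G {r})) ` R. K \<subseteq> Y)"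
      by (rule chernikov_normal_finite_family) (use R nc ch in auto)
    then obtain Y where Y: "Y \<lhd> G" "chernikov_group (G\<lparr>carrier := Y\<rparr>)"
      "\<And>r. r \<in> R \<Longrightarrow> normal_closure G (generate G {r}) \<subseteq> Y" by blast
    have "R \<subseteq> Y" using Y(3) nc(2) R(2) by blast
    then show thesis using that Y by blast
  qed
  note sK = normal_imp_subgroup[OF K(1)]
  obtain D n N where D: "divisible_min G D n" "D \<subseteq> K"
    and normD: "\<And>x d. x \<in> carrier G \<Longrightarrow> d \<in> D \<Longrightarrow> x \<otimes> d \<otimes> inv x \<in> D"
    and N: "N > (0::nat)" "\<And>x. x \<in> K \<Longrightarrow> x [^] N \<in> D"
    using chernikov_normalE[OF K(1,2)] by (metis (no_types, lifting))
  note D' = divisible_minD[OF D(1)]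
  obtain k where k: "k > (0::nat)" "\<And>x. x \<in> carrier G \<Longrightarrow> x [^] k \<in> H"
    using power_mem_finite_index[OF H R] by metis
  have DH: "D \<subseteq> H"
  proof
    fix d assume d: "d \<in> D"
    obtain e where "e \<in> D" "e [^] k = d" using D'(3)[OF d k(1)] by blast
    then show "d \<in> H" using k(2)[of e] D'(7) by blast
  qed
  define M where "M = m * N"
  have M0: "M > 0" using gen(4) N(1) by (simp add: M_def)
  define L where "L j = layer (G\<lparr>carrier := H\<rparr>) (enat j)" for j
  have L: "L j \<lhd> G" for j unfolding L_def by (rule layer_normal[OF H])
  have chL: "chernikov_group (G\<lparr>carrier := L j\<rparr>)" if "j > 0" for j
    using CL_group_layer[OF CL, of "enat j"] that by (simp add: L_def zero_enat_def)
  have "\<exists>Y. Y \<lhd> G \<and> chernikov_group (G\<lparr>carrier := Y\<rparr>) \<and> (\<forall>P\<in>insert K (L ` {1..M * M}). P \<subseteq> Y)"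
    by (rule chernikov_normal_finite_family) (use K L chL in auto)
  then obtain Y where Y: "Y \<lhd> G" "chernikov_group (G\<lparr>carrier := Y\<rparr>)" "K \<subseteq> Y"
    "\<And>j. j \<in> {1..M * M} \<Longrightarrow> L j \<subseteq> Y" by blast
  note sY = normal_imp_subgroup[OF Y(1)]
  have "X \<subseteq> Y"
  proof
    fix g assume g: "g \<in> X"
    have gG: "g \<in> carrier G" using g gen(3) by blast
    obtain h r where hr: "h \<in> H" "r \<in> R" "g = h \<otimes> r" using R(3)[OF gG] by blast
    have hG: "h \<in> carrier G" and rK: "r \<in> K" and rG: "r \<in> carrier G"
      using subgroup.mem_carrier[OF sH hr(1)] hr(2) K(3) R(2) by auto
    have "h [^] m \<in> K"
    proof -
      interpret K: normal K G by (rule K(1))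
      interpret Q: group "G Mod K" by (rule K.factorgroup_is_group)
      have "h \<in> K #> g"
      proof -
        have "h = (h \<otimes> inv r \<otimes> inv h) \<otimes> g" using hG rG by (simp add: hr(3) m_assoc)
        moreover have "h \<otimes> inv r \<otimes> inv h \<in> K"
          using normal_invE(2)[OF K(1) hG subgroup.m_inv_closed[OF sK rK]] .
        ultimately show ?thesis by (auto simp: r_coset_def)
      qed
      then have "K #> g = K #> h" using repr_independence[OF _ gG sK] by blast
      then have "K #> (h [^] m) = K #> (g [^] m)"
        using K.FactGroup_pow[OF hG, of m] K.FactGroup_pow[OF gG, of m] by simp
      also have "\<dots> = K" using gen(2)[OF g] coset_join2[OF one_closed sK subgroup.one_closed[OF sK]] by simp
      finally show ?thesis using coset_join1[OF _ _ sK] hG by simp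
    qed
    then have hM: "h [^] M \<in> D" using N(2)[of "h [^] m"] hG by (simp add: M_def nat_pow_pow)
    obtain e where e: "e \<in> D" "e [^] M = inv (h [^] M)"
      using D'(3)[OF subgroup.m_inv_closed[OF D'(1) hM] M0] by blast
    have eG: "e \<in> carrier G" using D'(7)[OF e(1)] .
    \<comment> \<open>\<open>h\<close> may have arbitrarily large order, but \<open>h \<otimes> e\<close> lies in one of the finitely many layers chosen above\<close>
    have "(h \<otimes> e) [^] (M * M) = \<one>"
    proof (rule bounded_order_correction[OF D'(1,2) hG _ e(1) hM e(2)])
      show "inv h \<otimes> d \<otimes> h \<in> D" if "d \<in> D" for d using normD[OF inv_closed[OF hG] that] hG by simp
    qed
    then have "ord (h \<otimes> e) dvd M * M" using pow_eq_id hG eG by simp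
    then have ord: "ord (h \<otimes> e) \<in> {1..M * M}"
      using M0 periodic[of "h \<otimes> e"] hG eG dvd_imp_le[of "ord (h \<otimes> e)" "M * M"] by (simp add: Suc_le_eq)
    have "h \<otimes> e \<in> H" using subgroup.m_closed[OF sH hr(1)] e(1) DH by blast
    then have "h \<otimes> e \<in> L (ord (h \<otimes> e))" unfolding L_def using mem_layer[OF sH] ord by simp
    then have heY: "h \<otimes> e \<in> Y" using Y(4)[OF ord] by blast
    have eY: "e \<in> Y" and rY: "r \<in> Y" using e(1) D(2) rK Y(3) by auto
    have "g = (h \<otimes> e) \<otimes> inv e \<otimes> r" using hG eG rG by (simp add: hr(3) m_assoc)
    also have "\<dots> \<in> Y"
      using subgroup.m_closed[OF sY subgroup.m_closed[OF sY heY subgroup.m_inv_closed[OF sY eY]] rY] .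
    finally show "g \<in> Y" .
  qed
  then have "carrier G \<subseteq> Y" unfolding gen(1) by (rule generate_subgroup_incl[OF _ sY])
  then have "Y = carrier G" using subgroup.subset[OF sY] by blast
  then show ?thesis using Y(2) by simp
qed

text \<open>If \<open>x\<close> had infinite order, then \<open>x\<^sup>2\<close> would generate a proper subgroup, which is not
  periodic.\<close>

lemma (in group) periodic_of_proper_CL:
  assumes CL: "\<And>H. subgroup H G \<Longrightarrow> H \<noteq> carrier G \<Longrightarrow> CL_group (G\<lparr>carrier := H\<rparr>)"
    and x: "x \<in> carrier G"
  shows "ord x \<noteq> 0"
proof
  assume o: "ord x = 0"
  define y where "y = x [^] (2::int)"
  have y: "y \<in> carrier G" using x by (simp add: y_def)
  define H where "H = generate G {y}"
  have H: "subgroup H G" unfolding H_def using generate_is_subgroup y by simp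
  have yH: "y \<in> H" unfolding H_def by (rule generate.incl) simp
  have "H \<noteq> carrier G"
  proof
    assume "H = carrier G"
    then obtain k where "x = y [^] (k::int)" using x generate_pow[OF y] unfolding H_def by blast
    then have "x [^] (1::int) = x [^] (2 * k)" using x by (simp add: y_def int_pow_pow)
    then have "(0::int) dvd 2 * k - 1" using int_pow_eq[OF x, of 1 "2 * k"] o by simp
    then have "2 * k - 1 = 0" by simp
    then show False by presburger
  qed
  then have "CL_group (G\<lparr>carrier := H\<rparr>)" using CL H by blast
  then have "ord y \<noteq> 0" using CL_group_periodic[of "G\<lparr>carrier := H\<rparr>" y] yH ord_subgroup_eq[OF H] by simp
  moreover have "x [^] (2 * int (ord y)) = y [^] ord y" using x by (simp add: y_def int_pow_pow flip: int_pow_int)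
  then have "x [^] (2 * int (ord y)) = \<one>" using y by simp
  then have "int (ord x) dvd 2 * int (ord y)" using int_pow_eq_id[OF x] by blast
  ultimately show False using o by simp
qed

theorem (in group) CC_group_imp_CL_group:
  assumes CL: "\<And>H. subgroup H G \<Longrightarrow> H \<noteq> carrier G \<Longrightarrow> CL_group (G\<lparr>carrier := H\<rparr>)"
    and CC: "CC_group G"
  shows "CL_group G"
proof -
  have periodic: "ord g \<noteq> 0" if "g \<in> carrier G" for g
    using periodic_of_proper_CL[OF CL that] .
  have carn: "carrier G \<lhd> G" by (rule normal_invI[OF subgroup_self]) auto
  show ?thesis
  proof (rule ccontr)
    assume "\<not> CL_group G"
    then obtain \<mu> where \<mu>: "\<mu> > 0" "\<not> chernikov_group (G\<lparr>carrier := layer G \<mu>\<rparr>)"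
      using group_axioms by (auto simp: CL_group_def)
    have "\<mu> \<noteq> \<infinity>"
    proof
      assume "\<mu> = \<infinity>"
      moreover have "element_order G x \<noteq> \<infinity>" if "x \<in> carrier G" for x
        using periodic[OF that] by (simp add: element_order_def)
      ultimately have "{x \<in> carrier G. element_order G x = \<mu>} = {}" by blast
      then have "layer G \<mu> = {\<one>}" unfolding layer_def by (metis generate_empty)
      then show False using \<mu>(2) chernikov_finite_subgroup[OF triv_subgroup] by simp
    qed
    then obtain m where m: "\<mu> = enat m" by auto
    have m0: "m > 0" using \<mu>(1) m by (simp add: zero_enat_def)
    define X where "X = {x \<in> carrier G. element_order G x = enat m}"
    have X: "X \<subseteq> carrier G" "\<And>x. x \<in> X \<Longrightarrow> x [^] m = \<one>"
      by (auto simp: X_def element_order_def split: if_splits)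
    define L where "L = generate G X"
    have nCh: "\<not> chernikov_group (G\<lparr>carrier := L\<rparr>)" using \<mu>(2) by (simp add: m layer_def L_def X_def)
    have sL: "subgroup L G" unfolding L_def by (rule generate_is_subgroup[OF X(1)])
    have L: "L = carrier G"
    proof (rule ccontr)
      assume ne: "L \<noteq> carrier G"
      have "X \<subseteq> L" unfolding L_def by (auto intro: generate.incl)
      then have "{x \<in> L. element_order G x = enat m} = X" using subgroup.subset[OF sL] by (auto simp: X_def)
      then have "layer (G\<lparr>carrier := L\<rparr>) (enat m) = L" unfolding layer_subgroup_eq[OF sL] by (simp add: L_def)
      then have "chernikov_group (G\<lparr>carrier := L\<rparr>)"
        using CL_group_layer[OF CL[OF sL ne], of "enat m"] m0 by (simp add: zero_enat_def)
      then show False using nCh by blast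
    qed
    have gen: "carrier G = generate G X" using L by (simp add: L_def)
    have nCh: "\<not> chernikov_group (G\<lparr>carrier := carrier G\<rparr>)" using nCh L by simp
    have chq: "chernikov_group (G Mod centralizer G (normal_closure G (generate G {x})))" if "x \<in> carrier G" for x
      using CC that by (simp add: CC_group_def)
    have proper: "normal_closure G (generate G {x}) \<noteq> carrier G" if x: "x \<in> carrier G" for x
      using chernikov_of_center_quotient[OF periodic gen X(2,1) m0 CL x] chq[OF x] nCh by auto
    have ch: "chernikov_group (G\<lparr>carrier := normal_closure G (generate G {x})\<rparr>)" if x: "x \<in> carrier G" for x
    proof -
      have sub: "generate G {x} \<subseteq> carrier G" using generate_incl x by simp
      have n: "normal_closure G (generate G {x}) \<lhd> G" by (rule normal_closure_props(1)[OF sub])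
      have "x \<in> normal_closure G (generate G {x})"
        using normal_closure_props(2)[OF sub] generate.incl[of x "{x}" G] by blast
      then show ?thesis
        using normal_closure_chernikov[OF n CL[OF normal_imp_subgroup[OF n] proper[OF x]] _ refl] by blast
    qed
    have "carrier G \<noteq> {\<one>}" using nCh chernikov_finite_subgroup[OF subgroup_self] by auto
    then obtain H R where H: "H \<lhd> G" "H \<noteq> carrier G"
      and R: "finite R" "R \<subseteq> carrier G" "\<And>x. x \<in> carrier G \<Longrightarrow> \<exists>a\<in>H. \<exists>r\<in>R. x = a \<otimes> r"
      using ex_proper_finite_index[OF gen X(2,1) m0 _ chq] by metis
    show False
      using chernikov_of_proper_finite_index[OF periodic gen X(2,1) m0 H(1) CL[OF normal_imp_subgroup[OF H(1)] H(2)] R ch] nCh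
      by blast
  qed
qed

theorem theorem2p8:
  fixes G :: "('a, 'b) monoid_scheme"
  assumes "minimal_non CL_group G"
  shows "minimal_non CC_group G"
proof -
  interpret group G using assms by (simp add: minimal_non_def)
  have CL: "CL_group (G\<lparr>carrier := H\<rparr>)" if "subgroup H G" "H \<noteq> carrier G" for H
    using assms that by (simp add: minimal_non_def)
  have "\<not> CC_group G" using CC_group_imp_CL_group[OF CL] assms by (auto simp: minimal_non_def)
  moreover have "CC_group (G\<lparr>carrier := H\<rparr>)" if "subgroup H G" "H \<noteq> carrier G" for H
    using CL_group_imp_CC_group[OF CL[OF that]] .
  ultimately show ?thesis using group_axioms by (simp add: minimal_non_def)
qed

end
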